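(* Let $d\geqslant 2$ be an integer. The set $\mathcal{M}_d$ of all primitive majors $M\in PM(d)$ at which the core entropy function $h:PM(d)\to\mathbb{R}$ attains its global maximum over $PM(d)$ consists of exactly $d-1$ elements. Let $S(z)=z+\frac{1}{d-1}\bmod 1$ act on $PM(d)$ by applying $S$ to the endpoints of every leaf, and call $M,M'\in PM(d)$ equivalent under $S$ if $M'=S^k(M)$ for some integer $k$. If $d$ is even, then all elements of $\mathcal{M}_d$ are equivalent under $S$. If $d$ is odd, then $\mathcal{M}_d$ consists of exactly two equivalence classes under $S$.
   Context: Identify the unit circle $S^1=\partial\mathbb{D}$ with $[0,1)=\mathbb{R}/\mathbb{Z}$ and let $T(x)=dx\bmod 1$. Primitive majors. A primitive major of degree $d$ is a finite set $M=\{L_1,\dots,L_r\}$ of ideal polygons (called leaves; an ideal line, with two endpoints, is allowed) in the closed unit disc such that: (1) the leaves are pairwise disjoint (including their endpoints); (2) for each $j$, all endpoints $\partial L_j:=\partial\mathbb{D}\cap L_j$ of $L_j$ have the same image under $T$ (this common image is denoted $T(L_j)$, and $T^n(L_j):=T^{n-1}(T(L_j))$ for $n\geqslant 1$); (3) $\sum_{j=1}^r(|\partial\mathbb{D}\cap L_j|-1)=d-1$. $PM(d)$ is the set of all primitive majors of degree $d$, and $RPM(d)\subset PM(d)$ is the subset of rational primitive majors, i.e. those all of whose leaves have rational endpoints. Topology on $PM(d)$. For $M\in PM(d)$ let $\delta_M$ be the largest pseudometric on $S^1$ that is bounded above by arc-length distance and for which any two endpoints of a common leaf of $M$ are at distance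 $0$. $PM(d)$ carries the metric $\mathrm{dist}(M,M')=\sup_{x,y\in S^1}|\delta_M(x,y)-\delta_{M'}(x,y)|$; $RPM(d)$ is dense in it. Separation. A leaf $L_j$ separates $x,y\in S^1$ if $x$ and $y$ lie in different connected components of $S^1\setminus\partial L_j$. The separation vector of an ordered pair $(x,y)$ is $(L_{a_1},\dots,L_{a_s})$, the list of all leaves of $M$ separating $x$ from $y$, in the order in which they are crossed by the geodesic from $x$ to $y$; it is $\emptyset$ if no leaf separates them. Thurston graph. Let $P=\{T^i(L_j): i\geqslant 1,\ 1\leqslant j\leqslant r\}$. The directed graph $G(M)$ (multiple edges counted with multiplicity) has as vertices the unordered pairs $\{x,y\}$ with $x,y\in P$ (possibly $x=y$). If $x\neq y$ are endpoints of a common leaf, $\{x,y\}$ has no outgoing edges. Otherwise, if no leaf separates $x$ and $y$, there is exactly one outgoing edge, to $\{T(x),T(y)\}$. Otherwise, if $(x,y)$ has separation vector $(L_{a_1},\dots,L_{a_s})$ with $s\geqslant 1$, there are $s+1$ outgoing edges: to $\{T(x),T(L_{a_1})\}$, to $\{T(L_{a_i}),T(L_{a_{i+1}})\}$ for $1\leqslant i\leqslant s-1$, and to $\{T(L_{a_s}),T(y)\}$. Core entropy. For $m\in RPM(d)$ the graph $G(m)$ is finite; let $\rho(m)$ be the leading eigenvalue (spectral radius) of its adjacency matrix and set $h(m)=\log\rho(m)$. By known results of Tiozzo and Gao–Tiozzo, $h$ extends uniquely to a continuous function $h:PM(d)\to\mathbb{R}$, called core entropy. *)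

theory Defs
  imports "HOL-Analysis.Analysis" "Jordan_Normal_Form.Spectral_Radius"
begin

(* The circle R/Z is represented by {0..<1}, and circle_point embeds it into the complex plane. *)

abbreviation circle :: "real set" where
  "circle \<equiv> {0..<1}"

definition circle_point :: "real \<Rightarrow> complex" where
  "circle_point x = cis (2 * pi * x)"

definition circle_map :: "nat \<Rightarrow> real \<Rightarrow> real" where
  "circle_map d x = frac (real d * x)"

(* A leaf is stored as its set of endpoints.  The ideal polygon spanned by them is drawn in the
   Klein model of the disc, where hyperbolic geodesics are straight chords, so it is a convex hull;
   it meets the unit circle exactly in the given endpoints. *)

definition leaf_polygon :: "real set \<Rightarrow> complex set" where
  "leaf_polygon L = convex hull (circle_point ` L)"

(* Only meaningful for a leaf all of whose endpoints have the same image. *)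
definition leaf_image :: "nat \<Rightarrow> real set \<Rightarrow> real" where
  "leaf_image d L = the_elem (circle_map d ` L)"

definition primitive_major :: "nat \<Rightarrow> real set set \<Rightarrow> bool" where
  "primitive_major d M \<longleftrightarrow>
     finite M \<and>
     (\<forall>L\<in>M. L \<subseteq> circle \<and> finite L \<and> 2 \<le> card L) \<and>
     (\<forall>L\<in>M. \<forall>L'\<in>M. L \<noteq> L' \<longrightarrow> disjnt (leaf_polygon L) (leaf_polygon L')) \<and>
     (\<forall>L\<in>M. \<forall>x\<in>L. \<forall>y\<in>L. circle_map d x = circle_map d y) \<and>
     (\<Sum>L\<in>M. card L - 1) = d - 1"

definition PM :: "nat \<Rightarrow> real set set set" where
  "PM d = {M. primitive_major d M}"

definition RPM :: "nat \<Rightarrow> real set set set" where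
  "RPM d = {M \<in> PM d. \<forall>L\<in>M. L \<subseteq> \<rat>}"

(* Arc length on R/Z, i.e. normalised so that the circle has length 1. *)
definition arc_dist :: "real \<Rightarrow> real \<Rightarrow> real" where
  "arc_dist x y = min \<bar>x - y\<bar> (1 - \<bar>x - y\<bar>)"

definition pseudometric_on :: "'a set \<Rightarrow> ('a \<Rightarrow> 'a \<Rightarrow> real) \<Rightarrow> bool" where
  "pseudometric_on A \<rho> \<longleftrightarrow>
     (\<forall>x\<in>A. \<rho> x x = 0) \<and>
     (\<forall>x\<in>A. \<forall>y\<in>A. 0 \<le> \<rho> x y \<and> \<rho> x y = \<rho> y x) \<and>
     (\<forall>x\<in>A. \<forall>y\<in>A. \<forall>z\<in>A. \<rho> x z \<le> \<rho> x y + \<rho> y z)"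

definition leaf_pseudometrics :: "real set set \<Rightarrow> (real \<Rightarrow> real \<Rightarrow> real) set" where
  "leaf_pseudometrics M =
     {\<rho>. pseudometric_on circle \<rho> \<and>
          (\<forall>x\<in>circle. \<forall>y\<in>circle. \<rho> x y \<le> arc_dist x y) \<and>
          (\<forall>L\<in>M. \<forall>x\<in>L. \<forall>y\<in>L. \<rho> x y = 0)}"

(* The largest element of leaf_pseudometrics M; see leaf_dist_in and leaf_dist_greatest. *)
definition leaf_dist :: "real set set \<Rightarrow> real \<Rightarrow> real \<Rightarrow> real" where
  "leaf_dist M x y = (SUP \<rho>\<in>leaf_pseudometrics M. \<rho> x y)"

definition PM_dist :: "real set set \<Rightarrow> real set set \<Rightarrow> real" where
  "PM_dist M M' = (SUP (x, y)\<in>circle \<times> circle. \<bar>leaf_dist M x y - leaf_dist M' x y\<bar>)"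

lemma arc_dist_self [simp]: "arc_dist x x = 0"
  by (simp add: arc_dist_def)

lemma arc_dist_commute: "arc_dist x y = arc_dist y x"
  by (simp add: arc_dist_def abs_minus_commute)

lemma arc_dist_bounds:
  "x \<in> circle \<Longrightarrow> y \<in> circle \<Longrightarrow> 0 \<le> arc_dist x y \<and> arc_dist x y \<le> 1"
  by (auto simp: arc_dist_def)

lemma arc_dist_pos:
  "x \<in> circle \<Longrightarrow> y \<in> circle \<Longrightarrow> x \<noteq> y \<Longrightarrow> 0 < arc_dist x y"
  by (auto simp: arc_dist_def)

lemma arc_dist_triangle:
  "x \<in> circle \<Longrightarrow> y \<in> circle \<Longrightarrow> z \<in> circle \<Longrightarrow> arc_dist x z \<le> arc_dist x y + arc_dist y z"
  by (auto simp: arc_dist_def)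

lemma zero_leaf_pseudometric: "(\<lambda>_ _. 0) \<in> leaf_pseudometrics M"
  by (auto simp: leaf_pseudometrics_def pseudometric_on_def dest: arc_dist_bounds)

lemma leaf_dist_bdd:
  assumes "x \<in> circle" "y \<in> circle"
  shows "bdd_above ((\<lambda>\<rho>. \<rho> x y) ` leaf_pseudometrics M)"
  using assms by (intro bdd_aboveI[of _ "arc_dist x y"]) (auto simp: leaf_pseudometrics_def)

lemma leaf_dist_greatest:
  assumes "\<rho> \<in> leaf_pseudometrics M" "x \<in> circle" "y \<in> circle"
  shows "\<rho> x y \<le> leaf_dist M x y"
  unfolding leaf_dist_def by (rule cSUP_upper[OF assms(1) leaf_dist_bdd[OF assms(2,3)]])

lemma leaf_dist_least:
  assumes "\<And>\<rho>. \<rho> \<in> leaf_pseudometrics M \<Longrightarrow> \<rho> x y \<le> c"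
  shows "leaf_dist M x y \<le> c"
  unfolding leaf_dist_def
  by (rule cSUP_least) (use zero_leaf_pseudometric assms in auto)

lemma leaf_dist_nonneg:
  assumes "x \<in> circle" "y \<in> circle"
  shows "0 \<le> leaf_dist M x y"
  using leaf_dist_greatest[OF zero_leaf_pseudometric assms] by simp

lemma leaf_dist_le_arc:
  assumes "x \<in> circle" "y \<in> circle"
  shows "leaf_dist M x y \<le> arc_dist x y"
  by (rule leaf_dist_least) (use assms in \<open>auto simp: leaf_pseudometrics_def\<close>)

lemma leaf_dist_in:
  assumes "\<And>L. L \<in> M \<Longrightarrow> L \<subseteq> circle"
  shows "leaf_dist M \<in> leaf_pseudometrics M"
proof -
  have tri: "leaf_dist M x z \<le> leaf_dist M x y + leaf_dist M y z"
    if xyz: "x \<in> circle" "y \<in> circle" "z \<in> circle" for x y z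
  proof (rule leaf_dist_least)
    fix \<rho> assume \<rho>: "\<rho> \<in> leaf_pseudometrics M"
    have "\<rho> x z \<le> \<rho> x y + \<rho> y z"
      using \<rho> xyz unfolding leaf_pseudometrics_def pseudometric_on_def by blast
    then show "\<rho> x z \<le> leaf_dist M x y + leaf_dist M y z"
      using leaf_dist_greatest[OF \<rho> xyz(1,2)] leaf_dist_greatest[OF \<rho> xyz(2,3)] by linarith
  qed
  have le: "leaf_dist M x y \<le> leaf_dist M y x" if xy: "x \<in> circle" "y \<in> circle" for x y
  proof (rule leaf_dist_least)
    fix \<rho> assume \<rho>: "\<rho> \<in> leaf_pseudometrics M"
    have "\<rho> x y = \<rho> y x"
      using \<rho> xy unfolding leaf_pseudometrics_def pseudometric_on_def by blast
    then show "\<rho> x y \<le> leaf_dist M y x"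
      using leaf_dist_greatest[OF \<rho> xy(2,1)] by simp
  qed
  have sym: "leaf_dist M x y = leaf_dist M y x" if "x \<in> circle" "y \<in> circle" for x y
    using le that by (meson order_antisym)
  have zero: "leaf_dist M x x = 0" if "x \<in> circle" for x
    using leaf_dist_le_arc[OF that that, of M] leaf_dist_nonneg[OF that that, of M] by simp
  have leaf: "leaf_dist M x y = 0" if "L \<in> M" "x \<in> L" "y \<in> L" for L x y
  proof (rule order_antisym)
    show "leaf_dist M x y \<le> 0"
      by (rule leaf_dist_least) (use that in \<open>auto simp: leaf_pseudometrics_def\<close>)
    show "0 \<le> leaf_dist M x y"
      using that assms by (intro leaf_dist_nonneg) (blast dest: subsetD)+
  qed
  have pseudo: "pseudometric_on circle (leaf_dist M)"
    unfolding pseudometric_on_def by (intro conjI ballI) (fact zero leaf_dist_nonneg sym tri)+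
  show ?thesis
    unfolding leaf_pseudometrics_def by (intro CollectI conjI ballI) (fact pseudo leaf_dist_le_arc leaf)+
qed

lemma PM_leaves_disjoint:
  assumes "M \<in> PM d" "L \<in> M" "L' \<in> M" "x \<in> L" "x \<in> L'"
  shows "L = L'"
proof (rule ccontr)
  assume "L \<noteq> L'"
  then have "disjnt (leaf_polygon L) (leaf_polygon L')"
    using assms by (auto simp: PM_def primitive_major_def)
  moreover have "circle_point x \<in> leaf_polygon L" "circle_point x \<in> leaf_polygon L'"
    using assms by (auto simp: leaf_polygon_def intro!: hull_inc)
  ultimately show False
    by (auto simp: disjnt_def)
qed

lemma leaf_dist_eq_0_iff:
  assumes M: "M \<in> PM d" and xy: "x \<in> circle" "y \<in> circle"
  shows "leaf_dist M x y = 0 \<longleftrightarrow> x = y \<or> (\<exists>L\<in>M. x \<in> L \<and> y \<in> L)"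
proof
  have sub: "\<And>L. L \<in> M \<Longrightarrow> L \<subseteq> circle" and fin: "finite M" "\<And>L. L \<in> M \<Longrightarrow> finite L"
    using M by (auto simp: PM_def primitive_major_def)
  show "leaf_dist M x y = 0" if "x = y \<or> (\<exists>L\<in>M. x \<in> L \<and> y \<in> L)"
  proof -
    have "leaf_dist M \<in> leaf_pseudometrics M" by (rule leaf_dist_in[OF sub])
    then show ?thesis
      using that xy(1) by (elim disjE bexE conjE) (simp_all add: leaf_pseudometrics_def pseudometric_on_def)
  qed
  show "x = y \<or> (\<exists>L\<in>M. x \<in> L \<and> y \<in> L)" if 0: "leaf_dist M x y = 0"
  proof (rule ccontr)
    assume neg: "\<not> ?thesis"
    define A where "A = (if \<exists>L\<in>M. x \<in> L then (THE L. L \<in> M \<and> x \<in> L) else {x})"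
    have A_leaf: "A = L" if "L \<in> M" "x \<in> L" for L
    proof -
      have "(THE L. L \<in> M \<and> x \<in> L) = L"
        by (rule the_equality) (use that PM_leaves_disjoint[OF M] in blast)+
      then show ?thesis using that by (auto simp: A_def)
    qed
    have "x \<in> A \<and> y \<notin> A \<and> finite A \<and> A \<subseteq> circle"
    proof (cases "\<exists>L\<in>M. x \<in> L")
      case True
      then obtain L where L: "L \<in> M" "x \<in> L" by blast
      then show ?thesis using A_leaf[OF L] neg fin(2)[OF L(1)] sub[OF L(1)] by blast
    next
      case False
      then have "A = {x}" by (simp add: A_def)
      then show ?thesis using neg xy by auto
    qed
    then have xA: "x \<in> A" and yA: "y \<notin> A" and finA: "finite A" and subA: "A \<subseteq> circle"
      by blast+
    have A_disj: "L = A \<or> L \<inter> A = {}" if "L \<in> M" for L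
    proof (cases "\<exists>K\<in>M. x \<in> K")
      case True
      then show ?thesis using A_leaf that PM_leaves_disjoint[OF M] by blast
    next
      case False
      then show ?thesis using that by (auto simp: A_def)
    qed
    define F where "F = insert y (\<Union>M) - A"
    define E where "E = insert 1 ((\<lambda>(a, u). arc_dist a u) ` (A \<times> F))"
    have finF: "finite F" and subF: "F \<subseteq> circle" and yF: "y \<in> F"
    proof -
      show "finite F" using fin by (simp add: F_def)
      show "F \<subseteq> circle" using sub xy(2) unfolding F_def by blast
      show "y \<in> F" using yA by (simp add: F_def)
    qed
    have finE: "finite E" using finA finF by (auto simp: E_def)
    define e where "e = Min E"
    have "0 < arc_dist a u" if "a \<in> A" "u \<in> F" for a u
    proof (rule arc_dist_pos)
      show "a \<in> circle" "u \<in> circle" using that subA subF by blast+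
      show "a \<noteq> u" using that by (auto simp: F_def)
    qed
    then have e_pos: "0 < e"
      unfolding e_def using finE by (subst Min_gr_iff) (auto simp: E_def)
    define f where "f u = min e (Min ((\<lambda>a. arc_dist a u) ` A))" for u
    have f_A: "f u = 0" if "u \<in> A" for u
    proof -
      have "Min ((\<lambda>a. arc_dist a u) ` A) = 0"
      proof (rule Min_eqI)
        show "0 \<in> (\<lambda>a. arc_dist a u) ` A"
          using that by (intro rev_image_eqI[of u]) simp_all
        show "0 \<le> y" if "y \<in> (\<lambda>a. arc_dist a u) ` A" for y
          using that \<open>u \<in> A\<close> subA arc_dist_bounds by blast
      qed (use finA in simp)
      then show ?thesis using e_pos by (simp add: f_def)
    qed
    have f_F: "f u = e" if "u \<in> F" for u
    proof -
      have "e \<le> Min ((\<lambda>a. arc_dist a u) ` A)"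
        using that finA xA finE by (subst Min_ge_iff) (auto simp: e_def E_def intro!: Min_le)
      then show ?thesis by (simp add: f_def)
    qed
    have f_Lip: "f u - f v \<le> arc_dist u v" if uv: "u \<in> circle" "v \<in> circle" for u v
    proof -
      have "Min ((\<lambda>a. arc_dist a v) ` A) \<in> (\<lambda>a. arc_dist a v) ` A"
        using finA xA by (intro Min_in) auto
      then obtain a where a: "a \<in> A" "Min ((\<lambda>a. arc_dist a v) ` A) = arc_dist a v" by auto
      have "Min ((\<lambda>a. arc_dist a u) ` A) \<le> arc_dist a u" using a finA by auto
      also have "\<dots> \<le> arc_dist a v + arc_dist u v"
        using arc_dist_triangle[of a v u] a(1) subA uv arc_dist_commute[of u v] by auto
      finally show ?thesis using a(2) arc_dist_bounds[OF uv] unfolding f_def by linarith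
    qed
    define \<rho> where "\<rho> u v = \<bar>f u - f v\<bar>" for u v
    have "\<rho> u v \<le> arc_dist u v" if "u \<in> circle" "v \<in> circle" for u v
      using f_Lip[OF that] f_Lip[OF that(2,1)] arc_dist_commute[of u v] by (simp add: \<rho>_def)
    moreover have "\<rho> u v = 0" if L: "L \<in> M" "u \<in> L" "v \<in> L" for L u v
      using A_disj[OF L(1)]
    proof
      assume "L = A"
      then show ?thesis using L f_A by (simp add: \<rho>_def)
    next
      assume "L \<inter> A = {}"
      then have "u \<in> F" "v \<in> F" using L by (auto simp: F_def)
      then show ?thesis using f_F by (simp add: \<rho>_def)
    qed
    moreover have "pseudometric_on circle \<rho>"
      unfolding pseudometric_on_def \<rho>_def by (intro conjI ballI) linarith+
    ultimately have "\<rho> \<in> leaf_pseudometrics M"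
      unfolding leaf_pseudometrics_def by blast
    from leaf_dist_greatest[OF this xy] show False
      using 0 f_A[OF xA] f_F[OF yF] e_pos by (simp add: \<rho>_def)
  qed
qed

lemma PM_eq_of_leaf_dist:
  assumes M: "M \<in> PM d" and M': "M' \<in> PM d"
    and eq: "\<And>x y. x \<in> circle \<Longrightarrow> y \<in> circle \<Longrightarrow> leaf_dist M x y = leaf_dist M' x y"
  shows "M \<subseteq> M'"
proof
  fix L assume L: "L \<in> M"
  then have sub: "L \<subseteq> circle" and card: "2 \<le> card L"
    using M by (auto simp: PM_def primitive_major_def)
  have sub': "\<And>K. K \<in> M' \<Longrightarrow> K \<subseteq> circle" using M' by (auto simp: PM_def primitive_major_def)
  have rel: "(\<exists>K\<in>M. x \<in> K \<and> y \<in> K) \<longleftrightarrow> (\<exists>K\<in>M'. x \<in> K \<and> y \<in> K)"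
    if "x \<in> circle" "y \<in> circle" "x \<noteq> y" for x y
    using leaf_dist_eq_0_iff[OF M that(1,2)] leaf_dist_eq_0_iff[OF M' that(1,2)] eq that by auto
  obtain x y where xy: "x \<in> L" "y \<in> L" "x \<noteq> y"
    using card by (metis card_2_iff' obtain_subset_with_card_n subset_iff)
  then obtain K where K: "K \<in> M'" "x \<in> K" "y \<in> K" using rel L sub by blast
  have "L \<subseteq> K"
  proof
    fix z assume z: "z \<in> L"
    show "z \<in> K"
    proof (cases "z = x")
      case False
      then obtain K' where "K' \<in> M'" "x \<in> K'" "z \<in> K'" using rel[of x z] L sub z xy by blast
      then show ?thesis using PM_leaves_disjoint[OF M' _ K(1) _ K(2)] by blast
    qed (use K in simp)
  qed
  moreover have "K \<subseteq> L"
  proof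
    fix z assume z: "z \<in> K"
    show "z \<in> L"
    proof (cases "z = x")
      case False
      then obtain K' where "K' \<in> M" "x \<in> K'" "z \<in> K'"
        using rel[of x z] K sub'[OF K(1)] z by blast
      then show ?thesis using PM_leaves_disjoint[OF M _ L _ xy(1)] by blast
    qed (use xy in simp)
  qed
  ultimately show "L \<in> M'" using K(1) by simp
qed

lemma leaf_dist_diff_le_1:
  assumes "x \<in> circle" "y \<in> circle"
  shows "\<bar>leaf_dist M x y - leaf_dist M' x y\<bar> \<le> 1"
  using leaf_dist_nonneg[OF assms] leaf_dist_le_arc[OF assms] arc_dist_bounds[OF assms]
  by (smt (verit))

lemma PM_dist_upper:
  assumes "x \<in> circle" "y \<in> circle"
  shows "\<bar>leaf_dist M x y - leaf_dist M' x y\<bar> \<le> PM_dist M M'"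
proof -
  have "bdd_above ((\<lambda>(x, y). \<bar>leaf_dist M x y - leaf_dist M' x y\<bar>) ` (circle \<times> circle))"
    by (intro bdd_aboveI[of _ 1]) (use leaf_dist_diff_le_1 in force)
  from cSUP_upper[OF _ this, of "(x, y)"] show ?thesis
    using assms by (simp add: PM_dist_def)
qed

lemma PM_dist_least:
  assumes "\<And>x y. x \<in> circle \<Longrightarrow> y \<in> circle \<Longrightarrow> \<bar>leaf_dist M x y - leaf_dist M' x y\<bar> \<le> c"
  shows "PM_dist M M' \<le> c"
  unfolding PM_dist_def using assms by (intro cSUP_least) auto

lemma Metric_space_PM: "Metric_space (PM d) PM_dist"
proof
  show nonneg: "0 \<le> PM_dist M M'" for M M'
    using PM_dist_upper[of 0 0 M M'] by simp
  show "PM_dist M M' = PM_dist M' M" for M M'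
    by (simp add: PM_dist_def abs_minus_commute)
  show "PM_dist M M' = 0 \<longleftrightarrow> M = M'" if "M \<in> PM d" "M' \<in> PM d" for M M'
  proof
    assume 0: "PM_dist M M' = 0"
    have "leaf_dist M x y = leaf_dist M' x y" if "x \<in> circle" "y \<in> circle" for x y
      using PM_dist_upper[OF that, of M M'] 0 by simp
    then show "M = M'"
      using PM_eq_of_leaf_dist[OF that] PM_eq_of_leaf_dist[OF that(2,1)] by (metis order_antisym)
  next
    assume "M = M'"
    then show "PM_dist M M' = 0"
      using PM_dist_least[of M M' 0] nonneg[of M M'] by simp
  qed
  show "PM_dist M M'' \<le> PM_dist M M' + PM_dist M' M''" for M M' M''
  proof (rule PM_dist_least)
    fix x y :: real assume "x \<in> circle" "y \<in> circle"
    then show "\<bar>leaf_dist M x y - leaf_dist M'' x y\<bar> \<le> PM_dist M M' + PM_dist M' M''"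
      using PM_dist_upper[of x y M M'] PM_dist_upper[of x y M' M''] by linarith
  qed
qed

definition leaf_separates :: "real set \<Rightarrow> real \<Rightarrow> real \<Rightarrow> bool" where
  "leaf_separates L x y \<longleftrightarrow>
     x \<notin> L \<and> y \<notin> L \<and>
     \<not> connected_component (sphere 0 1 - circle_point ` L) (circle_point x) (circle_point y)"

(* First time at which the geodesic from x to y (a chord of the Klein disc) hits the polygon of L. *)
definition crossing_time :: "real \<Rightarrow> real \<Rightarrow> real set \<Rightarrow> real" where
  "crossing_time x y L =
     Inf {t \<in> {0..1}. linepath (circle_point x) (circle_point y) t \<in> leaf_polygon L}"

definition separation_vector :: "real set set \<Rightarrow> real \<Rightarrow> real \<Rightarrow> real set list" where
  "separation_vector M x y =
     sorted_key_list_of_set (crossing_time x y) {L \<in> M. leaf_separates L x y}"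

definition postcritical :: "nat \<Rightarrow> real set set \<Rightarrow> real set" where
  "postcritical d M = {(circle_map d ^^ n) (leaf_image d L) |n L. L \<in> M}"

(* The unordered pair of x and y is the set {x, y}, a singleton if x = y. *)
definition thurston_vertices :: "nat \<Rightarrow> real set set \<Rightarrow> real set set" where
  "thurston_vertices d M = {{x, y} |x y. x \<in> postcritical d M \<and> y \<in> postcritical d M}"

(* Targets of the outgoing edges: consecutive pairs of the list T x, T L1, ..., T Ls, T y.
   For s = 0 this is the single pair of T x and T y. *)
definition pair_targets :: "nat \<Rightarrow> real set set \<Rightarrow> real \<Rightarrow> real \<Rightarrow> real set multiset" where
  "pair_targets d M x y =
     (if x \<noteq> y \<and> (\<exists>L\<in>M. x \<in> L \<and> y \<in> L) then {#}
      else let ps = circle_map d x # map (leaf_image d) (separation_vector M x y) @ [circle_map d y]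
           in mset (map2 (\<lambda>p q. {p, q}) (butlast ps) (tl ps)))"

(* Min and Max merely choose an order on the pair: swapping x and y reverses the separation
   vector, which leaves the multiset of targets unchanged. *)
definition thurston_targets :: "nat \<Rightarrow> real set set \<Rightarrow> real set \<Rightarrow> real set multiset" where
  "thurston_targets d M v = pair_targets d M (Min v) (Max v)"

(* The spectral radius does not depend on the chosen enumeration of the vertices. *)
definition thurston_matrix :: "nat \<Rightarrow> real set set \<Rightarrow> complex mat" where
  "thurston_matrix d M =
     (let vs = (SOME vs. distinct vs \<and> set vs = thurston_vertices d M)
      in Matrix.mat (length vs) (length vs)
           (\<lambda>(i, j). of_nat (count (thurston_targets d M (vs ! i)) (vs ! j))))"

definition rational_core_entropy :: "nat \<Rightarrow> real set set \<Rightarrow> real" where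
  "rational_core_entropy d m = ln (spectral_radius (thurston_matrix d m))"

(* Values of h outside PM d are irrelevant.  Since RPM d is dense in PM d, at most one h on PM d
   satisfies this; its existence is a theorem of Tiozzo and Gao-Tiozzo. *)
definition is_core_entropy :: "nat \<Rightarrow> (real set set \<Rightarrow> real) \<Rightarrow> bool" where
  "is_core_entropy d h \<longleftrightarrow>
     continuous_map (Metric_space.mtopology (PM d) PM_dist) euclideanreal h \<and>
     (\<forall>m\<in>RPM d. h m = rational_core_entropy d m)"

definition entropy_maximizers :: "nat \<Rightarrow> (real set set \<Rightarrow> real) \<Rightarrow> real set set set" where
  "entropy_maximizers d h = {M \<in> PM d. \<forall>M'\<in>PM d. h M' \<le> h M}"

definition circle_shift :: "nat \<Rightarrow> real \<Rightarrow> real" where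
  "circle_shift d z = frac (z + 1 / (real d - 1))"

definition shift_major :: "nat \<Rightarrow> real set set \<Rightarrow> real set set" where
  "shift_major d M = (\<lambda>L. circle_shift d ` L) ` M"

(* The second disjunct accounts for negative powers of the shift. *)
definition shift_equiv :: "nat \<Rightarrow> (real set set \<times> real set set) set" where
  "shift_equiv d =
     {(M, M') \<in> PM d \<times> PM d.
        \<exists>k. M' = (shift_major d ^^ k) M \<or> M = (shift_major d ^^ k) M'}"

end

theory Submission
  imports Defs
begin

text \<open>
  The maximal core entropy is \<open>ln d\<close>.  Its maximizers are the \<^emph>\<open>Chebyshev majors\<close>: for an axis
  \<open>a = j / (2 (d - 1))\<close> the reflection \<open>z \<mapsto> 2 a - z\<close> commutes with multiplication by \<open>d\<close>, and the
  leaves join \<open>a + k / (2 d)\<close> to its mirror image \<open>a - k / (2 d)\<close> for \<open>0 < k < d\<close>.  The value of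
  \<open>j\<close> matters modulo \<open>d - 1\<close>, and the rotation by \<open>1 / (d - 1)\<close> replaces \<open>j\<close> by \<open>j + 2\<close>; this
  gives \<open>d - 1\<close> majors in one orbit if \<open>d - 1\<close> is odd and in two orbits if it is even.

  A major has at most \<open>d - 1\<close> leaves, so every vertex of a Thurston graph has at most \<open>d\<close> outgoing
  edges, and the spectral radius is at most \<open>d\<close>.  Rational majors are dense
  (\<open>rational_majors_dense\<close>: rotate each leaf by a small amount of its own), hence the
  bound passes to all majors by continuity.  For a Chebyshev major all \<open>d\<close> edges that leave the pair
  \<open>{a, a + 1/2}\<close> return to it, so \<open>ln d\<close> is attained (\<open>chebyshev_entropy\<close>).

  For uniqueness let \<open>h M = ln d\<close>.  If every vertex of the graph of a rational major had a path of
  length less than \<open>n\<close> to a vertex of outdegree less than \<open>d\<close>, there would be at most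
  \<open>d ^ n - 1\<close> paths of length \<open>n\<close> from each vertex and the spectral radius would be bounded away
  from \<open>d\<close> (\<open>spectral_radius_power_le\<close>).  So rational majors \<open>m\<close> close to \<open>M\<close> have, for any given
  \<open>n\<close>, a vertex from which all paths of length less than \<open>n\<close> meet only vertices of outdegree \<open>d\<close>.
  Outdegree \<open>d\<close> forces \<open>m\<close> to consist of \<open>d - 1\<close> lines, all of which separate the two points of the
  vertex.  They are therefore parallel, and all points that occur on these paths lie in the two
  arcs of length \<open>1 / d\<close> that the outermost leaves cut off.

  Two things follow.  As the map expands by the factor \<open>d\<close> and the points stay in the two arcs for
  about \<open>n\<close> steps, all points in one arc agree up to \<open>d ^ -n\<close> (\<open>E_contract\<close>).  And
  the leaves subdivide the arc from \<open>p\<close> to \<open>q\<close> into \<open>d\<close> pieces that are mapped alternately onto an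
  arc from one end to the other and onto a complementary arc; as these arcs have almost
  the same lengths \<open>q - p\<close> and \<open>1 - (q - p)\<close> throughout, adding up gives \<open>q - p \<approx> 1/2\<close> and shows
  that all inner pieces have length about \<open>1 / (2 d)\<close> (\<open>E_geometry\<close>).  So \<open>m\<close>, and with it \<open>M\<close>,
  is as close as desired to one of finitely many Chebyshev majors, and thus equal to one of them.
\<close>

section \<open>Points on the circle\<close>

lemma frac_circle [simp]: "frac x \<in> circle" for x :: real
  by (simp add: frac_lt_1)

lemma circle_map_circle [simp]: "circle_map d x \<in> circle"
  by (simp add: circle_map_def frac_lt_1)

lemma circle_map_bounds [simp]: "0 \<le> circle_map d x" "circle_map d x < 1"
  by (simp_all add: circle_map_def frac_lt_1)

lemma frac_circle_eq: "x \<in> circle \<Longrightarrow> frac x = x"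
  by (simp add: frac_eq)

lemma frac_eq_frac_iff: "frac x = frac y \<longleftrightarrow> x - y \<in> \<int>" for x y :: real
proof
  assume "frac x = frac y"
  then have "x - y = of_int (\<lfloor>x\<rfloor> - \<lfloor>y\<rfloor>)" by (simp add: frac_def)
  then show "x - y \<in> \<int>" by (metis Ints_of_int)
next
  assume "x - y \<in> \<int>"
  then obtain k where "x - y = of_int k" by (auto elim: Ints_cases)
  then have "x = y + of_int k" by simp
  then show "frac x = frac y" by simp
qed

lemma not_in_Ints_between: "of_int n < x \<Longrightarrow> x < of_int n + 1 \<Longrightarrow> (x::real) \<notin> \<int>"
proof
  assume x: "of_int n < x" "x < of_int n + 1" "x \<in> \<int>"
  then obtain k where "x = of_int k" by (auto elim: Ints_cases)
  then have "n < k" "k < n + 1" using x by linarith+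
  then show False by simp
qed

lemma frac_add_inj:
  assumes "x \<in> circle" "y \<in> circle" "frac (x + t) = frac (y + t)"
  shows "x = y"
proof -
  have "x + t - (y + t) = of_int (\<lfloor>x + t\<rfloor> - \<lfloor>y + t\<rfloor>)" using assms(3) by (simp add: frac_def)
  then have "x - y = of_int (\<lfloor>x + t\<rfloor> - \<lfloor>y + t\<rfloor>)" by simp
  moreover have "\<bar>x - y\<bar> < 1" using assms by auto
  ultimately have "\<lfloor>x + t\<rfloor> - \<lfloor>y + t\<rfloor> = 0" by linarith
  with \<open>x - y = _\<close> show ?thesis by simp
qed

lemma frac_diff_unique:
  assumes "frac x = frac x'" "frac y = frac y'" "0 < y - x" "y - x < 1" "r - (y' - x') \<in> \<int>" "0 < r" "r < (1::real)"
  shows "y - x = r"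
proof -
  have eq: "(y - x) - r = (y - y') - (x - x') - (r - (y' - x'))" by simp
  have "y - y' \<in> \<int>" "x - x' \<in> \<int>" using assms(1,2) by (simp_all add: frac_eq_frac_iff)
  then have "(y - y') - (x - x') - (r - (y' - x')) \<in> \<int>"
    by (rule Ints_diff[OF Ints_diff assms(5)])
  then have "(y - x) - r \<in> \<int>" by (simp only: eq)
  then show ?thesis
    using assms not_in_Ints_between[of 0 "(y - x) - r"] not_in_Ints_between[of "-1" "(y - x) - r"]
    by (cases "y - x" r rule: linorder_cases) auto
qed

text \<open>
  A fundamental domain may start at any point; this frees later arguments from wrapping around 0.
\<close>

lemma lift_exists:
  assumes "x \<in> circle" obtains t where "a \<le> t" "t < a + 1" "frac t = x"
proof
  show "a \<le> a + frac (x - a)" "a + frac (x - a) < a + 1" by (auto simp: frac_lt_1)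
  show "frac (a + frac (x - a)) = x"
  proof -
    have "a + frac (x - a) = x + of_int (- \<lfloor>x - a\<rfloor>)" by (simp add: frac_def)
    then show ?thesis using assms by (simp only: frac_add_of_int_right frac_circle_eq)
  qed
qed

lemma frac_half: "frac (a + of_int k / 2) = (if even k then frac a else frac (a + 1/2))" for a :: real
proof (cases "even k")
  case True
  then obtain m where "k = 2 * m" by blast
  then show ?thesis by simp
next
  case False
  then obtain m where "k = 2 * m + 1" by (metis oddE)
  then have "a + of_int k / 2 = (a + 1/2) + of_int m" by simp
  then show ?thesis using False by (simp only: frac_add_of_int_right if_False)
qed

lemma half_turn_pair: "{frac (a + of_int k / 2), frac (a + of_int (k + 1) / 2)} = {frac a, frac (a + 1/2)}" for a :: real
  by (simp only: frac_half) auto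

lemma frac_half_neq: "frac a \<noteq> frac (a + 1/2)" for a :: real
  using not_in_Ints_between[of "-1" "a - (a + 1/2)"] by (simp add: frac_eq_frac_iff)

lemma circle_map_frac: "circle_map d (frac x) = frac (real d * x)"
proof -
  have "real d * frac x = real d * x - of_int (int d * \<lfloor>x\<rfloor>)" by (simp add: frac_def algebra_simps)
  then show ?thesis unfolding circle_map_def by (metis diff_add_cancel frac_add_of_int_right)
qed

lemma arc_dist_frac_le: "arc_dist (frac x) (frac y) \<le> \<bar>x - y\<bar>"
proof -
  have *: "arc_dist (frac x) (frac y) \<le> \<bar>frac x - frac y + of_int k\<bar>" for k :: int
  proof -
    have b: "\<bar>frac x - frac y\<bar> < 1" using frac_lt_1[of x] frac_lt_1[of y] frac_ge_0[of x] frac_ge_0[of y] by linarith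
    consider "k = 0" | "k \<ge> 1" | "k \<le> -1" by linarith
    then show ?thesis
    proof cases
      case 2 then have "real_of_int k \<ge> 1" by simp
      then show ?thesis using b by (auto simp: arc_dist_def abs_if min_def)
    next
      case 3 then have "real_of_int k \<le> -1" by simp
      then show ?thesis using b by (auto simp: arc_dist_def abs_if min_def)
    qed (simp add: arc_dist_def)
  qed
  have "x - y = frac x - frac y + of_int (\<lfloor>x\<rfloor> - \<lfloor>y\<rfloor>)" by (simp add: frac_def)
  then show ?thesis using *[of "\<lfloor>x\<rfloor> - \<lfloor>y\<rfloor>"] by simp
qed

lemma circle_point_frac [simp]: "circle_point (frac x) = circle_point x"
proof -
  have "2 * pi * frac x = 2 * pi * x - 2 * pi * of_int \<lfloor>x\<rfloor>" by (simp add: frac_def algebra_simps)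
  moreover have "cis (2 * pi * of_int \<lfloor>x\<rfloor>) = 1" by (rule cis_multiple_2pi) simp
  ultimately show ?thesis by (simp add: circle_point_def cis_divide[symmetric])
qed

lemma norm_circle_point [simp]: "norm (circle_point x) = 1"
  by (simp add: circle_point_def)

lemma circle_point_add: "circle_point (x + t) = circle_point t * circle_point x"
  by (simp add: circle_point_def cis_mult algebra_simps)

lemma circle_point_eq_iff: "circle_point x = circle_point y \<longleftrightarrow> frac x = frac y"
proof
  assume "circle_point x = circle_point y"
  then have "cis (2 * pi * (x - y)) = 1"
    by (simp add: circle_point_def right_diff_distrib flip: cis_divide)
  then have "cos (2 * pi * (x - y)) = 1" by (simp add: complex_eq_iff)
  then obtain n where n: "2 * pi * (x - y) = of_int n * 2 * pi"
    using cos_one_2pi_int by blast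
  then have "2 * pi * (x - y) = 2 * pi * of_int n" by simp
  then have "x - y = of_int n" unfolding mult_cancel_left by simp
  then have "x = y + of_int n" by simp
  then show "frac x = frac y" by (simp add: frac_def)
qed (metis circle_point_frac)

lemma circle_point_in_image_iff:
  assumes "L \<subseteq> circle" shows "circle_point t \<in> circle_point ` L \<longleftrightarrow> frac t \<in> L"
proof
  assume "circle_point t \<in> circle_point ` L"
  then obtain x where x: "x \<in> L" "frac t = frac x" by (auto simp: circle_point_eq_iff)
  then have "frac x = x" using assms by (subst frac_eq) auto
  then show "frac t \<in> L" using x by simp
qed (metis circle_point_frac imageI)

lemma circle_point_surj:
  assumes "norm z = 1" obtains p where "z = circle_point p"
proof
  have "z \<noteq> 0" using assms by auto
  then show "z = circle_point (Arg z / (2 * pi))"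
    using assms cis_Arg[of z] by (auto simp: circle_point_def sgn_eq)
qed

lemma circle_point_near_1:
  assumes "0 < \<mu>" obtains \<epsilon> where "0 < \<epsilon>" "\<And>t. \<bar>t\<bar> < \<epsilon> \<Longrightarrow> norm (circle_point t - 1) < \<mu>"
proof -
  have "continuous_on UNIV circle_point" unfolding circle_point_def by (intro continuous_intros)
  then have "isCont circle_point 0" by (simp add: continuous_on_eq_continuous_at)
  then obtain \<epsilon> where "0 < \<epsilon>" "\<And>t. dist t 0 < \<epsilon> \<Longrightarrow> dist (circle_point t) (circle_point 0) < \<mu>"
    unfolding continuous_at_eps_delta using assms by blast
  then show ?thesis using that[of \<epsilon>] by (simp add: dist_norm circle_point_def)
qed

section \<open>Lists, multisets and finite choices\<close>

lemma sum_count_eq_sum_mset: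
  fixes f :: "'a \<Rightarrow> 'b::comm_semiring_1"
  assumes "finite V" "set_mset A \<subseteq> V"
  shows "(\<Sum>q\<in>V. of_nat (count A q) * f q) = (\<Sum>q\<in>#A. f q)"
  using assms(2)
proof (induction A)
  case (add x A)
  have "(\<Sum>q\<in>V. of_nat (count (add_mset x A) q) * f q) =
        (\<Sum>q\<in>V. of_nat (count A q) * f q + (if q = x then f q else 0))"
    by (intro sum.cong) (auto simp: algebra_simps)
  also have "\<dots> = (\<Sum>q\<in>#add_mset x A. f q)"
    using add assms(1) by (simp add: sum.distrib add.commute)
  finally show ?case .
qed simp

lemma norm_sum_mset_le: "norm (\<Sum>q\<in>#A. f q) \<le> (\<Sum>q\<in>#A. norm (f q :: 'b::real_normed_vector))"
proof (induction A)
  case (add x A)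
  then show ?case using norm_triangle_ineq[of "f x" "\<Sum>q\<in>#A. f q"] by simp
qed simp

lemma sum_mset_nonneg:
  fixes f :: "'a \<Rightarrow> real"
  assumes "\<And>x. 0 \<le> f x"
  shows "0 \<le> (\<Sum>q\<in>#A. f q)"
  by (induction A) (simp_all add: assms)

lemma zip_butlast_tl_nth:
  "map2 f (butlast ps) (tl ps) = map (\<lambda>i. f (ps ! i) (ps ! Suc i)) [0..<length ps - 1]"
  by (rule nth_equalityI) (auto simp: nth_butlast nth_tl)

text \<open>
  Traversing a geodesic backwards yields the same unordered pairs of consecutive points.
\<close>

lemma mset_consecutive_rev:
  assumes f: "\<And>x y. f x y = f y x"
  shows "mset (map2 f (butlast (rev ps)) (tl (rev ps))) = mset (map2 f (butlast ps) (tl ps))"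
proof -
  have "zip (butlast (rev ps)) (tl (rev ps)) = rev (zip (tl ps) (butlast ps))"
    by (metis butlast_rev length_butlast length_tl rev_rev_ident zip_rev)
  then have "mset (map2 f (butlast (rev ps)) (tl (rev ps))) = mset (map2 f (tl ps) (butlast ps))"
    by (simp add: rev_map[symmetric])
  also have "map2 f (tl ps) (butlast ps) = map2 f (butlast ps) (tl ps)"
    by (rule nth_equalityI) (auto simp: f)
  finally show ?thesis .
qed

text \<open>
  This identifies a separation vector once a list of leaves with increasing crossing times is known.
\<close>

lemma sorted_key_list_of_set_eqI:
  fixes f :: "'a \<Rightarrow> 'b::linorder"
  assumes "sorted_wrt (<) (map f xs)"
  shows "sorted_key_list_of_set f (set xs) = xs"
proof -
  have inj: "f a \<noteq> f b" if "a \<in> set xs" "b \<in> set xs" "a \<noteq> b" for a b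
    using assms that by (auto simp: strict_sorted_iff distinct_map dest: inj_onD)
  interpret F: folding_on "set xs" "insort_key f" "[]"
  proof
    fix a b assume "a \<in> set xs" "b \<in> set xs"
    then show "insort_key f b \<circ> insort_key f a = insort_key f a \<circ> insort_key f b"
      using insort_key_left_comm[of f a b] inj[of a b] by (cases "a = b") (auto simp: fun_eq_iff)
  qed
  have "F.F (set ys) = ys" if "set ys \<subseteq> set xs" "sorted_wrt (<) (map f ys)" for ys
    using that
  proof (induction ys)
    case (Cons a ys)
    have "a \<notin> set ys" using Cons.prems(2) by auto
    then have "F.F (set (a # ys)) = insort_key f a (F.F (set ys))"
      using Cons.prems(1) by (simp add: F.insert)
    also have "\<dots> = insort_key f a ys" using Cons by simp
    also have "\<dots> = a # ys" using Cons.prems(2) by (intro insort_is_Cons) auto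
    finally show ?case .
  qed simp
  then show ?thesis using assms by (simp add: sorted_key_list_of_set_def)
qed

lemma finite_uniform_bound:
  fixes P :: "'a \<Rightarrow> real \<Rightarrow> bool"
  assumes "finite S" "\<And>s. s \<in> S \<Longrightarrow> \<exists>\<mu>>0. P s \<mu>" "\<And>s \<mu> \<nu>. P s \<mu> \<Longrightarrow> \<nu> \<le> \<mu> \<Longrightarrow> P s \<nu>"
  shows "\<exists>\<mu>>0. \<forall>s\<in>S. P s \<mu>"
  using assms(1,2)
proof (induction S)
  case empty then show ?case by (auto intro: exI[of _ 1])
next
  case (insert x S)
  then obtain \<mu> \<nu> where "\<mu> > 0" "\<forall>s\<in>S. P s \<mu>" "\<nu> > 0" "P x \<nu>" by (meson insertCI)
  then show ?case using assms(3) by (intro exI[of _ "min \<mu> \<nu>"]) (auto intro: assms(3))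
qed

text \<open>
  The contrapositive of the previous lemma; it passes from approximation to equality.
\<close>

lemma finite_limit:
  fixes P :: "'a \<Rightarrow> real \<Rightarrow> bool"
  assumes S: "finite S" and ex: "\<And>\<mu>. 0 < \<mu> \<Longrightarrow> \<exists>s\<in>S. P s \<mu>" and mono: "\<And>s \<mu> \<nu>. P s \<nu> \<Longrightarrow> \<nu> \<le> \<mu> \<Longrightarrow> P s \<mu>"
  shows "\<exists>s\<in>S. \<forall>\<mu>>0. P s \<mu>"
proof (rule ccontr)
  assume "\<not> ?thesis"
  then have "\<exists>\<mu>>0. \<forall>s\<in>S. \<not> P s \<mu>"
    using mono by (intro finite_uniform_bound[OF S]) blast+
  then show False using ex by blast
qed

section \<open>Chords of the disc\<close>

text \<open>
  The signed distance from the line through \<open>circle_point u\<close> and \<open>circle_point w\<close>: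
  after the rotation by \<open>- pi (u + w)\<close> this line is vertical, with abscissa \<open>cos (pi (w -
  u))\<close>.
\<close>

definition chord_fun :: "real \<Rightarrow> real \<Rightarrow> complex \<Rightarrow> real" where
  "chord_fun u w z = Re (z * cis (- (pi * (u + w)))) - cos (pi * (w - u))"

lemma sin_pi_pos: "0 < x \<Longrightarrow> x < 1 \<Longrightarrow> 0 < sin (pi * x)"
  by (rule sin_gt_zero) (simp_all)

text \<open>
  On the circle the signed distance factors, so its sign can be read off from the cyclic order. The formula
  holds for all real lifts of the three points; no case distinction at 0 is needed.
\<close>

lemma chord_fun_circle_point:
  "chord_fun u w (circle_point p) = 2 * sin (pi * (p - u)) * sin (pi * (w - p))"
proof -
  have "chord_fun u w (circle_point p) = cos (2 * pi * p - pi * (u + w)) - cos (pi * (w - u))"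
    by (simp add: chord_fun_def circle_point_def cis_mult)
  also have "\<dots> = 2 * sin (pi * (p - u)) * sin (pi * (w - p))"
  proof -
    have "(2 * pi * p - pi * (u + w) + pi * (w - u)) / 2 = pi * (p - u)"
      "(pi * (w - u) - (2 * pi * p - pi * (u + w))) / 2 = pi * (w - p)"
      by (simp_all add: field_simps)
    then show ?thesis unfolding cos_diff_cos by simp
  qed
  finally show ?thesis .
qed

lemma chord_fun_pos:
  assumes "u < p" "p < w" "w < u + 1"
  shows "0 < chord_fun u w (circle_point p)"
  using assms sin_pi_pos[of "p - u"] sin_pi_pos[of "w - p"] by (simp add: chord_fun_circle_point)

lemma chord_fun_neg:
  assumes "w - 1 < p" "p < u" "u < w"
  shows "chord_fun u w (circle_point p) < 0"
proof -
  have "sin (pi * (p - u)) < 0"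
    using sin_pi_pos[of "u - p"] assms by (simp add: right_diff_distrib sin_diff mult.commute)
  moreover have "0 < sin (pi * (w - p))" using sin_pi_pos[of "w - p"] assms by simp
  ultimately show ?thesis by (simp add: chord_fun_circle_point mult_neg_pos)
qed

lemma chord_fun_ends [simp]:
  "chord_fun u w (circle_point u) = 0" "chord_fun u w (circle_point w) = 0"
  by (simp_all add: chord_fun_circle_point)

lemma chord_fun_affine:
  "chord_fun u w ((1 - t) *\<^sub>R a + t *\<^sub>R b) = (1 - t) * chord_fun u w a + t * chord_fun u w b"
  by (simp add: chord_fun_def algebra_simps)

lemma chord_fun_closed_segment:
  assumes "z \<in> closed_segment a b"
  obtains t where "0 \<le> t" "t \<le> 1" "chord_fun u w z = (1 - t) * chord_fun u w a + t * chord_fun u w b"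
  using assms chord_fun_affine unfolding closed_segment_def by blast

lemma continuous_on_chord_fun: "continuous_on S (chord_fun u w)"
  unfolding chord_fun_def by (intro continuous_intros)

lemma chord_fun_zero_on_chord:
  "z \<in> closed_segment (circle_point u) (circle_point w) \<Longrightarrow> chord_fun u w z = 0"
  by (elim chord_fun_closed_segment[where u = u and w = w]) simp

lemma chord_fun_pos_on_chord:
  assumes "z \<in> closed_segment (circle_point u') (circle_point w')"
    and "0 < chord_fun u w (circle_point u')" "0 < chord_fun u w (circle_point w')"
  shows "0 < chord_fun u w z"
proof -
  obtain t where "0 \<le> t" "t \<le> 1"
    "chord_fun u w z = (1 - t) * chord_fun u w (circle_point u') + t * chord_fun u w (circle_point w')"
    using chord_fun_closed_segment[OF assms(1)] by blast
  then show ?thesis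
    using assms(2,3) by (cases "t = 1") (simp_all add: add_pos_nonneg)
qed

text \<open>
  A line meets the closed disc exactly in the chord between its two points on the circle.
\<close>

lemma zero_set_of_chord_fun:
  assumes z: "norm z \<le> 1" "chord_fun u w z = 0" and uw: "u < w" "w < u + 1"
  shows "z \<in> closed_segment (circle_point u) (circle_point w)"
proof -
  define s where "s = sin (pi * (w - u))"
  define c where "c = cos (pi * (w - u))"
  define e where "e = cis (pi * (u + w))"
  define z' where "z' = z * cis (- (pi * (u + w)))"
  have s: "s > 0" unfolding s_def using uw by (intro sin_pi_pos) auto
  have e: "cis (- (pi * (u + w))) * e = 1" by (simp add: e_def cis_mult)
  have zz: "z = e * z'" by (metis e mult.assoc mult.commute mult.right_neutral z'_def)
  have re: "Re z' = c" using z(2) by (simp add: chord_fun_def z'_def c_def)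
  have "(norm z')\<^sup>2 \<le> 1" using z(1) by (simp add: z'_def norm_mult power_le_one)
  then have "c\<^sup>2 + (Im z')\<^sup>2 \<le> c\<^sup>2 + s\<^sup>2"
    using re by (simp add: cmod_power2 c_def s_def)
  then have im: "\<bar>Im z'\<bar> \<le> s" using s by (simp add: abs_le_square_iff[symmetric])
  \<comment> \<open>the position of \<open>z\<close> on the chord, which becomes a vertical segment of half-length \<open>s\<close> by the rotation\<close>
  define t where "t = (1 + Im z' / s) / 2"
  have t: "0 \<le> t" "t \<le> 1" using im s by (auto simp: t_def field_simps abs_le_iff)
  have u: "circle_point u = e * Complex c (- s)" and w: "circle_point w = e * Complex c s"
  proof -
    have "Complex c (- s) = cis (- (pi * (w - u)))" "Complex c s = cis (pi * (w - u))"
      by (auto simp: complex_eq_iff c_def s_def)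
    then show "circle_point u = e * Complex c (- s)" "circle_point w = e * Complex c s"
      by (simp_all add: circle_point_def e_def cis_mult algebra_simps)
  qed
  have "z' = (1 - t) *\<^sub>R Complex c (- s) + t *\<^sub>R Complex c s"
    using re s by (auto simp: complex_eq_iff t_def field_simps)
  then have "z = (1 - t) *\<^sub>R circle_point u + t *\<^sub>R circle_point w"
    unfolding u w zz by (simp add: distrib_left)
  then show ?thesis using t by (auto simp: closed_segment_def)
qed

text \<open>
  The ends of the second chord lie on different sides of the first one.
\<close>

lemma linked_chords_cross:
  assumes "u < u'" "u' < w" "w < w'" "w' < u + 1"
  shows "closed_segment (circle_point u) (circle_point w) \<inter>
         closed_segment (circle_point u') (circle_point w') \<noteq> {}"
proof -
  define f where "f = chord_fun u w"
  have pos: "0 < f (circle_point u')" unfolding f_def using assms by (intro chord_fun_pos) auto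
  have neg: "f (circle_point w') < 0"
    unfolding f_def using assms chord_fun_neg[of w "w' - 1" u] circle_point_frac[of w'] circle_point_frac[of "w' - 1"]
    by (simp add: frac_def)
  define t where "t = f (circle_point u') / (f (circle_point u') - f (circle_point w'))"
  have t: "0 \<le> t" "t \<le> 1" using pos neg by (auto simp: t_def field_simps)
  define z where "z = (1 - t) *\<^sub>R circle_point u' + t *\<^sub>R circle_point w'"
  have z: "z \<in> closed_segment (circle_point u') (circle_point w')"
    using t by (auto simp: z_def closed_segment_def)
  have "closed_segment (circle_point u') (circle_point w') \<subseteq> cball 0 1"
    by (intro closed_segment_subset) auto
  then have "norm z \<le> 1" using z by auto
  moreover have "f z = 0"
  proof -
    have "f z = (1 - t) * f (circle_point u') + t * f (circle_point w')"
      unfolding z_def f_def by (rule chord_fun_affine)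
    also have "\<dots> = f (circle_point u') - t * (f (circle_point u') - f (circle_point w'))"
      by (simp add: algebra_simps)
    also have "\<dots> = 0" using pos neg by (simp add: t_def)
    finally show ?thesis .
  qed
  ultimately have "z \<in> closed_segment (circle_point u) (circle_point w)"
    unfolding f_def using assms by (intro zero_set_of_chord_fun) auto
  then show ?thesis using z by blast
qed

section \<open>Leaves that separate two points\<close>

lemma leaf_polygon_norm: "z \<in> leaf_polygon L \<Longrightarrow> norm z \<le> 1"
proof -
  have "leaf_polygon L \<subseteq> cball 0 1" unfolding leaf_polygon_def by (intro hull_minimal) auto
  then show "z \<in> leaf_polygon L \<Longrightarrow> norm z \<le> 1" by auto
qed

lemma leaf_polygon_nonempty: "L \<noteq> {} \<Longrightarrow> leaf_polygon L \<noteq> {}"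
  by (simp add: leaf_polygon_def)

lemma compact_leaf_polygon: "finite L \<Longrightarrow> compact (leaf_polygon L)"
  unfolding leaf_polygon_def by (intro compact_convex_hull finite_imp_compact) auto

lemma leaf_polygon_pair: "leaf_polygon {frac u, frac w} = closed_segment (circle_point u) (circle_point w)"
  by (simp add: leaf_polygon_def segment_convex_hull)

lemma leaf_separates_commute: "leaf_separates L x y = leaf_separates L y x"
  by (auto simp: leaf_separates_def connected_component_sym_eq)

text \<open>
  The arc from \<open>a\<close> to \<open>b\<close> is a connected set that avoids the leaf.
\<close>

lemma not_leaf_separates_arc:
  assumes L: "L \<subseteq> circle" and ab: "a \<le> b" "\<And>t. a \<le> t \<Longrightarrow> t \<le> b \<Longrightarrow> frac t \<notin> L"
  shows "\<not> leaf_separates L (frac a) (frac b)"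
proof -
  have "connected (circle_point ` {a..b})"
    unfolding circle_point_def by (intro connected_continuous_image continuous_intros) auto
  moreover have "circle_point ` {a..b} \<subseteq> sphere 0 1 - circle_point ` L"
    using ab(2) circle_point_in_image_iff[OF L] by fastforce
  moreover have "circle_point a \<in> circle_point ` {a..b}" "circle_point b \<in> circle_point ` {a..b}"
    using ab(1) by auto
  ultimately have "connected_component (sphere 0 1 - circle_point ` L) (circle_point a) (circle_point b)"
    unfolding connected_component_def by blast
  then show ?thesis by (simp add: leaf_separates_def)
qed

lemma not_leaf_separates_refl:
  assumes "L \<subseteq> circle" "x \<in> circle" shows "\<not> leaf_separates L x x"
proof (cases "x \<in> L")
  case False
  have fx: "frac x = x" by (rule frac_circle_eq[OF assms(2)])
  have "\<not> leaf_separates L (frac x) (frac x)"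
    by (rule not_leaf_separates_arc[OF assms(1) order_refl]) (use False fx in force)
  then show ?thesis by (simp only: fx not_False_eq_True)
qed (simp add: leaf_separates_def)

text \<open>
  The signed distance from the chord is continuous and, on the circle, vanishes only at the ends of the
  chord. A connected subset of the rest of the circle therefore stays on one side.
\<close>

lemma leaf_separates_by_chord:
  assumes uw: "w - 1 < p" "p < u" "u < q" "q < w"
  shows "leaf_separates {frac u, frac w} (frac p) (frac q)"
proof -
  have pos: "0 < chord_fun u w (circle_point q)" using uw by (intro chord_fun_pos) auto
  have neg: "chord_fun u w (circle_point p) < 0" using uw by (intro chord_fun_neg) auto
  have "\<not> connected_component (sphere 0 1 - circle_point ` {frac u, frac w}) (circle_point p) (circle_point q)"
  proof
    assume "connected_component (sphere 0 1 - circle_point ` {frac u, frac w}) (circle_point p) (circle_point q)"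
    then obtain T where T: "connected T" "T \<subseteq> sphere 0 1 - circle_point ` {frac u, frac w}"
        "circle_point p \<in> T" "circle_point q \<in> T"
      unfolding connected_component_def by blast
    have "connected (chord_fun u w ` T)"
      by (intro connected_continuous_image T continuous_on_chord_fun)
    then have "0 \<in> chord_fun u w ` T"
      using connectedD_interval[of "chord_fun u w ` T" "chord_fun u w (circle_point p)" "chord_fun u w (circle_point q)" 0]
        T(3,4) pos neg by auto
    then obtain z where z: "z \<in> T" "chord_fun u w z = 0" by auto
    then have "norm z = 1" using T(2) by auto
    then obtain s where s: "z = circle_point s" using circle_point_surj by blast
    have "sin (pi * (s - u)) = 0 \<or> sin (pi * (w - s)) = 0"
      using z(2) by (simp add: s chord_fun_circle_point)
    then obtain i where "pi * (s - u) = of_int i * pi \<or> pi * (w - s) = of_int i * pi"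
      using sin_zero_iff_int2 by (metis mult.commute)
    then have "pi * (s - u) = pi * of_int i \<or> pi * (w - s) = pi * of_int i" by (simp only: mult.commute)
    then have "s - u = of_int i \<or> w - s = of_int i" unfolding mult_cancel_left by simp
    then have "s = u + of_int i \<or> w = s + of_int i" by linarith
    then have "frac s = frac u \<or> frac s = frac w" by (auto simp: frac_def)
    then have "z = circle_point u \<or> z = circle_point w" by (simp add: s circle_point_eq_iff)
    then show False using T(2) z(1) by auto
  qed
  moreover have "frac p \<notin> {frac u, frac w}" "frac q \<notin> {frac u, frac w}"
    using pos neg by (auto simp: circle_point_eq_iff[symmetric])
  ultimately show ?thesis by (simp add: leaf_separates_def)
qed

text \<open>
  Both arcs between separated points contain an end of the leaf, as otherwise such an arc would connect
  them.
\<close>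

lemma leaf_separates_endpoints:
  assumes L: "L \<subseteq> circle" and xy: "x \<in> circle" "y \<in> circle" "x < y" and sep: "leaf_separates L x y"
  obtains u w where "u \<in> L" "x < u" "u < y" "frac w \<in> L" "y < w" "w < x + 1"
proof -
  have nin: "x \<notin> L" "y \<notin> L" using sep by (auto simp: leaf_separates_def)
  have fr: "frac x = x" "frac y = y" "frac (x + 1) = x" using xy by (auto simp: frac_eq frac_1_eq)
  obtain u where u: "x \<le> u" "u \<le> y" "frac u \<in> L"
    using not_leaf_separates_arc[OF L, of x y] sep xy(3) fr by auto
  obtain w where w: "y \<le> w" "w \<le> x + 1" "frac w \<in> L"
    using not_leaf_separates_arc[OF L, of y "x + 1"] sep[unfolded leaf_separates_commute[of L x]] xy fr by auto
  have "frac u = u" using u xy by (auto simp: frac_eq)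
  moreover have "w \<noteq> y" "w \<noteq> x + 1" "u \<noteq> x" "u \<noteq> y" using u w nin fr by auto
  ultimately show ?thesis using u w by (intro that[of u w]) auto
qed

text \<open>
  The set whose infimum is the crossing time.
\<close>

definition crossings :: "real \<Rightarrow> real \<Rightarrow> real set \<Rightarrow> real set" where
  "crossings x y L = {t \<in> {0..1}. linepath (circle_point x) (circle_point y) t \<in> leaf_polygon L}"

lemma crossing_time_in_crossings:
  assumes "finite L" "crossings x y L \<noteq> {}"
  shows "crossing_time x y L \<in> crossings x y L"
proof -
  have "closed (leaf_polygon L)"
    unfolding leaf_polygon_def using assms(1)
    by (intro compact_imp_closed compact_convex_hull finite_imp_compact) auto
  then have "closed {t \<in> {0..1}. linepath (circle_point x) (circle_point y) t \<in> leaf_polygon L}"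
    using continuous_on_closed_Collect_le[of] continuous_closed_preimage[of "{0..1}" "linepath (circle_point x) (circle_point y)"]
    by (auto simp: vimage_def Int_def continuous_on_linepath intro: back_subst[of closed])
  then show ?thesis
    using assms(2) unfolding crossing_time_def crossings_def
    by (intro closed_contains_Inf) (auto intro: bdd_belowI[of _ 0])
qed

lemma linepath_image_closed_segment:
  "z \<in> closed_segment a b \<Longrightarrow> \<exists>t\<in>{0..1}. linepath a b t = z"
  by (metis image_iff linepath_image_01)

lemma crossings_sym: "crossings y x L = (\<lambda>t. 1 - t) ` crossings x y L"
proof -
  have *: "linepath a b (1 - t) = linepath b a t" for a b :: complex and t
    by (simp add: linepath_def algebra_simps)
  have "t \<in> (\<lambda>t. 1 - t) ` crossings x y L" if "t \<in> crossings y x L" for t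
    using that by (intro image_eqI[of _ _ "1 - t"]) (auto simp: crossings_def *)
  then show ?thesis by (auto simp: crossings_def *)
qed

text \<open>
  A separating leaf has two ends that are linked with \<open>x\<close> and \<open>y\<close>, so the chord
  between them crosses the geodesic.
\<close>

lemma leaf_separates_crossings:
  assumes L: "L \<subseteq> circle" and xy: "x \<in> circle" "y \<in> circle" and sep: "leaf_separates L x y"
  shows "crossings x y L \<noteq> {}"
proof -
  have less: "crossings x y L \<noteq> {}" if xy: "x \<in> circle" "y \<in> circle" "x < y" and sep: "leaf_separates L x y" for x y
  proof -
    obtain u w where uw: "u \<in> L" "x < u" "u < y" "frac w \<in> L" "y < w" "w < x + 1"
      using leaf_separates_endpoints[OF L xy sep] by blast
    obtain z where z: "z \<in> closed_segment (circle_point x) (circle_point y)"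
        "z \<in> closed_segment (circle_point u) (circle_point w)"
      using linked_chords_cross[of x u y w] uw by auto
    have "circle_point w \<in> circle_point ` L" using uw(4) by (metis circle_point_frac imageI)
    then have "closed_segment (circle_point u) (circle_point w) \<subseteq> leaf_polygon L"
      unfolding leaf_polygon_def using uw(1) by (intro closed_segment_subset_convex_hull hull_inc) auto
    then show ?thesis using linepath_image_closed_segment[OF z(1)] z(2) by (auto simp: crossings_def)
  qed
  have "x \<noteq> y"
  proof
    assume "x = y"
    then have "connected_component (sphere 0 1 - circle_point ` L) (circle_point x) (circle_point y)"
      using sep circle_point_in_image_iff[OF L, of x] xy by (auto simp: leaf_separates_def frac_eq)
    then show False using sep by (simp add: leaf_separates_def)
  qed
  then show ?thesis
    using less[OF xy] less[OF xy(2,1)] sep leaf_separates_commute[of L x y] crossings_sym[of x y L]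
    by (cases x y rule: linorder_cases) auto
qed

text \<open>
  The signed distance from the line of the first leaf is affine along the geodesic. It vanishes at the first
  crossing time and is positive at the second one, so its slope decides which comes first.
\<close>

lemma crossing_time_order_sign:
  assumes L: "crossings x y {frac u, frac w} \<noteq> {}"
    and K: "finite K" "crossings x y K \<noteq> {}" "\<And>z. z \<in> leaf_polygon K \<Longrightarrow> 0 < chord_fun u w z"
  shows "0 < (crossing_time x y K - crossing_time x y {frac u, frac w}) *
             (chord_fun u w (circle_point y) - chord_fun u w (circle_point x))"
proof -
  define f where "f t = chord_fun u w (linepath (circle_point x) (circle_point y) t)" for t
  define s where "s = crossing_time x y {frac u, frac w}"
  define t where "t = crossing_time x y K"
  have f: "f r = chord_fun u w (circle_point x) + r * (chord_fun u w (circle_point y) - chord_fun u w (circle_point x))" for r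
    unfolding f_def linepath_def chord_fun_affine by (simp add: algebra_simps)
  have "s \<in> crossings x y {frac u, frac w}"
    unfolding s_def by (rule crossing_time_in_crossings[OF _ L]) simp
  then have "f s = 0"
    unfolding f_def by (intro chord_fun_zero_on_chord) (simp add: crossings_def leaf_polygon_pair)
  moreover have "t \<in> crossings x y K"
    unfolding t_def by (rule crossing_time_in_crossings[OF K(1,2)])
  then have "0 < f t" unfolding f_def by (intro K(3)) (simp add: crossings_def)
  ultimately have "0 < (t - s) * (chord_fun u w (circle_point y) - chord_fun u w (circle_point x))"
    by (simp add: f algebra_simps)
  then show ?thesis by (simp only: s_def t_def)
qed

section \<open>The Thurston graph\<close>

lemma primitive_majorD:
  assumes "primitive_major d M"
  shows "finite M" "L \<in> M \<Longrightarrow> L \<subseteq> circle" "L \<in> M \<Longrightarrow> finite L" "L \<in> M \<Longrightarrow> 2 \<le> card L"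
    "L \<in> M \<Longrightarrow> L' \<in> M \<Longrightarrow> L \<noteq> L' \<Longrightarrow> disjnt (leaf_polygon L) (leaf_polygon L')"
    "L \<in> M \<Longrightarrow> x \<in> L \<Longrightarrow> y \<in> L \<Longrightarrow> circle_map d x = circle_map d y"
    "(\<Sum>L\<in>M. card L - 1) = d - 1"
proof -
  note M = assms[unfolded primitive_major_def]
  note leaf = M[THEN conjunct2, THEN conjunct1, rule_format]
  show "finite M" by (rule M[THEN conjunct1])
  show "L \<in> M \<Longrightarrow> L \<subseteq> circle" by (rule leaf[THEN conjunct1])
  show "L \<in> M \<Longrightarrow> finite L" by (rule leaf[THEN conjunct2, THEN conjunct1])
  show "L \<in> M \<Longrightarrow> 2 \<le> card L" by (rule leaf[THEN conjunct2, THEN conjunct2])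
  show "L \<in> M \<Longrightarrow> L' \<in> M \<Longrightarrow> L \<noteq> L' \<Longrightarrow> disjnt (leaf_polygon L) (leaf_polygon L')"
    by (rule M[THEN conjunct2, THEN conjunct2, THEN conjunct1, rule_format])
  show "L \<in> M \<Longrightarrow> x \<in> L \<Longrightarrow> y \<in> L \<Longrightarrow> circle_map d x = circle_map d y"
    by (rule M[THEN conjunct2, THEN conjunct2, THEN conjunct2, THEN conjunct1, rule_format])
  show "(\<Sum>L\<in>M. card L - 1) = d - 1"
    by (rule M[THEN conjunct2, THEN conjunct2, THEN conjunct2, THEN conjunct2])
qed

lemma leaf_image_eq:
  assumes "primitive_major d M" "L \<in> M" "x \<in> L"
  shows "leaf_image d L = circle_map d x"
proof -
  have "circle_map d ` L = (\<lambda>_. circle_map d x) ` L"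
    using primitive_majorD(6)[OF assms(1,2) _ assms(3)] by (rule image_cong[OF refl])
  then have "circle_map d ` L = {circle_map d x}"
    using image_constant[OF assms(3)] by metis
  then show ?thesis by (simp add: leaf_image_def)
qed

lemma leaf_nonempty: "primitive_major d M \<Longrightarrow> L \<in> M \<Longrightarrow> L \<noteq> {}"
  using primitive_majorD(4) by fastforce

lemma leaf_image_circle:
  assumes "primitive_major d M" "L \<in> M"
  shows "leaf_image d L \<in> circle"
proof -
  obtain x where "x \<in> L" using leaf_nonempty[OF assms] by blast
  then show ?thesis using leaf_image_eq[OF assms] by simp
qed

lemma postcritical_leaf_image: "L \<in> M \<Longrightarrow> leaf_image d L \<in> postcritical d M"
  unfolding postcritical_def by (rule CollectI, rule exI[of _ 0]) auto

lemma postcritical_circle_map: "x \<in> postcritical d M \<Longrightarrow> circle_map d x \<in> postcritical d M"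
  unfolding postcritical_def
proof (elim CollectE exE conjE)
  fix n L assume "x = (circle_map d ^^ n) (leaf_image d L)" "L \<in> M"
  then show "circle_map d x \<in> {(circle_map d ^^ n) (leaf_image d L) |n L. L \<in> M}"
    by (intro CollectI exI[of _ "Suc n"] exI[of _ L]) auto
qed

lemma postcritical_circle:
  assumes "primitive_major d M"
  shows "postcritical d M \<subseteq> circle"
proof
  fix x assume "x \<in> postcritical d M"
  then obtain n L where "L \<in> M" "x = (circle_map d ^^ n) (leaf_image d L)"
    by (auto simp: postcritical_def)
  then show "x \<in> circle"
    using leaf_image_circle[OF assms] by (cases n) auto
qed

lemma circle_map_rational_orbit:
  assumes "0 < b" "b * x \<in> \<int>"
  shows "real b * circle_map d x \<in> \<int>"
proof -
  have "real b * circle_map d x = real d * (real b * x) - real b * real_of_int \<lfloor>real d * x\<rfloor>"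
    by (simp add: circle_map_def frac_def algebra_simps)
  also have "\<dots> \<in> \<int>"
    by (rule Ints_diff[OF Ints_mult[OF _ assms(2)] Ints_mult]) auto
  finally show ?thesis .
qed

text \<open>
  The circle map preserves a denominator of the first postcritical point, so the orbit stays in a finite
  set.
\<close>

lemma finite_postcritical:
  assumes M: "primitive_major d M" and rat: "\<forall>L\<in>M. L \<subseteq> \<rat>"
  shows "finite (postcritical d M)"
proof -
  have fin: "finite {(circle_map d ^^ n) (leaf_image d L) |n. True}" if L: "L \<in> M" for L
  proof -
    obtain x where x: "x \<in> L" using leaf_nonempty[OF M L] by blast
    then have "x \<in> \<rat>" using rat L by blast
    then have "circle_map d x \<in> \<rat>"
      by (auto simp: circle_map_def frac_def)
    then obtain p q where "0 < q" and y: "circle_map d x = of_int p / of_int q"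
      by (metis Rats_cases')
    define b where "b = nat q"
    have b: "0 < b" "real b = of_int q" using \<open>0 < q\<close> by (auto simp: b_def)
    have y: "real b * circle_map d x \<in> \<int>" using y b by simp
    have orbit: "real b * (circle_map d ^^ n) (circle_map d x) \<in> \<int> \<and> (circle_map d ^^ n) (circle_map d x) \<in> circle" for n
      using circle_map_rational_orbit[OF b(1)] y by (induction n) auto
    have "(circle_map d ^^ n) (circle_map d x) \<in> (\<lambda>k. of_int k / b) ` {0..int b}" for n
    proof -
      define y where "y = (circle_map d ^^ n) (circle_map d x)"
      have y: "real b * y \<in> \<int>" "0 \<le> y" "y \<le> 1" using orbit[of n] unfolding y_def by auto
      then obtain k where k: "real b * y = of_int k" by (auto elim: Ints_cases)
      have "0 \<le> real b * y" "real b * y \<le> real b * 1"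
        using y b(1) by (auto simp del: mult_1_right intro!: mult_left_mono)
      then have "0 \<le> k" "k \<le> int b" unfolding k by linarith+
      moreover have "y = of_int k / b" using k b(1) by (simp add: field_simps)
      ultimately have "y \<in> (\<lambda>k. of_int k / b) ` {0..int b}" by (intro image_eqI[of _ _ k]) simp_all
      then show ?thesis by (simp only: y_def)
    qed
    then have "{(circle_map d ^^ n) (leaf_image d L) |n. True} \<subseteq> (\<lambda>k. of_int k / b) ` {0..int b}"
      unfolding leaf_image_eq[OF M L x] by blast
    then show ?thesis by (rule finite_subset) auto
  qed
  have "postcritical d M = (\<Union>L\<in>M. {(circle_map d ^^ n) (leaf_image d L) |n. True})"
    by (auto simp: postcritical_def)
  then show ?thesis using fin primitive_majorD(1)[OF M] by simp
qed

lemma finite_thurston_vertices: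
  assumes "finite (postcritical d M)"
  shows "finite (thurston_vertices d M)"
proof -
  have "thurston_vertices d M = (\<lambda>(x, y). {x, y}) ` (postcritical d M \<times> postcritical d M)"
    by (auto simp: thurston_vertices_def)
  then show ?thesis using assms by simp
qed

text \<open>
  Crossing times of different leaves differ because disjoint polygons cannot contain the same point of the
  geodesic.
\<close>

lemma separation_vector_set:
  assumes M: "primitive_major d M" and xy: "x \<in> circle" "y \<in> circle"
  shows "length (separation_vector M x y) = card {L \<in> M. leaf_separates L x y}"
    and "set (separation_vector M x y) = {L \<in> M. leaf_separates L x y}"
proof -
  define S where "S = {L \<in> M. leaf_separates L x y}"
  have fin: "finite S" using primitive_majorD(1)[OF M] by (simp add: S_def)
  have t: "crossing_time x y L \<in> crossings x y L" if L: "L \<in> S" for L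
    using L leaf_separates_crossings[OF primitive_majorD(2)[OF M] xy] primitive_majorD(3)[OF M]
    by (intro crossing_time_in_crossings) (auto simp: S_def)
  have inj: "inj_on (crossing_time x y) S"
  proof (rule inj_onI, rule ccontr)
    fix L K assume LK: "L \<in> S" "K \<in> S" "crossing_time x y L = crossing_time x y K" "L \<noteq> K"
    then have "leaf_polygon L \<inter> leaf_polygon K \<noteq> {}"
      using t[OF LK(1)] t[OF LK(2)] by (auto simp: crossings_def)
    then show False using primitive_majorD(5)[OF M, of L K] LK by (auto simp: S_def disjnt_def)
  qed
  obtain xs where xs: "set xs = S" "distinct xs" using finite_distinct_list[OF fin] by blast
  define ys where "ys = sort_key (crossing_time x y) xs"
  have ys: "set ys = S" "distinct ys" using xs by (auto simp: ys_def)
  have "sorted_wrt (<) (map (crossing_time x y) ys)"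
    using ys inj by (simp add: strict_sorted_iff distinct_map) (simp add: ys_def)
  then have "separation_vector M x y = ys"
    unfolding separation_vector_def S_def[symmetric] ys(1)[symmetric] by (rule sorted_key_list_of_set_eqI)
  then show "length (separation_vector M x y) = card {L \<in> M. leaf_separates L x y}"
    "set (separation_vector M x y) = {L \<in> M. leaf_separates L x y}"
    using ys distinct_card[of ys] by (auto simp: S_def)
qed

text \<open>
  Every leaf contributes at least 1 to the sum in the definition of a primitive major.
\<close>

lemma card_leaves_le:
  assumes M: "primitive_major d M"
  shows "card M \<le> d - 1"
proof -
  have "card M = (\<Sum>L\<in>M. 1)" by simp
  also have "\<dots> \<le> (\<Sum>L\<in>M. card L - 1)" using primitive_majorD(4)[OF M] by (intro sum_mono) force
  finally show ?thesis using primitive_majorD(7)[OF M] by simp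
qed

lemma pair_targets_size:
  assumes M: "primitive_major d M" and xy: "x \<in> circle" "y \<in> circle"
  shows "size (pair_targets d M x y) \<le> Suc (card {L \<in> M. leaf_separates L x y})"
  using separation_vector_set(1)[OF M xy] by (auto simp: pair_targets_def Let_def)

lemma pair_targets_size_le:
  assumes M: "primitive_major d M" and d: "2 \<le> d" and xy: "x \<in> circle" "y \<in> circle"
  shows "size (pair_targets d M x y) \<le> d"
proof -
  have "card {L \<in> M. leaf_separates L x y} \<le> card M"
    using primitive_majorD(1)[OF M] by (intro card_mono) auto
  then show ?thesis using pair_targets_size[OF M xy] card_leaves_le[OF M] d by simp
qed

text \<open>
  The equality case of the bound on the outdegree: there must be \<open>d - 1\<close> separating leaves,
  which exhausts the sum in the definition of a primitive major.
\<close>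

lemma full_pair:
  assumes M: "primitive_major d M" and d: "2 \<le> d" and xy: "x \<in> circle" "y \<in> circle"
    and size: "size (pair_targets d M x y) = d"
  shows "card M = d - 1" "L \<in> M \<Longrightarrow> card L = 2" "L \<in> M \<Longrightarrow> leaf_separates L x y"
proof -
  have fin: "finite M" by (rule primitive_majorD(1)[OF M])
  have ge: "d - 1 \<le> card {L \<in> M. leaf_separates L x y}"
    using pair_targets_size[OF M xy] size by simp
  have le: "card {L \<in> M. leaf_separates L x y} \<le> card M" using fin by (intro card_mono) auto
  show card: "card M = d - 1" using ge le card_leaves_le[OF M] by simp
  have "{L \<in> M. leaf_separates L x y} = M"
    using fin ge le card by (intro card_subset_eq) auto
  then show "L \<in> M \<Longrightarrow> leaf_separates L x y" by blast
  show "card L = 2" if L: "L \<in> M"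
  proof (rule ccontr)
    assume "card L \<noteq> 2"
    then have "1 < card L - 1" using primitive_majorD(4)[OF M L] by simp
    then have "(\<Sum>L\<in>M. 1) < (\<Sum>L\<in>M. card L - 1)"
      using primitive_majorD(4)[OF M] L fin by (intro sum_strict_mono_ex1) force+
    then show False using card primitive_majorD(7)[OF M] by simp
  qed
qed

lemma thurston_targets_pair: "thurston_targets d M {x, y} = pair_targets d M (min x y) (max x y)"
  by (simp add: thurston_targets_def)

lemma pair_targets_closed:
  assumes "finite M" and x: "x \<in> postcritical d M" and y: "y \<in> postcritical d M"
    and set: "set (separation_vector M x y) \<subseteq> M"
  shows "set_mset (pair_targets d M x y) \<subseteq> thurston_vertices d M"
proof -
  define ps where "ps = circle_map d x # map (leaf_image d) (separation_vector M x y) @ [circle_map d y]"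
  have "set ps \<subseteq> postcritical d M"
    using x y set by (auto simp: ps_def intro: postcritical_circle_map postcritical_leaf_image)
  then have "ps ! i \<in> postcritical d M" if "i < length ps" for i
    using that nth_mem by blast
  then have "set (map2 (\<lambda>p q. {p, q}) (butlast ps) (tl ps)) \<subseteq> thurston_vertices d M"
    unfolding zip_butlast_tl_nth thurston_vertices_def by fastforce
  then show ?thesis by (auto simp: pair_targets_def ps_def[symmetric] Let_def)
qed

lemma thurston_graph_closed:
  assumes M: "primitive_major d M" and v: "v \<in> thurston_vertices d M"
  shows "set_mset (thurston_targets d M v) \<subseteq> thurston_vertices d M"
proof -
  obtain x y where xy: "v = {x, y}" "x \<in> postcritical d M" "y \<in> postcritical d M"
    using v by (auto simp: thurston_vertices_def)
  have p: "min x y \<in> postcritical d M" "max x y \<in> postcritical d M" using xy by (auto simp: min_def max_def)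
  have "set (separation_vector M (min x y) (max x y)) \<subseteq> M"
    using separation_vector_set(2)[OF M] p postcritical_circle[OF M] by blast
  then show ?thesis
    unfolding xy(1) thurston_targets_pair by (rule pair_targets_closed[OF primitive_majorD(1)[OF M] p])
qed

lemma thurston_targets_size_le:
  assumes M: "primitive_major d M" and d: "2 \<le> d" and v: "v \<in> thurston_vertices d M"
  shows "size (thurston_targets d M v) \<le> d"
proof -
  obtain x y where xy: "v = {x, y}" "x \<in> postcritical d M" "y \<in> postcritical d M"
    using v by (auto simp: thurston_vertices_def)
  have "min x y \<in> circle" "max x y \<in> circle"
    using xy(2,3) postcritical_circle[OF M] by (auto simp: min_def max_def)
  then show ?thesis unfolding xy(1) thurston_targets_pair by (rule pair_targets_size_le[OF M d])
qed

text \<open>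
  Every path that starts at \<open>v\<close> meets only vertices of outdegree \<open>d\<close> in its first
  \<open>n\<close> positions.
\<close>

primrec full_paths :: "nat \<Rightarrow> real set set \<Rightarrow> nat \<Rightarrow> real set \<Rightarrow> bool" where
  "full_paths d M 0 v \<longleftrightarrow> True"
| "full_paths d M (Suc n) v \<longleftrightarrow>
     size (thurston_targets d M v) = d \<and> (\<forall>q\<in>#thurston_targets d M v. full_paths d M n q)"

lemma full_paths_Suc: "full_paths d M (Suc n) v \<Longrightarrow> full_paths d M n v"
  by (induction n arbitrary: v) (auto simp del: full_paths.simps(2) simp: full_paths.simps(2)[of d M])

lemma full_paths_separated:
  assumes M: "primitive_major d M" and d: "2 \<le> d" and xy: "x \<in> circle" "y \<in> circle"
    and full: "full_paths d M (Suc n) {x, y}"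
  shows "card M = d - 1" "L \<in> M \<Longrightarrow> card L = 2" "L \<in> M \<Longrightarrow> leaf_separates L x y"
proof -
  have c: "min x y \<in> circle" "max x y \<in> circle" using xy by (auto simp: min_def max_def)
  have size: "size (pair_targets d M (min x y) (max x y)) = d" using full by (simp add: thurston_targets_pair)
  note fp = full_pair[OF M d c size]
  show "card M = d - 1" "L \<in> M \<Longrightarrow> card L = 2" by (fact fp)+
  show "leaf_separates L x y" if "L \<in> M"
    using fp(3)[OF that] leaf_separates_commute[of L x y] by (cases "x \<le> y") (auto simp: min_def max_def)
qed

section \<open>Counting paths\<close>

locale finite_thurston_graph =
  fixes d :: nat and M :: "real set set"
  assumes finite_vertices: "finite (thurston_vertices d M)"
    and vertices_nonempty: "thurston_vertices d M \<noteq> {}"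
    and closed: "v \<in> thurston_vertices d M \<Longrightarrow>
      set_mset (thurston_targets d M v) \<subseteq> thurston_vertices d M"
begin

definition vs :: "real set list" where
  "vs = (SOME vs. distinct vs \<and> set vs = thurston_vertices d M)"

lemma vs: "distinct vs" "set vs = thurston_vertices d M"
proof -
  have "\<exists>vs. distinct vs \<and> set vs = thurston_vertices d M"
    using finite_distinct_list[OF finite_vertices] by blast
  from someI_ex[OF this] show "distinct vs" "set vs = thurston_vertices d M"
    by (auto simp: vs_def)
qed

lemma thurston_matrix_eq: "thurston_matrix d M = Matrix.mat (length vs) (length vs)
           (\<lambda>(i, j). of_nat (count (thurston_targets d M (vs ! i)) (vs ! j)))"
  by (simp add: thurston_matrix_def vs_def Let_def)

lemma sum_vs: "(\<Sum>i<length vs. f (vs ! i)) = (\<Sum>v\<in>thurston_vertices d M. f v)"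
  using sum.reindex_bij_betw[OF bij_betw_nth[OF vs(1) refl refl], of f] vs(2)
  by (simp add: lessThan_atLeast0)

lemma thurston_matrix_mult:
  assumes i: "i < length vs" and v: "v = Matrix.vec (length vs) (\<lambda>i. f (vs ! i))"
  shows "vec_index (thurston_matrix d M *\<^sub>v v) i = (\<Sum>q\<in>#thurston_targets d M (vs ! i). f q)"
proof -
  have "vec_index (thurston_matrix d M *\<^sub>v v) i =
      (\<Sum>j<length vs. of_nat (count (thurston_targets d M (vs ! i)) (vs ! j)) * f (vs ! j))"
    using i unfolding thurston_matrix_eq v by (simp add: scalar_prod_def lessThan_atLeast0)
  also have "\<dots> = (\<Sum>q\<in>thurston_vertices d M. of_nat (count (thurston_targets d M (vs ! i)) q) * f q)"
    by (rule sum_vs)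
  also have "\<dots> = (\<Sum>q\<in>#thurston_targets d M (vs ! i). f q)"
    using closed[of "vs ! i"] i vs(2) nth_mem[OF i] by (intro sum_count_eq_sum_mset[OF finite_vertices]) auto
  finally show ?thesis .
qed

lemma thurston_matrix_carrier: "thurston_matrix d M \<in> carrier_mat (length vs) (length vs)"
  by (simp add: thurston_matrix_eq)

lemma length_vs: "length vs > 0"
  using vs(2) vertices_nonempty by auto

text \<open>
  The absolute values of an eigenvector for an eigenvalue of maximal modulus. This subinvariant function
  replaces the Perron-Frobenius theorem.
\<close>

lemma spectral_radius_eigenfunction:
  obtains w :: "real set \<Rightarrow> real" where
    "\<And>v. v \<in> thurston_vertices d M \<Longrightarrow> 0 \<le> w v"
    "\<exists>v\<in>thurston_vertices d M. 0 < w v"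
    "\<And>v. v \<in> thurston_vertices d M \<Longrightarrow>
       spectral_radius (thurston_matrix d M) * w v \<le> (\<Sum>q\<in>#thurston_targets d M v. w q)"
proof -
  obtain ev where l: "ev \<in> spectrum (thurston_matrix d M)"
      and sr: "spectral_radius (thurston_matrix d M) = norm ev"
    using spectral_radius_mem_max(1)[OF thurston_matrix_carrier] length_vs by auto
  then obtain x where x: "x \<in> carrier_vec (length vs)" "x \<noteq> 0\<^sub>v (length vs)"
      "thurston_matrix d M *\<^sub>v x = ev \<cdot>\<^sub>v x"
    using thurston_matrix_carrier
    by (auto simp: spectrum_def eigenvalue_def eigenvector_def)
  define idx where "idx v = (THE i. i < length vs \<and> vs ! i = v)" for v
  have idx: "idx (vs ! i) = i" if "i < length vs" for i
    unfolding idx_def using that vs(1) by (auto simp: nth_eq_iff_index_eq)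
  define f where "f v = vec_index x (idx v)" for v
  have xf: "x = Matrix.vec (length vs) (\<lambda>i. f (vs ! i))"
    using x(1) idx by (intro eq_vecI) (auto simp: f_def)
  show ?thesis
  proof (rule that[of "\<lambda>v. norm (f v)"])
    show "\<exists>v\<in>thurston_vertices d M. 0 < norm (f v)"
    proof (rule ccontr)
      assume "\<not> ?thesis"
      then have "f (vs ! i) = 0" if "i < length vs" for i
        using that vs(2) nth_mem by fastforce
      then have "x = 0\<^sub>v (length vs)" using xf by (intro eq_vecI) auto
      then show False using x(2) by simp
    qed
  next
    fix v assume "v \<in> thurston_vertices d M"
    then obtain i where i: "i < length vs" "v = vs ! i" using vs(2) by (metis in_set_conv_nth)
    have "norm ev * norm (f v) = norm (vec_index (ev \<cdot>\<^sub>v x) i)"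
      using i x(1) idx by (simp add: f_def norm_mult)
    also have "\<dots> = norm (\<Sum>q\<in>#thurston_targets d M v. f q)"
      using thurston_matrix_mult[OF i(1) xf] x(3) i(2) by simp
    also have "\<dots> \<le> (\<Sum>q\<in>#thurston_targets d M v. norm (f q))"
      by (rule norm_sum_mset_le)
    finally show "spectral_radius (thurston_matrix d M) * norm (f v) \<le> (\<Sum>q\<in>#thurston_targets d M v. norm (f q))"
      by (simp add: sr)
  qed auto
qed

lemma spectral_radius_nonneg: "0 \<le> spectral_radius (thurston_matrix d M)"
  using spectral_radius_mem_max(1)[OF thurston_matrix_carrier] length_vs by auto

context
  assumes size_le: "\<And>v. v \<in> thurston_vertices d M \<Longrightarrow> size (thurston_targets d M v) \<le> d"
begin

text \<open>
  Iterating the inequality \<open>n\<close> times bounds the left side by the sum of \<open>w\<close> over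
  the ends of all paths of length \<open>n\<close>. There are at most \<open>d ^ n\<close> of them, and at
  least one is lost if a vertex of smaller outdegree is met.
\<close>

lemma weighted_paths_le:
  fixes w :: "real set \<Rightarrow> real"
  assumes w: "\<And>v. v \<in> thurston_vertices d M \<Longrightarrow> 0 \<le> w v \<and> w v \<le> W"
    and \<rho>: "0 \<le> \<rho>" "\<And>v. v \<in> thurston_vertices d M \<Longrightarrow> \<rho> * w v \<le> (\<Sum>q\<in>#thurston_targets d M v. w q)"
    and v: "v \<in> thurston_vertices d M"
  shows "\<rho> ^ n * w v \<le> (if full_paths d M n v then real d ^ n else real d ^ n - 1) * W"
  using v
proof (induction n arbitrary: v)
  case 0
  then show ?case using w by simp
next
  case (Suc n)
  let ?T = "thurston_targets d M v"
  have W: "0 \<le> W" using w[OF Suc.prems] by linarith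
  \<comment> \<open>the number of paths known to be lost behind \<open>q\<close>\<close>
  define b where "b q = (if full_paths d M n q then 0 else 1 :: real)" for q
  have T: "set_mset ?T \<subseteq> thurston_vertices d M" by (rule closed[OF Suc.prems])
  have "\<rho> ^ Suc n * w v = \<rho> ^ n * (\<rho> * w v)" by simp
  also have "\<dots> \<le> \<rho> ^ n * (\<Sum>q\<in>#?T. w q)"
    using \<rho>(2)[OF Suc.prems] \<rho>(1) by (intro mult_left_mono) auto
  also have "\<dots> = (\<Sum>q\<in>#?T. \<rho> ^ n * w q)" by (simp add: sum_mset_distrib_left multiset.map_comp o_def)
  also have "\<dots> \<le> (\<Sum>q\<in>#?T. (real d ^ n - b q) * W)"
    using Suc.IH T by (intro sum_mset_mono) (fastforce simp: b_def)
  also have "\<dots> = (size ?T * real d ^ n - (\<Sum>q\<in>#?T. b q)) * W"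
  proof -
    have "(\<Sum>q\<in>#A. (real d ^ n - b q) * W) = (size A * real d ^ n - (\<Sum>q\<in>#A. b q)) * W" for A
      by (induction A) (auto simp: algebra_simps)
    then show ?thesis .
  qed
  also have "\<dots> \<le> (if full_paths d M (Suc n) v then real d ^ Suc n else real d ^ Suc n - 1) * W"
  proof (rule mult_right_mono[OF _ W])
    have sz: "size ?T \<le> d" by (rule size_le[OF Suc.prems])
    have b0: "0 \<le> (\<Sum>q\<in>#?T. b q)" by (rule sum_mset_nonneg) (simp add: b_def)
    have le: "real (size ?T) * real d ^ n \<le> real d * real d ^ n"
      using sz by (intro mult_right_mono) auto
    consider "full_paths d M (Suc n) v" | "size ?T < d" "\<not> full_paths d M (Suc n) v"
      | q where "q \<in># ?T" "\<not> full_paths d M n q" "\<not> full_paths d M (Suc n) v"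
      using sz by fastforce
    then show "size ?T * real d ^ n - (\<Sum>q\<in>#?T. b q)
        \<le> (if full_paths d M (Suc n) v then real d ^ Suc n else real d ^ Suc n - 1)"
    proof cases
      case 1 then show ?thesis using le b0 by (simp del: full_paths.simps)
    next
      case 2
      then have "real (size ?T) \<le> real d - 1" by linarith
      then have "real (size ?T) * real d ^ n \<le> (real d - 1) * real d ^ n"
        by (intro mult_right_mono) auto
      moreover have "1 \<le> real d ^ n" using 2(1) by simp
      ultimately show ?thesis using b0 unfolding if_not_P[OF 2(2)] power_Suc left_diff_distrib by linarith
    next
      case 3
      then obtain A where "?T = add_mset q A" by (metis mset_add)
      then have "1 \<le> (\<Sum>q\<in>#?T. b q)" using 3 sum_mset_nonneg[of b A] by (simp add: b_def)
      then show ?thesis using le 3 by (simp del: full_paths.simps)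
    qed
  qed
  finally show ?case .
qed

text \<open>
  Apply the path count at a vertex where the eigenfunction is maximal.
\<close>

lemma spectral_radius_power_le:
  obtains v where "v \<in> thurston_vertices d M"
    "spectral_radius (thurston_matrix d M) ^ n \<le> (if full_paths d M n v then real d ^ n else real d ^ n - 1)"
proof -
  obtain w where w: "\<And>v. v \<in> thurston_vertices d M \<Longrightarrow> 0 \<le> w v"
    "\<exists>v\<in>thurston_vertices d M. 0 < w v"
    "\<And>v. v \<in> thurston_vertices d M \<Longrightarrow>
       spectral_radius (thurston_matrix d M) * w v \<le> (\<Sum>q\<in>#thurston_targets d M v. w q)"
    using spectral_radius_eigenfunction by blast
  define W where "W = Max (w ` thurston_vertices d M)"
  have fin: "finite (w ` thurston_vertices d M)" using finite_vertices by simp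
  have le: "w v \<le> W" if "v \<in> thurston_vertices d M" for v
    unfolding W_def using that fin by auto
  then have W: "W > 0" using w(2) by fastforce
  have "W \<in> w ` thurston_vertices d M"
    unfolding W_def using fin vertices_nonempty by (intro Max_in) auto
  then obtain v where v: "v \<in> thurston_vertices d M" "w v = W" by auto
  have "spectral_radius (thurston_matrix d M) ^ n * w v \<le> (if full_paths d M n v then real d ^ n else real d ^ n - 1) * W"
    using w le spectral_radius_nonneg v(1) by (intro weighted_paths_le) auto
  then show ?thesis using that[OF v(1)] v(2) W by auto
qed

lemma spectral_radius_le: "spectral_radius (thurston_matrix d M) \<le> d"
proof -
  obtain v where "spectral_radius (thurston_matrix d M) ^ 1 \<le>
      (if full_paths d M 1 v then real d ^ 1 else real d ^ 1 - 1)"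
    by (rule spectral_radius_power_le)
  moreover have "(if b then real d ^ 1 else real d ^ 1 - 1) \<le> real d" for b
    by (cases b) simp_all
  ultimately show ?thesis by (metis order_trans power_one_right)
qed

end

text \<open>
  The indicator function of \<open>v\<close> is an eigenvector, as no other vertex has an edge to
  \<open>v\<close>.
\<close>

lemma spectral_radius_ge_self_loops:
  assumes v: "v \<in> thurston_vertices d M"
    and others: "\<And>q. q \<in> thurston_vertices d M \<Longrightarrow> q \<noteq> v \<Longrightarrow> v \<notin># thurston_targets d M q"
  shows "real (count (thurston_targets d M v) v) \<le> spectral_radius (thurston_matrix d M)"
proof -
  define k where "k = (of_nat (count (thurston_targets d M v) v) :: complex)"
  define f where "f q = (if q = v then 1 else 0 :: complex)" for q
  define x where "x = Matrix.vec (length vs) (\<lambda>i. f (vs ! i))"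
  have sum: "(\<Sum>q\<in>#A. f q) = of_nat (count A v)" for A
    by (induction A) (auto simp: f_def)
  obtain i where i: "i < length vs" "vs ! i = v" using v vs(2) by (metis in_set_conv_nth)
  have "thurston_matrix d M *\<^sub>v x = k \<cdot>\<^sub>v x"
  proof (rule eq_vecI)
    show "dim_vec (thurston_matrix d M *\<^sub>v x) = dim_vec (k \<cdot>\<^sub>v x)"
      using thurston_matrix_carrier by (simp add: x_def)
    fix j assume "j < dim_vec (k \<cdot>\<^sub>v x)"
    then have j: "j < length vs" by (simp add: x_def)
    have "vec_index (thurston_matrix d M *\<^sub>v x) j = of_nat (count (thurston_targets d M (vs ! j)) v)"
      using thurston_matrix_mult[OF j x_def] by (simp add: sum)
    also have "\<dots> = k * f (vs ! j)"
    proof (cases "vs ! j = v")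
      case False
      then have "v \<notin># thurston_targets d M (vs ! j)" using others vs(2) j nth_mem by blast
      then show ?thesis using False by (simp add: f_def not_in_iff)
    qed (simp add: f_def k_def)
    also have "\<dots> = vec_index (k \<cdot>\<^sub>v x) j" using j by (simp add: x_def)
    finally show "vec_index (thurston_matrix d M *\<^sub>v x) j = vec_index (k \<cdot>\<^sub>v x) j" .
  qed
  moreover have "x \<noteq> 0\<^sub>v (length vs)"
  proof
    assume "x = 0\<^sub>v (length vs)"
    then have "vec_index x i = 0" using i by simp
    then show False using i by (simp add: x_def f_def)
  qed
  ultimately have "eigenvector (thurston_matrix d M) x k"
    using thurston_matrix_carrier by (auto simp: eigenvector_def x_def)
  then have "k \<in> spectrum (thurston_matrix d M)" by (auto simp: spectrum_def eigenvalue_def)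
  then have "norm k \<le> spectral_radius (thurston_matrix d M)"
    by (intro spectral_radius_mem_max(2)[OF thurston_matrix_carrier]) (use length_vs in auto)
  then show ?thesis by (simp add: k_def)
qed

end

text \<open>
  This includes \<open>x = 0\<close>, where \<open>ln\<close> has the value 0; a spectral radius may vanish.
\<close>

lemma ln_le_ln_of_le: "0 \<le> (x::real) \<Longrightarrow> x \<le> c \<Longrightarrow> 1 \<le> c \<Longrightarrow> ln x \<le> ln c"
  by (cases "x = 0") auto

lemma rational_finite_thurston_graph:
  assumes m: "m \<in> RPM d" and d: "2 \<le> d"
  shows "finite_thurston_graph d m"
proof
  have M: "primitive_major d m" and r: "\<forall>L\<in>m. L \<subseteq> \<rat>" using m by (auto simp: RPM_def PM_def)
  show "finite (thurston_vertices d m)" by (intro finite_thurston_vertices finite_postcritical[OF M r])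
  have "m \<noteq> {}" using primitive_majorD(7)[OF M] d by auto
  then obtain L where "L \<in> m" by blast
  then show "thurston_vertices d m \<noteq> {}"
    using postcritical_leaf_image[of L m d] by (auto simp: thurston_vertices_def)
  show "set_mset (thurston_targets d m v) \<subseteq> thurston_vertices d m" if "v \<in> thurston_vertices d m" for v
    by (rule thurston_graph_closed[OF M that])
qed

lemma rational_entropy_le:
  assumes m: "m \<in> RPM d" and d: "2 \<le> d"
  shows "rational_core_entropy d m \<le> ln d"
proof -
  interpret finite_thurston_graph d m by (rule rational_finite_thurston_graph[OF m d])
  have M: "primitive_major d m" using m by (auto simp: RPM_def PM_def)
  show ?thesis unfolding rational_core_entropy_def
    using spectral_radius_nonneg spectral_radius_le[OF thurston_targets_size_le[OF M d]] d
    by (intro ln_le_ln_of_le) auto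
qed

lemma rational_entropy_full_paths:
  assumes m: "m \<in> RPM d" and d: "2 \<le> d" and n: "0 < n"
    and h: "ln (real d ^ n - 1) / n < rational_core_entropy d m"
  obtains x y where "x \<in> circle" "y \<in> circle" "full_paths d m n {x, y}"
proof -
  interpret finite_thurston_graph d m by (rule rational_finite_thurston_graph[OF m d])
  have M: "primitive_major d m" using m by (auto simp: RPM_def PM_def)
  let ?\<rho> = "spectral_radius (thurston_matrix d m)"
  obtain v where v: "v \<in> thurston_vertices d m"
    "?\<rho> ^ n \<le> (if full_paths d m n v then real d ^ n else real d ^ n - 1)"
    by (rule spectral_radius_power_le[OF thurston_targets_size_le[OF M d]])
  have "real d ^ 1 \<le> real d ^ n" using d n by (intro power_increasing) auto
  then have "real d \<le> real d ^ n" by (simp only: power_one_right)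
  moreover have "2 \<le> real d" using d by simp
  ultimately have d1: "1 \<le> real d ^ n - 1" by linarith
  have "full_paths d m n v"
  proof (rule ccontr)
    assume nf: "\<not> full_paths d m n v"
    have le: "?\<rho> ^ n \<le> real d ^ n - 1" using v(2) unfolding if_not_P[OF nf] .
    have "n * ln ?\<rho> = ln (?\<rho> ^ n)"
      using spectral_radius_nonneg n by (cases "?\<rho> = 0") (auto simp: ln_realpow power_0_left)
    also have "\<dots> \<le> ln (real d ^ n - 1)"
      using le d1 spectral_radius_nonneg by (intro ln_le_ln_of_le) auto
    finally have "ln ?\<rho> \<le> ln (real d ^ n - 1) / n" using n by (simp add: field_simps)
    then show False using h by (simp add: rational_core_entropy_def)
  qed
  moreover obtain x y where "v = {x, y}" "x \<in> postcritical d m" "y \<in> postcritical d m"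
    using v(1) by (auto simp: thurston_vertices_def)
  ultimately show ?thesis using that[of x y] postcritical_circle[OF M] by blast
qed

section \<open>Density of the rational majors\<close>

text \<open>
  The function \<open>g = leaf_dist M x\<close> is 1-Lipschitz and constant on each leaf of
  \<open>M\<close>; any such function for \<open>M'\<close> yields a pseudometric below \<open>leaf_dist
  M'\<close>, so \<open>g\<close> has to be adapted to \<open>M'\<close>. After shrinking by the factor
  \<open>1 - \<eta>\<close>, the values of \<open>g\<close> prescribed at the displaced endpoints still form
  a 1-Lipschitz function on these finitely many points, because endpoints of different leaves are at least
  \<open>\<sigma>\<close> apart. Clamping \<open>g\<close> between the two extremal Lipschitz extensions of
  these values makes it constant on the leaves of \<open>M'\<close> and moves it by at most
  \<open>\<epsilon>\<close>.
\<close>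

lemma leaf_dist_transfer:
  fixes f :: "real set \<Rightarrow> real set"
  assumes M: "\<And>L. L \<in> M \<Longrightarrow> L \<subseteq> circle" and f: "\<And>L. L \<in> M' \<Longrightarrow> f L \<in> M"
    and M': "finite M'" "M' \<noteq> {}" "\<And>L. L \<in> M' \<Longrightarrow> L \<subseteq> circle \<and> finite L \<and> L \<noteq> {}"
    and close: "\<And>L e. L \<in> M' \<Longrightarrow> e \<in> L \<Longrightarrow> \<exists>e'\<in>f L. arc_dist e' e \<le> \<epsilon>"
    and far: "\<And>L K e k. L \<in> M' \<Longrightarrow> K \<in> M' \<Longrightarrow> L \<noteq> K \<Longrightarrow> e \<in> L \<Longrightarrow> k \<in> K \<Longrightarrow> \<sigma> \<le> arc_dist e k"
    and \<epsilon>: "0 \<le> \<epsilon>" "0 \<le> \<eta>" "\<eta> \<le> 1" "2 * \<epsilon> \<le> \<eta> * \<sigma>"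
    and xy: "x \<in> circle" "y \<in> circle"
  shows "leaf_dist M x y \<le> leaf_dist M' x y + \<eta> + 2 * \<epsilon>"
proof -
  define g where "g u = (1 - \<eta>) * leaf_dist M x u" for u
  have LM: "leaf_dist M \<in> leaf_pseudometrics M" by (rule leaf_dist_in[OF M])
  have tri: "leaf_dist M x u \<le> leaf_dist M x v + leaf_dist M v u" if "u \<in> circle" "v \<in> circle" for u v
    using LM xy that unfolding leaf_pseudometrics_def pseudometric_on_def by blast
  have sym: "leaf_dist M u v = leaf_dist M v u" if "u \<in> circle" "v \<in> circle" for u v
    using LM xy that unfolding leaf_pseudometrics_def pseudometric_on_def by blast
  have g_Lip1: "g u - g v \<le> (1 - \<eta>) * arc_dist u v" if uv: "u \<in> circle" "v \<in> circle" for u v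
  proof -
    have "leaf_dist M x u - leaf_dist M x v \<le> arc_dist u v"
      using tri[OF uv] sym[OF uv] leaf_dist_le_arc[OF uv, of M] by linarith
    then show ?thesis using \<epsilon>(3) by (simp add: g_def right_diff_distrib[symmetric] mult_left_mono)
  qed
  have g_leaf: "g u = g v" if "L \<in> M" "u \<in> L" "v \<in> L" for u v L
  proof -
    have uv: "u \<in> circle" "v \<in> circle" using M[OF that(1)] that(2,3) by blast+
    have "leaf_dist M u v = 0" using LM that unfolding leaf_pseudometrics_def by blast
    then show ?thesis using tri[OF uv] tri[OF uv(2,1)] sym[OF uv] by (simp add: g_def)
  qed
  have Lip: "(1 - \<eta>) * arc_dist u v \<le> arc_dist u v" if uv: "u \<in> circle" "v \<in> circle" for u v
    using arc_dist_bounds[OF uv] \<epsilon>(2) by (simp add: left_diff_distrib)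
  \<comment> \<open>the value of \<open>g\<close> on the leaf of \<open>M\<close> that corresponds to \<open>L\<close>\<close>
  define v where "v L = g (SOME e. e \<in> f L)" for L
  have v: "v L = g e" if "L \<in> M'" "e \<in> f L" for L e
    unfolding v_def by (rule g_leaf[OF f[OF that(1)] someI[of "\<lambda>e. e \<in> f L", OF that(2)] that(2)])
  define P where "P = (SIGMA L:M'. L)"
  have P: "finite P" "P \<noteq> {}" using M' by (auto simp: P_def)
  have Pc: "snd a \<in> circle" if "a \<in> P" for a
  proof -
    have "fst a \<in> M'" "snd a \<in> fst a" using that by (auto simp: P_def)
    then show ?thesis using M'(3) by blast
  qed
  have v_Lip: "v (fst a) - v (fst b) \<le> arc_dist (snd a) (snd b)" if ab: "a \<in> P" "b \<in> P" for a b
  proof (cases "fst a = fst b")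
    case True
    then show ?thesis using arc_dist_bounds[OF Pc[OF ab(1)] Pc[OF ab(2)]] by simp
  next
    case False
    have L: "fst a \<in> M'" "fst b \<in> M'" "snd a \<in> fst a" "snd b \<in> fst b" using ab by (auto simp: P_def)
    obtain e where e: "e \<in> f (fst a)" "arc_dist e (snd a) \<le> \<epsilon>" using close L by blast
    obtain k where k: "k \<in> f (fst b)" "arc_dist k (snd b) \<le> \<epsilon>" using close L by blast
    have c: "e \<in> circle" "k \<in> circle" "snd a \<in> circle" "snd b \<in> circle"
      using M[OF f[OF L(1)]] M[OF f[OF L(2)]] e k Pc ab by auto
    define A where "A = arc_dist (snd a) (snd b)"
    have "arc_dist e k \<le> A + 2 * \<epsilon>"
      using arc_dist_triangle[OF c(1,3,2)] arc_dist_triangle[OF c(3,4,2)] e(2) k(2) arc_dist_commute[of k "snd b"]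
      by (simp add: A_def)
    then have "(1 - \<eta>) * arc_dist e k \<le> (1 - \<eta>) * (A + 2 * \<epsilon>)"
      using \<epsilon>(3) by (intro mult_left_mono) auto
    also have "\<dots> = A + 2 * \<epsilon> - \<eta> * A - \<eta> * (2 * \<epsilon>)" by (simp add: algebra_simps)
    also have "\<dots> \<le> A"
    proof -
      have "\<eta> * \<sigma> \<le> \<eta> * A" unfolding A_def using far L False \<epsilon>(2) by (intro mult_left_mono) auto
      moreover have "0 \<le> \<eta> * (2 * \<epsilon>)" using \<epsilon> by simp
      ultimately show ?thesis using \<epsilon>(4) by linarith
    qed
    finally show ?thesis
      using g_Lip1[OF c(1,2)] v[OF L(1) e(1)] v[OF L(2) k(1)] by (simp add: A_def)
  qed
  \<comment> \<open>the smallest and the largest 1-Lipschitz function with the values \<open>v\<close> on the leaves of \<open>M'\<close>\<close>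
  define lo where "lo z = Max ((\<lambda>a. v (fst a) - arc_dist z (snd a)) ` P)" for z
  define hi where "hi z = Min ((\<lambda>a. v (fst a) + arc_dist z (snd a)) ` P)" for z
  define G where "G z = max (lo z) (min (hi z) (g z))" for z
  have lo_le: "lo z \<le> c \<longleftrightarrow> (\<forall>a\<in>P. v (fst a) - arc_dist z (snd a) \<le> c)" for z c
    unfolding lo_def using P by (subst Max_le_iff) auto
  have hi_ge: "c \<le> hi z \<longleftrightarrow> (\<forall>a\<in>P. c \<le> v (fst a) + arc_dist z (snd a))" for z c
    unfolding hi_def using P by (subst Min_ge_iff) auto
  have G_leaf: "G e = v L" if "L \<in> M'" "e \<in> L" for L e
  proof -
    have a: "(L, e) \<in> P" using that by (auto simp: P_def)
    have "lo e \<le> v L" unfolding lo_le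
    proof
      fix b assume b: "b \<in> P"
      show "v (fst b) - arc_dist e (snd b) \<le> v L"
        using v_Lip[OF b a] arc_dist_commute[of e "snd b"] by simp
    qed
    moreover have "v L \<le> lo e" using lo_le[of e "lo e"] a by force
    moreover have "hi e \<le> v L" using hi_ge[of "hi e" e] a by force
    ultimately show ?thesis by (auto simp: G_def)
  qed
  have G_Lip: "G z \<le> G z' + arc_dist z z'" if z: "z \<in> circle" "z' \<in> circle" for z z'
  proof -
    have "lo z \<le> lo z' + arc_dist z z'" unfolding lo_le
    proof
      fix a assume a: "a \<in> P"
      have "v (fst a) - arc_dist z' (snd a) \<le> lo z'" using lo_le[of z' "lo z'"] a by blast
      then show "v (fst a) - arc_dist z (snd a) \<le> lo z' + arc_dist z z'"
        using arc_dist_triangle[OF z(2,1) Pc[OF a]] arc_dist_commute[of z z'] by linarith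
    qed
    moreover have "hi z - arc_dist z z' \<le> hi z'" unfolding hi_ge
    proof
      fix a assume a: "a \<in> P"
      have "hi z \<le> v (fst a) + arc_dist z (snd a)" using hi_ge[of "hi z" z] a by blast
      then show "hi z - arc_dist z z' \<le> v (fst a) + arc_dist z' (snd a)"
        using arc_dist_triangle[OF z(1,2) Pc[OF a]] by linarith
    qed
    moreover have "g z \<le> g z' + arc_dist z z'" using g_Lip1[OF z] Lip[OF z] by linarith
    ultimately show ?thesis unfolding G_def by linarith
  qed
  have G_close: "\<bar>G z - g z\<bar> \<le> \<epsilon>" if z: "z \<in> circle" for z
  proof -
    have *: "\<bar>v (fst a) - g z\<bar> \<le> arc_dist z (snd a) + \<epsilon>" if a: "a \<in> P" for a
    proof -
      have L: "fst a \<in> M'" "snd a \<in> fst a" using a by (auto simp: P_def)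
      obtain e where e: "e \<in> f (fst a)" "arc_dist e (snd a) \<le> \<epsilon>" using close L by blast
      have c: "e \<in> circle" using M[OF f[OF L(1)]] e by auto
      have "arc_dist z e \<le> arc_dist z (snd a) + \<epsilon>"
        using arc_dist_triangle[OF z Pc[OF a] c] arc_dist_commute[of e "snd a"] e(2) by linarith
      moreover have "\<bar>g e - g z\<bar> \<le> arc_dist z e"
        using g_Lip1[OF c z, unfolded arc_dist_commute[of e z]] g_Lip1[OF z c] Lip[OF z c] by linarith
      ultimately show ?thesis using v[OF L(1) e(1)] by linarith
    qed
    have "lo z \<le> g z + \<epsilon>" unfolding lo_le using * by (force simp: abs_le_iff)
    moreover have "g z - \<epsilon> \<le> hi z" unfolding hi_ge using * by (force simp: abs_le_iff)
    ultimately show ?thesis unfolding G_def using \<epsilon>(1) by (auto simp: max_def min_def abs_le_iff)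
  qed
  define \<rho> where "\<rho> z z' = \<bar>G z - G z'\<bar>" for z z'
  have "\<rho> \<in> leaf_pseudometrics M'"
    unfolding leaf_pseudometrics_def
  proof (intro CollectI conjI ballI)
    show "pseudometric_on circle \<rho>" unfolding pseudometric_on_def \<rho>_def by (intro conjI ballI) linarith+
    show "\<rho> z z' \<le> arc_dist z z'" if "z \<in> circle" "z' \<in> circle" for z z'
      using G_Lip[OF that] G_Lip[OF that(2,1)] arc_dist_commute[of z z'] unfolding \<rho>_def by linarith
    show "\<rho> e e' = 0" if "L \<in> M'" "e \<in> L" "e' \<in> L" for L e e'
      using G_leaf that by (simp add: \<rho>_def)
  qed
  then have "\<bar>G x - G y\<bar> \<le> leaf_dist M' x y"
    using leaf_dist_greatest[OF _ xy] unfolding \<rho>_def by blast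
  moreover have "g x = 0" using LM xy unfolding g_def leaf_pseudometrics_def pseudometric_on_def by auto
  ultimately have "g y \<le> leaf_dist M' x y + 2 * \<epsilon>"
    using G_close[OF xy(1)] G_close[OF xy(2)] by linarith
  moreover have "\<eta> * leaf_dist M x y \<le> \<eta> * 1"
    using leaf_dist_le_arc[OF xy, of M] arc_dist_bounds[OF xy] \<epsilon>(2) by (intro mult_left_mono) linarith+
  ultimately show ?thesis by (simp add: g_def algebra_simps)
qed

definition rotate_leaf :: "real \<Rightarrow> real set \<Rightarrow> real set" where
  "rotate_leaf t L = (\<lambda>x. frac (x + t)) ` L"

lemma rotate_leaf_polygon: "leaf_polygon (rotate_leaf t L) = (\<lambda>z. circle_point t * z) ` leaf_polygon L"
proof -
  have "circle_point ` rotate_leaf t L = (\<lambda>z. circle_point t * z) ` circle_point ` L"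
    by (simp add: rotate_leaf_def image_image circle_point_add)
  then show ?thesis
    unfolding leaf_polygon_def
    by (simp add: convex_hull_linear_image[OF bounded_linear.linear[OF bounded_linear_mult_right]])
qed

text \<open>
  A rotated leaf still has endpoints with a common image, since these differ by multiples of \<open>1 /
  d\<close>; for the same reason all its endpoints are rational as soon as one is. Disjointness of the
  polygons is an open condition. So each leaf can be rotated by its own small angle that makes it rational.
\<close>

lemma rational_majors_dense:
  assumes d: "2 \<le> d" and M: "M \<in> PM d" and \<delta>: "0 < \<delta>"
  obtains m where "m \<in> RPM d" "PM_dist M m \<le> \<delta>"
    "\<And>L. L \<in> M \<Longrightarrow> \<exists>K\<in>m. \<forall>x\<in>L. \<exists>y\<in>K. arc_dist x y \<le> \<delta>"
proof -
  have pm: "primitive_major d M" using M by (simp add: PM_def)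
  note pmD = primitive_majorD[OF pm]
  have "\<exists>\<mu>>0. \<forall>s\<in>(SIGMA L:M. L) \<times> (SIGMA L:M. L). fst (fst s) \<noteq> fst (snd s) \<longrightarrow> \<mu> \<le> arc_dist (snd (fst s)) (snd (snd s))"
  proof (rule finite_uniform_bound)
    show "finite ((SIGMA L:M. L) \<times> (SIGMA L:M. L))" using pmD by auto
    fix s assume s: "s \<in> (SIGMA L:M. L) \<times> (SIGMA L:M. L)"
    obtain L e K k where s': "s = ((L, e), (K, k))" by (metis surj_pair)
    have "L \<in> M" "K \<in> M" "e \<in> L" "k \<in> K" using s by (auto simp: s')
    then have "L \<noteq> K \<longrightarrow> 0 < arc_dist e k"
      using PM_leaves_disjoint[OF M, of L K e] arc_dist_pos[of e k] pmD(2) by blast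
    then show "\<exists>\<mu>>0. fst (fst s) \<noteq> fst (snd s) \<longrightarrow> \<mu> \<le> arc_dist (snd (fst s)) (snd (snd s))"
      unfolding s' by (cases "L = K") (auto intro: exI[of _ 1])
  qed auto
  then obtain \<sigma> where "\<sigma> > 0" and "\<forall>s\<in>(SIGMA L:M. L) \<times> (SIGMA L:M. L). fst (fst s) \<noteq> fst (snd s) \<longrightarrow> \<sigma> \<le> arc_dist (snd (fst s)) (snd (snd s))"
    by blast
  then have \<sigma>: "\<sigma> > 0" "\<And>L K e k. L \<in> M \<Longrightarrow> K \<in> M \<Longrightarrow> L \<noteq> K \<Longrightarrow> e \<in> L \<Longrightarrow> k \<in> K \<Longrightarrow> \<sigma> \<le> arc_dist e k"
    by force+
  have "\<exists>\<mu>>0. \<forall>s\<in>M \<times> M. fst s \<noteq> snd s \<longrightarrow>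
      (\<forall>z\<in>leaf_polygon (fst s). \<forall>z'\<in>leaf_polygon (snd s). \<mu> \<le> dist z z')"
  proof (rule finite_uniform_bound)
    show "finite (M \<times> M)" using pmD by auto
    fix s assume "s \<in> M \<times> M"
    then obtain L K where s': "s = (L, K)" and LK: "L \<in> M" "K \<in> M" by auto
    show "\<exists>\<mu>>0. fst s \<noteq> snd s \<longrightarrow> (\<forall>z\<in>leaf_polygon (fst s). \<forall>z'\<in>leaf_polygon (snd s). \<mu> \<le> dist z z')"
    proof (cases "L = K")
      case False
      then have "leaf_polygon L \<inter> leaf_polygon K = {}" using pmD(5)[OF LK] by (simp add: disjnt_def)
      then obtain \<mu> where "\<mu> > 0" "\<forall>z\<in>leaf_polygon L. \<forall>z'\<in>leaf_polygon K. \<mu> \<le> dist z z'"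
        using separate_compact_closed[OF compact_leaf_polygon[OF pmD(3)[OF LK(1)]] compact_imp_closed[OF compact_leaf_polygon[OF pmD(3)[OF LK(2)]]]]
        by auto
      then show ?thesis unfolding s' by auto
    qed (auto simp: s' intro: exI[of _ 1])
  qed (meson order_trans)
  then obtain \<mu> where "\<mu> > 0" and "\<forall>s\<in>M \<times> M. fst s \<noteq> snd s \<longrightarrow>
      (\<forall>z\<in>leaf_polygon (fst s). \<forall>z'\<in>leaf_polygon (snd s). \<mu> \<le> dist z z')"
    by blast
  then have \<mu>: "\<mu> > 0" "\<And>L K z z'. L \<in> M \<Longrightarrow> K \<in> M \<Longrightarrow> L \<noteq> K \<Longrightarrow>
      z \<in> leaf_polygon L \<Longrightarrow> z' \<in> leaf_polygon K \<Longrightarrow> \<mu> \<le> dist z z'"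
    by force+
  obtain \<epsilon>0 where \<epsilon>0: "0 < \<epsilon>0" "\<And>t. \<bar>t\<bar> < \<epsilon>0 \<Longrightarrow> norm (circle_point t - 1) < \<mu> / 2"
    using circle_point_near_1[of "\<mu> / 2"] \<mu>(1) by auto
  \<comment> \<open>one half of \<open>\<delta>\<close> is spent on shrinking and the other half on the displacement; rotated leaves stay \<open>\<sigma> / 2\<close> apart\<close>
  define \<eta> where "\<eta> = min (\<delta> / 2) 1"
  define \<epsilon> where "\<epsilon> = min (min (\<epsilon>0 / 2) (\<delta> / 4)) (min (\<sigma> / 4) (\<eta> * \<sigma> / 4))"
  have \<eta>: "0 < \<eta>" "\<eta> \<le> 1" "\<eta> \<le> \<delta> / 2" using \<delta> by (auto simp: \<eta>_def)
  have \<epsilon>: "0 < \<epsilon>" using \<eta> \<epsilon>0(1) \<delta> \<sigma>(1) by (auto simp: \<epsilon>_def)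
  have \<epsilon>_le: "\<epsilon> < \<epsilon>0" "\<epsilon> \<le> \<delta> / 4" "\<epsilon> \<le> \<sigma> / 4" "\<epsilon> \<le> \<eta> * \<sigma> / 4" using \<epsilon>0(1) by (auto simp: \<epsilon>_def min_def)
  have "\<exists>t. \<bar>t\<bar> \<le> \<epsilon> \<and> (\<exists>x\<in>L. x + t \<in> \<rat>)" if L: "L \<in> M" for L
  proof -
    obtain x where x: "x \<in> L" using leaf_nonempty[OF pm L] by blast
    obtain r where "r \<in> \<rat>" "x < r" "r < x + \<epsilon>" using Rats_dense_in_real[of x "x + \<epsilon>"] \<epsilon> by auto
    then show ?thesis using x by (intro exI[of _ "r - x"] conjI bexI[of _ x]) auto
  qed
  then obtain \<tau> where \<tau>: "\<And>L. L \<in> M \<Longrightarrow> \<bar>\<tau> L\<bar> \<le> \<epsilon>" "\<And>L. L \<in> M \<Longrightarrow> \<exists>x\<in>L. x + \<tau> L \<in> \<rat>"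
    by metis
  define R where "R L = rotate_leaf (\<tau> L) L" for L
  have R_near: "arc_dist x (frac (x + \<tau> L)) \<le> \<epsilon>" if "L \<in> M" "x \<in> L" for L x
  proof -
    have "frac x = x" using pmD(2)[OF that(1)] that(2) by (intro frac_circle_eq) blast
    then show ?thesis using arc_dist_frac_le[of x "x + \<tau> L"] \<tau>(1)[OF that(1)] by simp
  qed
  have R_disjoint: "disjnt (leaf_polygon (R L)) (leaf_polygon (R K))" if LK: "L \<in> M" "K \<in> M" "L \<noteq> K" for L K
  proof (rule ccontr)
    assume "\<not> ?thesis"
    then obtain z z' where z: "z \<in> leaf_polygon L" "z' \<in> leaf_polygon K"
        "circle_point (\<tau> L) * z = circle_point (\<tau> K) * z'"
      by (auto simp: disjnt_def R_def rotate_leaf_polygon)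
    have near: "dist w (circle_point (\<tau> L) * w) < \<mu> / 2" if "L \<in> M" "w \<in> leaf_polygon L" for L w
    proof -
      have "dist w (circle_point (\<tau> L) * w) = norm (circle_point (\<tau> L) - 1) * norm w"
        by (simp add: dist_norm norm_minus_commute left_diff_distrib flip: norm_mult)
      also have "\<dots> \<le> norm (circle_point (\<tau> L) - 1) * 1"
        using leaf_polygon_norm[OF that(2)] by (intro mult_left_mono) auto
      also have "\<dots> < \<mu> / 2" using \<epsilon>0(2)[of "\<tau> L"] \<tau>(1)[OF that(1)] \<epsilon>_le(1) by simp
      finally show ?thesis .
    qed
    have "dist z' (circle_point (\<tau> L) * z) < \<mu> / 2" using near[OF LK(2) z(2)] z(3) by simp
    then have "dist z z' < \<mu>"
      using near[OF LK(1) z(1)]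
        dist_triangle[of z z' "circle_point (\<tau> L) * z"] dist_commute[of z' "circle_point (\<tau> L) * z"] by linarith
    then show False using \<mu>(2)[OF LK z(1,2)] by simp
  qed
  have inj: "inj_on R M"
  proof (rule inj_onI, rule ccontr)
    fix L K assume LK: "L \<in> M" "K \<in> M" "R L = R K" "L \<noteq> K"
    have "R L \<noteq> {}" using leaf_nonempty[OF pm LK(1)] by (simp add: R_def rotate_leaf_def)
    then show False using R_disjoint[OF LK(1,2,4)] LK(3) leaf_polygon_nonempty[of "R L"] by (simp add: disjnt_def)
  qed
  have card_R: "card (R L) = card L" if "L \<in> M" for L
    unfolding R_def rotate_leaf_def using pmD(2)[OF that]
    by (intro card_image inj_onI) (meson frac_add_inj subset_iff)
  have R_circle: "R L \<subseteq> circle" for L unfolding R_def rotate_leaf_def using frac_circle by blast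
  define m where "m = R ` M"
  have m: "primitive_major d m"
    unfolding primitive_major_def
  proof (intro conjI ballI impI)
    show "finite m" using pmD(1) by (simp add: m_def)
    show "K \<subseteq> circle" if "K \<in> m" for K using that R_circle by (auto simp: m_def)
    show "finite K" if "K \<in> m" for K using that pmD(3) by (auto simp: m_def R_def rotate_leaf_def)
    show "2 \<le> card K" if "K \<in> m" for K using that pmD(4) card_R by (auto simp: m_def)
    show "disjnt (leaf_polygon K) (leaf_polygon K')" if "K \<in> m" "K' \<in> m" "K \<noteq> K'" for K K'
      using that R_disjoint by (auto simp: m_def)
    show "circle_map d x = circle_map d y" if K: "K \<in> m" "x \<in> K" "y \<in> K" for K x y
    proof -
      obtain L where "L \<in> M" "K = R L" using K(1) unfolding m_def by blast
      then obtain x' y' where L: "L \<in> M" "x' \<in> L" "y' \<in> L" "x = frac (x' + \<tau> L)" "y = frac (y' + \<tau> L)"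
        using K(2,3) unfolding R_def rotate_leaf_def by blast
      have "real d * (x' + \<tau> L) - real d * (y' + \<tau> L) = real d * x' - real d * y'" by (simp add: algebra_simps)
      moreover have "real d * x' - real d * y' \<in> \<int>"
        using pmD(6)[OF L(1-3)] by (simp add: circle_map_def frac_eq_frac_iff)
      ultimately show ?thesis unfolding L(4,5) circle_map_frac frac_eq_frac_iff by simp
    qed
    show "(\<Sum>L\<in>m. card L - 1) = d - 1"
      unfolding m_def sum.reindex[OF inj] using pmD(7) card_R by simp
  qed
  have rat: "K \<subseteq> \<rat>" if K: "K \<in> m" for K
  proof
    fix y assume "y \<in> K"
    then obtain L x where L: "L \<in> M" "x \<in> L" "y = frac (x + \<tau> L)" using K by (auto simp: m_def R_def rotate_leaf_def)
    obtain x0 where x0: "x0 \<in> L" "x0 + \<tau> L \<in> \<rat>" using \<tau>(2)[OF L(1)] by blast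
    have "real d * x - real d * x0 \<in> \<int>"
      using pmD(6)[OF L(1,2) x0(1)] by (simp add: circle_map_def frac_eq_frac_iff)
    then obtain k where "real d * x - real d * x0 = of_int k" by (auto elim: Ints_cases)
    then have "x - x0 = of_int k / real d" using d by (simp add: field_simps)
    then have "x - x0 \<in> \<rat>" by simp
    then have "(x0 + \<tau> L) + (x - x0) \<in> \<rat>" using x0(2) by (rule Rats_add[rotated])
    then have "x + \<tau> L \<in> \<rat>" by (simp add: add.commute)
    then show "y \<in> \<rat>" unfolding L(3) frac_def by (intro Rats_diff) auto
  qed
  have "m \<in> RPM d" using m rat by (auto simp: RPM_def PM_def)
  have ne: "M \<noteq> {}" using pmD(7) d by auto
  define R' where "R' = the_inv_into M R"
  have R': "R' (R L) = L" if "L \<in> M" for L using that inj by (simp add: R'_def the_inv_into_f_f)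
  have "PM_dist M m \<le> \<delta>"
  proof (rule PM_dist_least)
    fix x y :: real assume xy: "x \<in> circle" "y \<in> circle"
    have "leaf_dist M x y \<le> leaf_dist m x y + \<eta> + 2 * \<epsilon>"
    proof (rule leaf_dist_transfer[where f = R' and \<sigma> = "\<sigma> / 2"])
      show "R' L \<in> M" if "L \<in> m" for L using that R' by (auto simp: m_def)
      show "finite m" "m \<noteq> {}" using pmD(1) ne by (auto simp: m_def)
      show "L \<subseteq> circle \<and> finite L \<and> L \<noteq> {}" if "L \<in> m" for L
        using primitive_majorD(2,3)[OF m that] leaf_nonempty[OF m that] by blast
      show "\<exists>e'\<in>R' L. arc_dist e' e \<le> \<epsilon>" if L: "L \<in> m" "e \<in> L" for L e
      proof -
        obtain K where K: "K \<in> M" "L = R K" using L(1) unfolding m_def by blast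
        then obtain x where x: "x \<in> K" "e = frac (x + \<tau> K)" using L(2) unfolding R_def rotate_leaf_def by blast
        then show ?thesis using R'[OF K(1)] R_near[OF K(1) x(1)] K(2) by auto
      qed
      show "\<sigma> / 2 \<le> arc_dist e k" if LK: "L \<in> m" "K \<in> m" "L \<noteq> K" and ek: "e \<in> L" "k \<in> K" for L K e k
      proof -
        obtain L' K' where L': "L' \<in> M" "K' \<in> M" "L' \<noteq> K'" "L = R L'" "K = R K'" using LK by (auto simp: m_def)
        obtain e' k' where e': "e' \<in> L'" "k' \<in> K'" "e = frac (e' + \<tau> L')" "k = frac (k' + \<tau> K')"
          using ek L' by (auto simp: R_def rotate_leaf_def)
        have c: "e' \<in> circle" "k' \<in> circle" "e \<in> circle" "k \<in> circle"
          using pmD(2)[OF L'(1)] pmD(2)[OF L'(2)] e' frac_circle by auto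
        show ?thesis
          using \<sigma>(2)[OF L'(1-3) e'(1,2)] arc_dist_triangle[OF c(1,3,2)] arc_dist_triangle[OF c(3,4,2)]
            R_near[OF L'(1) e'(1)] R_near[OF L'(2) e'(2)] arc_dist_commute[of k k'] \<epsilon>_le(3) unfolding e'(3,4) by linarith
      qed
      show "2 * \<epsilon> \<le> \<eta> * (\<sigma> / 2)" using \<epsilon>_le(4) by simp
    qed (use pmD(2) \<epsilon> \<eta> xy in auto)
    moreover have "leaf_dist m x y \<le> leaf_dist M x y + \<eta> + 2 * \<epsilon>"
    proof (rule leaf_dist_transfer[where f = R and \<sigma> = \<sigma>])
      show "R L \<in> m" if "L \<in> M" for L using that by (auto simp: m_def)
      show "L \<subseteq> circle \<and> finite L \<and> L \<noteq> {}" if "L \<in> M" for L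
        using pmD(2,3)[OF that] leaf_nonempty[OF pm that] by blast
      show "\<exists>e'\<in>R L. arc_dist e' e \<le> \<epsilon>" if "L \<in> M" "e \<in> L" for L e
        using R_near[OF that] arc_dist_commute that by (auto simp: R_def rotate_leaf_def)
      have "0 \<le> \<eta> * \<sigma>" using \<eta> \<sigma> by simp
      then show "2 * \<epsilon> \<le> \<eta> * \<sigma>" using \<epsilon>_le(4) by simp
    qed (use primitive_majorD(2)[OF m] pmD(1) ne \<sigma> \<epsilon> \<eta> xy in auto)
    ultimately show "\<bar>leaf_dist M x y - leaf_dist m x y\<bar> \<le> \<delta>"
      using \<eta>(3) \<epsilon>_le(2) by linarith
  qed
  moreover have "\<exists>K\<in>m. \<forall>x\<in>L. \<exists>y\<in>K. arc_dist x y \<le> \<delta>" if "L \<in> M" for L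
  proof (rule bexI[of _ "R L"], rule ballI)
    show "R L \<in> m" using that by (simp add: m_def)
    fix x assume x: "x \<in> L"
    show "\<exists>y\<in>R L. arc_dist x y \<le> \<delta>"
      using R_near[OF that x] \<epsilon>_le(2) \<delta> x by (intro bexI[of _ "frac (x + \<tau> L)"]) (auto simp: R_def rotate_leaf_def)
  qed
  ultimately show ?thesis using that \<open>m \<in> RPM d\<close> by blast
qed

section \<open>Alternating chains\<close>

text \<open>
  The points \<open>p < U 1 < ... < U (d - 1) < q\<close> at which the leaves cut the arc from
  \<open>p\<close> to \<open>q\<close>.
\<close>

definition chain_cuts :: "nat \<Rightarrow> (nat \<Rightarrow> real) \<Rightarrow> real \<Rightarrow> real \<Rightarrow> nat \<Rightarrow> real" where
  "chain_cuts d U p q i = (if i = 0 then p else if i < d then U i else q)"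

text \<open>
  The number \<open>g\<close> is the length of the positively oriented arc from the first point to the
  second when \<open>E\<close> relates a point of the first end arc to a point of the second one.
\<close>

definition chain_link :: "(real \<Rightarrow> real \<Rightarrow> bool) \<Rightarrow> real \<Rightarrow> real \<Rightarrow> real \<Rightarrow> bool" where
  "chain_link E a b g \<longleftrightarrow> E a b \<and> g = b - a \<or> E b a \<and> g = 1 - (a - b)"

text \<open>
  The analytic content of a long path through vertices of outdegree \<open>d\<close>. The two end arcs of
  length \<open>1 / d\<close> start at \<open>\<alpha>\<close> and \<open>\<beta>\<close>; \<open>E n p
  q\<close> stands for a vertex \<open>{p, q}\<close>, with \<open>p\<close> in the first arc and
  \<open>q\<close> in the second, such that paths from it meet only vertices of outdegree \<open>d\<close>
  in their first \<open>n + 1\<close> positions. The points \<open>s i\<close> are lifts of the images of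
  the cut points. Those that come from leaves do not depend on \<open>p\<close> and \<open>q\<close>; this
  is what makes two such vertices comparable.
\<close>

locale alternating_chains =
  fixes d :: nat and \<alpha> \<beta> :: real and U t :: "nat \<Rightarrow> real"
    and E :: "nat \<Rightarrow> real \<Rightarrow> real \<Rightarrow> bool"
  assumes d2: "2 \<le> d"
    and AB: "\<alpha> + 1 / d \<le> \<beta>"
    and E_range: "E n p q \<Longrightarrow> \<alpha> < p \<and> p < \<alpha> + 1 / d \<and> \<beta> < q \<and> q < \<beta> + 1 / d"
    and E_Suc: "E (Suc n) p q \<Longrightarrow> E n p q"
    and E_step: "E (Suc n) p q \<Longrightarrow>
      \<exists>s. (\<forall>i<d. chain_link (E n) (s i) (s (Suc i))
                  (d * (chain_cuts d U p q (Suc i) - chain_cuts d U p q i))) \<and>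
          (\<forall>i\<in>{1..<d}. s i = t i) \<and> (\<forall>i\<le>d. d * chain_cuts d U p q i - s i \<in> \<int>)"
begin

text \<open>
  The images of \<open>p\<close> and \<open>p'\<close> are both paired with the image \<open>t 1\<close> of
  the first leaf. They lie in the same end arc, at \<open>d\<close> times the original distance, and one
  level less remains. The same holds for \<open>q\<close>, \<open>q'\<close> and the last leaf.
\<close>

lemma E_contract:
  assumes "E n p q" "E n p' q'"
  shows "\<bar>p - p'\<bar> \<le> 1 / real d ^ n \<and> \<bar>q - q'\<bar> \<le> 1 / real d ^ n"
  using assms
proof (induction n arbitrary: p q p' q')
  case 0
  have "1 / real d \<le> 1" using d2 by simp
  then show ?case using E_range[OF 0(1)] E_range[OF 0(2)] by (simp add: abs_if)
next
  case (Suc n)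
  have d0: "real d > 0" using d2 by simp
  obtain s where s: "\<And>i. i < d \<Longrightarrow> chain_link (E n) (s i) (s (Suc i))
                  (d * (chain_cuts d U p q (Suc i) - chain_cuts d U p q i))"
    and st: "\<And>i. i \<in> {1..<d} \<Longrightarrow> s i = t i"
    using E_step[OF Suc.prems(1)] by metis
  obtain s' where s': "\<And>i. i < d \<Longrightarrow> chain_link (E n) (s' i) (s' (Suc i))
                  (d * (chain_cuts d U p' q' (Suc i) - chain_cuts d U p' q' i))"
    and st': "\<And>i. i \<in> {1..<d} \<Longrightarrow> s' i = t i"
    using E_step[OF Suc.prems(2)] by metis
  have e1: "s 1 = s' 1" and e2: "s (d - 1) = s' (d - 1)"
    using st st' d2 by auto
  have nE: False if "E n x y" "E n y z" for x y z
    using E_range[OF that(1)] E_range[OF that(2)] AB by linarith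
  have "\<bar>real d * (p - p')\<bar> = \<bar>s 0 - s' 0\<bar> \<and> \<bar>s 0 - s' 0\<bar> \<le> 1 / real d ^ n"
  proof -
    have 0: "0 < d" "Suc 0 \<noteq> d" "Suc 0 < d" using d2 by auto
    note a = s[OF 0(1)] and b = s'[OF 0(1)]
    from a b show ?thesis unfolding chain_link_def chain_cuts_def
    proof (elim disjE conjE, goal_cases)
      case 1 then show ?thesis
        using Suc.IH[OF 1(1,3)] e1 0 by (auto simp: algebra_simps)
    next
      case 2 then show ?thesis using nE e1 by (metis One_nat_def)
    next
      case 3 then show ?thesis using nE e1 by (metis One_nat_def)
    next
      case 4 then show ?thesis
        using Suc.IH[OF 4(1,3)] e1 0 by (auto simp: algebra_simps)
    qed
  qed
  moreover have "\<bar>real d * (q - q')\<bar> = \<bar>s d - s' d\<bar> \<and> \<bar>s d - s' d\<bar> \<le> 1 / real d ^ n"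
  proof -
    have 0: "d - 1 < d" "d - 1 \<noteq> 0" "Suc (d - 1) = d" "d \<noteq> 0" "d - 1 \<noteq> d" using d2 by auto
    note a = s[OF 0(1)] and b = s'[OF 0(1)]
    from a b show ?thesis unfolding chain_link_def chain_cuts_def 0(3)
    proof (elim disjE conjE, goal_cases)
      case 1
      then have "real d * (q - U (d - 1)) = s d - s (d - 1)" "real d * (q' - U (d - 1)) = s' d - s (d - 1)"
        using e2 0 by auto
      then have "real d * (q - q') = s d - s' d" unfolding right_diff_distrib by linarith
      then show ?case using Suc.IH[OF 1(1)] 1(3) e2 by metis
    next
      case 2 then show ?thesis using nE e2 by metis
    next
      case 3 then show ?thesis using nE e2 by metis
    next
      case 4
      then have "real d * (q - U (d - 1)) = 1 - (s (d - 1) - s d)" "real d * (q' - U (d - 1)) = 1 - (s (d - 1) - s' d)"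
        using e2 0 by auto
      then have "real d * (q - q') = s d - s' d" unfolding right_diff_distrib by linarith
      then show ?case using Suc.IH[OF 4(1)] 4(3) e2 by metis
    qed
  qed
  ultimately have "real d * \<bar>p - p'\<bar> \<le> 1 / real d ^ n" "real d * \<bar>q - q'\<bar> \<le> 1 / real d ^ n"
    by (auto simp: abs_mult)
  then show ?case using d0 by (auto simp: field_simps)
qed

lemma sum_alternating_sign:
  "(\<Sum>i<(m::nat). (if even i = b then 1 else - 1 :: real)) = (if even m then 0 else if b then 1 else -1)"
  by (induction m) auto

text \<open>
  With \<open>\<psi> = q - p - 1/2\<close> the pieces have the lengths \<open>(1/2 + \<psi>) / d\<close> and
  \<open>(1/2 - \<psi>) / d\<close> alternately, up to an error of order \<open>\<epsilon>\<close>. Their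
  sum is \<open>1/2 + \<psi>\<close>, but the contributions of \<open>\<psi>\<close> cancel in pairs, except
  for one of them if \<open>d\<close> is odd, so that \<open>\<psi>\<close> itself is of order
  \<open>\<epsilon>\<close>. The second claim holds because the image of \<open>p\<close> is near
  \<open>p\<close> or the image of \<open>U 1\<close>, which is about half a turn away from that of
  \<open>p\<close>, is near \<open>p\<close>.
\<close>

lemma E_geometry:
  assumes E: "E (Suc n) p q"
  defines "\<epsilon> \<equiv> 1 / real d ^ n"
  shows "i \<in> {1..<d} \<Longrightarrow> \<bar>U i - (p + i / (2 * d))\<bar> \<le> 6 * \<epsilon>"
    and "\<exists>j::int. \<bar>2 * (real d - 1) * p - j\<bar> \<le> 14 * \<epsilon>"
proof -
  define c where "c = chain_cuts d U p q"
  have d0: "real d \<ge> 2" using d2 by simp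
  have e0: "\<epsilon> \<ge> 0" by (simp add: \<epsilon>_def)
  obtain s where s: "\<And>i. i < d \<Longrightarrow> chain_link (E n) (s i) (s (Suc i)) (d * (c (Suc i) - c i))"
    and sZ: "\<And>i. i \<le> d \<Longrightarrow> d * c i - s i \<in> \<int>"
    using E_step[OF E] unfolding c_def by metis
  note s = s[unfolded chain_link_def]
  have nE: False if "E n x y" "E n y z" for x y z
    using E_range[OF that(1)] E_range[OF that(2)] AB by linarith
  define up where "up i \<longleftrightarrow> E n (s i) (s (Suc i))" for i
  have up: "up i = (even i = up 0)" if "i < d" for i
    using that
  proof (induction i)
    case (Suc i)
    have "up (Suc i) = (\<not> up i)"
      using s[of i] s[of "Suc i"] Suc.prems nE unfolding up_def by (meson Suc_lessD)
    then show ?case using Suc by auto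
  qed auto
  define \<psi> where "\<psi> = q - p - 1/2"
  define \<sigma> where "\<sigma> i = (if even i = up 0 then 1 else - 1 :: real)" for i :: nat
  have close: "\<bar>x - p\<bar> \<le> \<epsilon>" "\<bar>y - q\<bar> \<le> \<epsilon>" if "E n x y" for x y
    using E_contract[OF that E_Suc[OF E]] by (auto simp: \<epsilon>_def)
  have g: "\<bar>d * (c (Suc i) - c i) - 1/2 - \<sigma> i * \<psi>\<bar> \<le> 2 * \<epsilon>" if i: "i < d" for i
  proof (cases "up i")
    case True
    then have "d * (c (Suc i) - c i) = s (Suc i) - s i" "\<sigma> i = 1"
      using s[OF i] nE up[OF i] True unfolding up_def \<sigma>_def by auto
    then show ?thesis using close[of "s i" "s (Suc i)"] True unfolding up_def \<psi>_def by (simp add: abs_if split: if_splits)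
  next
    case False
    then have "d * (c (Suc i) - c i) = 1 - (s i - s (Suc i))" "\<sigma> i = -1" "E n (s (Suc i)) (s i)"
      using s[OF i] up[OF i] False unfolding up_def \<sigma>_def by auto
    then show ?thesis using close[of "s (Suc i)" "s i"] unfolding \<psi>_def by (simp add: abs_if split: if_splits)
  qed
  have "\<bar>\<psi>\<bar> \<le> 4 * \<epsilon>"
  proof -
    have "(\<Sum>i<d. d * (c (Suc i) - c i)) = d * (q - p)"
    proof -
      have "c d = q" "c 0 = p" using d2 by (auto simp: c_def chain_cuts_def)
      then show ?thesis using sum_lessThan_telescope[of c d] by (simp add: sum_distrib_left[symmetric])
    qed
    moreover have "(\<Sum>i<d. d * (c (Suc i) - c i) - 1/2 - \<sigma> i * \<psi>) =
        (\<Sum>i<d. d * (c (Suc i) - c i)) - d / 2 - (\<Sum>i<d. \<sigma> i) * \<psi>"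
      by (simp only: sum_subtractf sum_distrib_right) simp
    ultimately have "(\<Sum>i<d. d * (c (Suc i) - c i) - 1/2 - \<sigma> i * \<psi>) = d * \<psi> - (\<Sum>i<d. \<sigma> i) * \<psi>"
      by (simp add: \<psi>_def algebra_simps)
    moreover have "\<bar>\<Sum>i<d. d * (c (Suc i) - c i) - 1/2 - \<sigma> i * \<psi>\<bar> \<le> (\<Sum>i<d. 2 * \<epsilon>)"
      by (rule order_trans[OF sum_abs sum_mono]) (use g in auto)
    ultimately have "\<bar>(d - (\<Sum>i<d. \<sigma> i)) * \<psi>\<bar> \<le> d * (2 * \<epsilon>)"
      by (simp add: algebra_simps)
    \<comment> \<open>the signs cancel in pairs, and \<open>d \<le> 2 (d - 1)\<close> absorbs the remaining factor\<close>
    moreover have "(\<Sum>i<d. \<sigma> i) \<le> 1" unfolding \<sigma>_def sum_alternating_sign by auto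
    ultimately have "(real d - 1) * \<bar>\<psi>\<bar> \<le> d * (2 * \<epsilon>)"
      using d0 mult_right_mono[of "real d - 1" "d - (\<Sum>i<d. \<sigma> i)" "\<bar>\<psi>\<bar>"] by (auto simp: abs_mult)
    also have "\<dots> \<le> (2 * (real d - 1)) * (2 * \<epsilon>)"
      using d0 e0 by (intro mult_right_mono) auto
    finally have "(real d - 1) * \<bar>\<psi>\<bar> \<le> (real d - 1) * (4 * \<epsilon>)" by (simp add: algebra_simps)
    then show ?thesis using d0 by (subst (asm) mult_le_cancel_left_pos) auto
  qed
  then have g6: "\<bar>d * (c (Suc i) - c i) - 1/2\<bar> \<le> 6 * \<epsilon>" if i: "i < d" for i
    using g[OF i] by (auto simp: \<sigma>_def abs_if split: if_splits)
  have c: "\<bar>d * (c i - p) - i / 2\<bar> \<le> i * (6 * \<epsilon>)" if "i \<le> d" for i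
    using that
  proof (induction i)
    case 0 then show ?case using d2 by (simp add: c_def chain_cuts_def)
  next
    case (Suc i)
    then have "\<bar>d * (c i - p) - i / 2\<bar> \<le> i * (6 * \<epsilon>)" "\<bar>d * (c (Suc i) - c i) - 1/2\<bar> \<le> 6 * \<epsilon>"
      using g6[of i] by auto
    moreover have "d * (c (Suc i) - p) - Suc i / 2 = (d * (c i - p) - i / 2) + (d * (c (Suc i) - c i) - 1/2)"
      by (simp add: algebra_simps add_divide_distrib)
    moreover have "real (Suc i) * (6 * \<epsilon>) = i * (6 * \<epsilon>) + 6 * \<epsilon>" by (simp add: algebra_simps)
    ultimately show ?case by linarith
  qed
  show "\<bar>U i - (p + i / (2 * d))\<bar> \<le> 6 * \<epsilon>" if i: "i \<in> {1..<d}"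
  proof -
    have "d * (U i - (p + i / (2 * d))) = d * (c i - p) - i / 2" using i by (simp add: c_def chain_cuts_def field_simps)
    then have "d * \<bar>U i - (p + i / (2 * d))\<bar> \<le> i * (6 * \<epsilon>)"
      using c[of i] i by (metis abs_mult abs_of_nat atLeastLessThan_iff less_imp_le)
    also have "\<dots> \<le> d * (6 * \<epsilon>)" using i e0 by (intro mult_right_mono) auto
    finally show ?thesis using d0 by simp
  qed
  show "\<exists>j::int. \<bar>2 * (real d - 1) * p - j\<bar> \<le> 14 * \<epsilon>"
  proof (cases "up 0")
    case True
    then have "\<bar>s 0 - p\<bar> \<le> \<epsilon>" using close unfolding up_def by blast
    moreover obtain z where "d * p - s 0 = of_int z" using sZ[of 0] d2 by (auto simp: c_def chain_cuts_def elim!: Ints_cases)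
    ultimately have "\<bar>2 * (real d - 1) * p - of_int (2 * z)\<bar> \<le> 14 * \<epsilon>"
      using e0 by (simp add: algebra_simps abs_if split: if_splits)
    then show ?thesis by blast
  next
    case False
    then have "E n (s 1) (s 0)" using s[of 0] d2 unfolding up_def by auto
    then have "\<bar>s 1 - p\<bar> \<le> \<epsilon>" using close by blast
    moreover obtain z where "d * c 1 - s 1 = of_int z" using sZ[of 1] d2 by (auto elim!: Ints_cases)
    moreover have "\<bar>d * (c 1 - p) - 1/2\<bar> \<le> 6 * \<epsilon>" using c[of 1] d2 by simp
    ultimately have "\<bar>2 * (real d - 1) * p - of_int (2 * z - 1)\<bar> \<le> 14 * \<epsilon>"
      using e0 by (simp add: algebra_simps abs_if split: if_splits)
    then show ?thesis by blast
  qed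
qed

end

section \<open>Majors with parallel leaves\<close>

text \<open>
  The leaf \<open>i\<close> joins the lifts \<open>U i\<close> and \<open>W i\<close>, and the leaves are
  nested. In a primitive major the numbers \<open>d (W i - U i)\<close> are \<open>d - 1\<close> strictly
  decreasing integers between 0 and \<open>d\<close>, which forces the value \<open>d - i\<close>.
\<close>

locale parallel_leaves =
  fixes d :: nat and U W :: "nat \<Rightarrow> real"
  assumes d2: "2 \<le> d"
    and U_mono: "1 \<le> i \<Longrightarrow> i < j \<Longrightarrow> j < d \<Longrightarrow> U i < U j"
    and W_anti: "1 \<le> i \<Longrightarrow> i < j \<Longrightarrow> j < d \<Longrightarrow> W j < W i"
    and WU: "1 \<le> i \<Longrightarrow> i < d \<Longrightarrow> W i = U i + 1 - real i / real d"
begin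

definition leaf :: "nat \<Rightarrow> real set" where
  "leaf i = {frac (U i), frac (W i)}"

definition major :: "real set set" where
  "major = leaf ` {1..<d}"

lemma UW: "1 \<le> i \<Longrightarrow> i < d \<Longrightarrow> U i < W i" "1 \<le> i \<Longrightarrow> i < d \<Longrightarrow> W i < U i + 1"
proof -
  assume i: "1 \<le> i" "i < d"
  then have "0 < real i / real d" "real i / real d < 1" by auto
  then show "U i < W i" "W i < U i + 1" using WU[OF i] by linarith+
qed

lemma U_mono_le: "1 \<le> i \<Longrightarrow> i \<le> j \<Longrightarrow> j < d \<Longrightarrow> U i \<le> U j"
  using U_mono[of i j] by (cases "i = j") simp_all

lemma W_anti_le: "1 \<le> i \<Longrightarrow> i \<le> j \<Longrightarrow> j < d \<Longrightarrow> W j \<le> W i"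
  using W_anti[of i j] by (cases "i = j") simp_all

lemma outer_leaves: "U 1 \<le> U (d - 1)" "W (d - 1) \<le> W 1"
proof -
  have "1 \<le> d - 1" "d - 1 < d" using d2 by linarith+
  then show "U 1 \<le> U (d - 1)" "W (d - 1) \<le> W 1" using U_mono_le[of 1 "d - 1"] W_anti_le[of 1 "d - 1"] by simp_all
qed

lemma frac_UW_neq: "1 \<le> i \<Longrightarrow> i < d \<Longrightarrow> frac (U i) \<noteq> frac (W i)"
proof
  assume i: "1 \<le> i" "i < d" and "frac (U i) = frac (W i)"
  then have "W i - U i \<in> \<int>" by (metis frac_eq_frac_iff)
  then show False using UW[OF i] not_in_Ints_between[of 0 "W i - U i"] by simp
qed

lemma chord_fun_other:
  assumes "1 \<le> i" "i < j" "j < d" "z \<in> leaf_polygon (leaf j)"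
  shows "0 < chord_fun (U i) (W i) z"
proof -
  have o: "U i < U j" "U j < W j" "W j < W i" "W i < U i + 1"
    using U_mono W_anti UW assms by auto
  show ?thesis
    using assms(4) o unfolding leaf_def leaf_polygon_pair
    by (intro chord_fun_pos_on_chord[of z "U j" "W j"] chord_fun_pos) auto
qed

lemma leaf_polygons_disjoint:
  assumes "1 \<le> i" "i < j" "j < d"
  shows "leaf_polygon (leaf i) \<inter> leaf_polygon (leaf j) = {}"
proof -
  have "chord_fun (U i) (W i) z = 0" if "z \<in> leaf_polygon (leaf i)" for z
    using that unfolding leaf_def leaf_polygon_pair by (rule chord_fun_zero_on_chord)
  then show ?thesis using chord_fun_other[OF assms] by force
qed

lemma leaf_polygons_disjoint': "i \<in> {1..<d} \<Longrightarrow> j \<in> {1..<d} \<Longrightarrow> i \<noteq> j \<Longrightarrow>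
    leaf_polygon (leaf i) \<inter> leaf_polygon (leaf j) = {}"
  using leaf_polygons_disjoint[of i j] leaf_polygons_disjoint[of j i] by (cases i j rule: linorder_cases) auto

lemma inj_leaf: "inj_on leaf {1..<d}"
proof (rule inj_onI, rule ccontr)
  fix i j assume "i \<in> {1..<d}" "j \<in> {1..<d}" "leaf i = leaf j" "i \<noteq> j"
  then have "leaf_polygon (leaf i) = {}" using leaf_polygons_disjoint'[of i j] by simp
  then show False by (simp add: leaf_polygon_def leaf_def)
qed

lemma circle_map_leaf:
  assumes "1 \<le> i" "i < d" "x \<in> leaf i"
  shows "circle_map d x = frac (real d * U i)"
proof -
  have "real d * W i = real d * U i + of_int (int d - int i)"
    using WU[OF assms(1,2)] d2 by (simp add: field_simps)
  then have "frac (real d * W i) = frac (real d * U i)" by (simp only: frac_add_of_int_right)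
  then show ?thesis using assms(3) by (auto simp: leaf_def circle_map_frac)
qed

lemma major_primitive: "primitive_major d major"
  unfolding primitive_major_def
proof (intro conjI ballI impI)
  show "finite major" by (simp add: major_def)
  show "L \<subseteq> circle" if L: "L \<in> major" for L
    using L frac_circle unfolding major_def leaf_def by blast
  show "finite L" if "L \<in> major" for L using that by (auto simp: major_def leaf_def)
  have card: "card (leaf i) = 2" if "i \<in> {1..<d}" for i
    using that frac_UW_neq[of i] by (simp add: leaf_def)
  then show "2 \<le> card L" if "L \<in> major" for L using that by (auto simp: major_def)
  show "disjnt (leaf_polygon L) (leaf_polygon L')" if L: "L \<in> major" "L' \<in> major" "L \<noteq> L'" for L L'
  proof -
    obtain i j where "i \<in> {1..<d}" "j \<in> {1..<d}" "L = leaf i" "L' = leaf j"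
      using L(1,2) unfolding major_def by blast
    then show ?thesis using leaf_polygons_disjoint'[of i j] L(3) by (auto simp: disjnt_def)
  qed
  show "circle_map d x = circle_map d y" if L: "L \<in> major" "x \<in> L" "y \<in> L" for L x y
  proof -
    obtain i where "1 \<le> i" "i < d" "L = leaf i" using L(1) unfolding major_def by fastforce
    then show ?thesis using circle_map_leaf[of i x] circle_map_leaf[of i y] L by metis
  qed
  have "(\<Sum>L\<in>major. card L - 1) = (\<Sum>i\<in>{1..<d}. card (leaf i) - 1)"
    unfolding major_def by (rule sum.reindex_cong[OF inj_leaf refl refl])
  also have "\<dots> = (\<Sum>i\<in>{1..<d}. 1)" by (intro sum.cong) (use card in auto)
  finally show "(\<Sum>L\<in>major. card L - 1) = d - 1" by simp
qed

lemma leaf_image_leaf: "1 \<le> i \<Longrightarrow> i < d \<Longrightarrow> leaf_image d (leaf i) = frac (real d * U i)"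
  using leaf_image_eq[OF major_primitive, of "leaf i" "frac (U i)"] circle_map_leaf[of i "frac (U i)"]
  by (simp add: major_def leaf_def)

text \<open>
  The two arcs cut off by the first and the last leaf; the first one is lifted to the left of \<open>U
  1\<close>.
\<close>

definition ends :: "real \<Rightarrow> real \<Rightarrow> bool" where
  "ends p q \<longleftrightarrow> W 1 - 1 < p \<and> p < U 1 \<and> U (d - 1) < q \<and> q < W (d - 1)"

lemma ends_between:
  assumes "ends p q" "1 \<le> i" "i < d"
  shows "W i - 1 < p \<and> p < U i \<and> U i < q \<and> q < W i"
proof -
  have "U 1 \<le> U i" "U i \<le> U (d - 1)" "W (d - 1) \<le> W i" "W i \<le> W 1"
    using U_mono_le[of 1 i] U_mono_le[of i "d - 1"] W_anti_le[of 1 i] W_anti_le[of i "d - 1"] assms(2,3)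
    by simp_all
  then show ?thesis using assms(1) by (auto simp: ends_def)
qed

lemma ends_diff: "ends p q \<Longrightarrow> 0 < q - p \<and> q - p < 1"
  using outer_leaves by (auto simp: ends_def)

lemma ends_separated:
  assumes "ends p q" "1 \<le> i" "i < d"
  shows "leaf_separates (leaf i) (frac p) (frac q)"
  unfolding leaf_def using ends_between[OF assms] by (intro leaf_separates_by_chord) auto

lemma ends_chord_fun:
  assumes "ends p q" "1 \<le> i" "i < d"
  shows "chord_fun (U i) (W i) (circle_point p) < 0" "0 < chord_fun (U i) (W i) (circle_point q)"
  using ends_between[OF assms] UW[OF assms(2,3)]
  by (auto intro!: chord_fun_neg chord_fun_pos)

lemma crossings_nonempty:
  assumes "ends p q" "1 \<le> i" "i < d"
  shows "crossings (frac p) (frac q) (leaf i) \<noteq> {}" "crossings (frac q) (frac p) (leaf i) \<noteq> {}"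
proof -
  have "leaf i \<subseteq> circle" unfolding leaf_def using frac_circle by blast
  then show "crossings (frac p) (frac q) (leaf i) \<noteq> {}" "crossings (frac q) (frac p) (leaf i) \<noteq> {}"
    using leaf_separates_crossings[OF _ frac_circle frac_circle] ends_separated[OF assms]
      leaf_separates_commute by blast+
qed

text \<open>
  Seen from the line of leaf \<open>i\<close>, the leaf \<open>j\<close> lies on the same side as
  \<open>q\<close>.
\<close>

lemma crossing_time_increasing:
  assumes "ends p q" "1 \<le> i" "i < j" "j < d"
  shows "crossing_time (frac p) (frac q) (leaf i) < crossing_time (frac p) (frac q) (leaf j)"
    and "crossing_time (frac q) (frac p) (leaf j) < crossing_time (frac q) (frac p) (leaf i)"
proof -
  have i: "1 \<le> i" "i < d" and j: "1 \<le> j" "j < d" using assms by auto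
  have fin: "finite (leaf j)" by (simp add: leaf_def)
  note ne = crossings_nonempty[OF assms(1) i] crossings_nonempty[OF assms(1) j]
  show "crossing_time (frac p) (frac q) (leaf i) < crossing_time (frac p) (frac q) (leaf j)"
    using crossing_time_order_sign[of "frac p" "frac q" "U i" "W i" "leaf j"] ends_chord_fun[OF assms(1) i]
      ne fin chord_fun_other[OF assms(2-4)] by (simp add: leaf_def[of i] zero_less_mult_iff)
  show "crossing_time (frac q) (frac p) (leaf j) < crossing_time (frac q) (frac p) (leaf i)"
    using crossing_time_order_sign[of "frac q" "frac p" "U i" "W i" "leaf j"] ends_chord_fun[OF assms(1) i]
      ne fin chord_fun_other[OF assms(2-4)] by (simp add: leaf_def[of i] zero_less_mult_iff)
qed

lemma separation_vector_eq:
  assumes vec: "sorted_wrt (<) (map (crossing_time x y) xs)" "set xs = major"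
    and sep: "\<And>L. L \<in> major \<Longrightarrow> leaf_separates L x y"
  shows "separation_vector major x y = xs"
proof -
  have S: "{L \<in> major. leaf_separates L x y} = set xs" using vec(2) sep by auto
  have "sorted_key_list_of_set (crossing_time x y) (set xs) = xs"
    by (rule sorted_key_list_of_set_eqI[OF vec(1)])
  then show ?thesis unfolding separation_vector_def S .
qed

lemma separation_vector_ends:
  assumes "ends p q"
  shows "separation_vector major (frac p) (frac q) = map leaf [1..<d]"
    and "separation_vector major (frac q) (frac p) = rev (map leaf [1..<d])"
proof -
  have sep: "leaf_separates L (frac p) (frac q)" if L: "L \<in> major" for L
    using L ends_separated[OF assms] by (auto simp: major_def)
  show "separation_vector major (frac p) (frac q) = map leaf [1..<d]"
  proof (rule separation_vector_eq)
    show "sorted_wrt (<) (map (crossing_time (frac p) (frac q)) (map leaf [1..<d]))"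
      using crossing_time_increasing(1)[OF assms] by (auto simp: sorted_wrt_iff_nth_less)
  qed (use sep in \<open>auto simp: major_def\<close>)
  show "separation_vector major (frac q) (frac p) = rev (map leaf [1..<d])"
  proof (rule separation_vector_eq)
    have "sorted_wrt (>) (map (crossing_time (frac q) (frac p)) (map leaf [1..<d]))"
      using crossing_time_increasing(2)[OF assms] by (auto simp: sorted_wrt_iff_nth_less)
    then show "sorted_wrt (<) (map (crossing_time (frac q) (frac p)) (rev (map leaf [1..<d])))"
      by (simp add: rev_map[symmetric] sorted_wrt_rev del: map_map)
  qed (use sep leaf_separates_commute in \<open>auto simp: major_def\<close>)
qed

definition chain_point :: "real \<Rightarrow> real \<Rightarrow> nat \<Rightarrow> real" where
  "chain_point p q i = frac (real d * chain_cuts d U p q i)"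

text \<open>
  The geodesic crosses the leaves in the order of their indices, or in the opposite order if it is traversed
  from \<open>q\<close> to \<open>p\<close>; both give the same pairs.
\<close>

lemma thurston_targets_ends:
  assumes "ends p q"
  shows "thurston_targets d major {frac p, frac q} =
    mset (map (\<lambda>i. {chain_point p q i, chain_point p q (Suc i)}) [0..<d])"
proof -
  define ps where "ps = circle_map d (frac p) # map (leaf_image d) (map leaf [1..<d]) @ [circle_map d (frac q)]"
  have ps: "ps = map (chain_point p q) [0..<Suc d]"
  proof -
    have "[0..<d] = 0 # [Suc 0..<d]" by (rule upt_conv_Cons) (use d2 in simp)
    then have "[0..<Suc d] = 0 # [1..<d] @ [d]" by simp
    moreover have "map (chain_point p q) [1..<d] = map (leaf_image d) (map leaf [1..<d])"
      by (auto simp: chain_point_def chain_cuts_def leaf_image_leaf)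
    ultimately show ?thesis using d2
      by (simp add: ps_def chain_point_def chain_cuts_def circle_map_frac)
  qed
  define A where "A = mset (map (\<lambda>i. {chain_point p q i, chain_point p q (Suc i)}) [0..<d])"
  have A: "mset (map2 (\<lambda>p q. {p, q}) (butlast ps) (tl ps)) = A"
    unfolding zip_butlast_tl_nth A_def ps
    by (intro arg_cong[of _ _ mset] map_cong) (auto simp: nth_append simp del: upt_Suc)
  have sep: "leaf_separates (leaf i) (frac p) (frac q)" if "i \<in> {1..<d}" for i
    using ends_separated[OF assms] that by simp
  have no: "\<not> (\<exists>L\<in>major. frac p \<in> L \<and> frac q \<in> L)"
    using sep unfolding major_def leaf_separates_def by blast
  have c: "\<not> (frac p \<noteq> frac q \<and> (\<exists>L\<in>major. frac p \<in> L \<and> frac q \<in> L))"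
    "\<not> (frac q \<noteq> frac p \<and> (\<exists>L\<in>major. frac q \<in> L \<and> frac p \<in> L))"
    using no by blast+
  have 1: "pair_targets d major (frac p) (frac q) = A"
    unfolding pair_targets_def if_not_P[OF c(1)] separation_vector_ends[OF assms] ps_def[symmetric] Let_def
    by (rule A)
  have rev: "circle_map d (frac q) # map (leaf_image d) (rev (map leaf [1..<d])) @ [circle_map d (frac p)] = rev ps"
    by (simp add: ps_def rev_map)
  have 2: "pair_targets d major (frac q) (frac p) = A"
    unfolding pair_targets_def if_not_P[OF c(2)] separation_vector_ends[OF assms] rev Let_def
    using A mset_consecutive_rev[of "\<lambda>p q. {p, q}" ps] by (simp add: insert_commute)
  show ?thesis
    using 1 2 unfolding thurston_targets_def A_def[symmetric]
    by (cases "frac p \<le> frac q") (simp_all add: min_def max_def)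
qed

lemma separated_same_side:
  assumes i: "1 \<le> i" "i < d" and ab: "a \<le> b" "U i < a \<and> b < W i \<or> W i - 1 < a \<and> b < U i"
  shows "\<not> leaf_separates (leaf i) (frac a) (frac b)"
proof (rule not_leaf_separates_arc[OF _ ab(1)])
  show "leaf i \<subseteq> circle" unfolding leaf_def using frac_circle by blast
  fix t assume t: "a \<le> t" "t \<le> b"
  have "t - U i \<notin> \<int> \<and> t - W i \<notin> \<int>"
    using ab(2)
  proof
    assume "U i < a \<and> b < W i"
    then show ?thesis using not_in_Ints_between[of 0 "t - U i"] not_in_Ints_between[of "-1" "t - W i"] t UW[OF i] by simp
  next
    assume "W i - 1 < a \<and> b < U i"
    then show ?thesis using not_in_Ints_between[of "-1" "t - U i"] not_in_Ints_between[of "-1" "t - W i"] t UW[OF i] by simp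
  qed
  then show "frac t \<notin> leaf i" by (auto simp: leaf_def frac_eq_frac_iff)
qed

text \<open>
  The first leaf cuts off one arc, which contains exactly one of the two points. The last leaf has to
  separate the other point from it as well, and this point is not in the first arc.
\<close>

lemma separated_imp_ends:
  assumes xy: "x \<in> circle" "y \<in> circle" and sep: "\<And>i. 1 \<le> i \<Longrightarrow> i < d \<Longrightarrow> leaf_separates (leaf i) x y"
  obtains p q where "ends p q" "{x, y} = {frac p, frac q}"
proof -
  have one: "1 \<le> (1::nat)" "1 < d" "1 \<le> d - 1" "d - 1 < d" using d2 by auto
  obtain a where a: "W 1 - 1 \<le> a" "a < W 1" "frac a = x" using lift_exists[OF xy(1), of "W 1 - 1"] by auto
  obtain b where b: "W 1 - 1 \<le> b" "b < W 1" "frac b = y" using lift_exists[OF xy(2), of "W 1 - 1"] by auto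
  have W1: "frac (W 1 - 1) = frac (W 1)" by (metis diff_add_cancel frac_1_eq)
  have "frac a \<notin> leaf 1" "frac b \<notin> leaf 1" using sep[OF one(1,2)] a b by (auto simp: leaf_separates_def)
  then have ne: "a \<noteq> W 1 - 1" "a \<noteq> U 1" "b \<noteq> W 1 - 1" "b \<noteq> U 1"
    using W1 by (auto simp: leaf_def)
  have *: "ends a b" if ab: "W 1 - 1 < a" "a < W 1" "W 1 - 1 < b" "b < W 1" "a < b"
    and sep: "\<And>i. 1 \<le> i \<Longrightarrow> i < d \<Longrightarrow> leaf_separates (leaf i) (frac a) (frac b)"
    and ne: "a \<noteq> U 1" "b \<noteq> U 1" for a b
  proof -
    have 1: "a < U 1" "U 1 < b"
    proof -
      have *: "\<not> (U 1 < a \<and> b < W 1 \<or> W 1 - 1 < a \<and> b < U 1)"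
        using separated_same_side[OF one(1,2), of a b] sep[OF one(1,2)] ab(5) by auto
      then show "a < U 1" "U 1 < b" using ab ne by linarith+
    qed
    have o: "U 1 \<le> U (d - 1)" "W (d - 1) \<le> W 1" "U (d - 1) < W (d - 1)" "W (d - 1) < U (d - 1) + 1"
      using U_mono_le[of 1 "d - 1"] W_anti_le[of 1 "d - 1"] UW[of "d - 1"] one by simp_all
    have "frac b \<notin> leaf (d - 1)" using sep[OF one(3,4)] by (auto simp: leaf_separates_def)
    then have nb: "b \<noteq> U (d - 1)" "b \<noteq> W (d - 1)" by (auto simp: leaf_def)
    have "U (d - 1) < b"
    proof (rule ccontr)
      assume "\<not> U (d - 1) < b"
      then have "W (d - 1) - 1 < a" "b < U (d - 1)" using nb ab 1 o by auto
      then show False using separated_same_side[OF one(3,4), of a b] sep[OF one(3,4)] ab(5) by simp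
    qed
    moreover have "b < W (d - 1)"
    proof (rule ccontr)
      assume "\<not> b < W (d - 1)"
      then have "W (d - 1) - 1 < b - 1" "b - 1 \<le> a" "a < U (d - 1)" using nb ab 1 o by auto
      moreover have "frac (b - 1) = frac b" by (metis diff_add_cancel frac_1_eq)
      ultimately show False
        using separated_same_side[OF one(3,4), of "b - 1" a] sep[OF one(3,4)]
        by (auto simp: leaf_separates_commute)
    qed
    ultimately show ?thesis using ab 1 by (simp add: ends_def)
  qed
  have "a \<noteq> b"
  proof
    assume "a = b"
    have "U 1 < a \<and> a < W 1 \<or> W 1 - 1 < a \<and> a < U 1" using a ne by linarith
    then have "\<not> leaf_separates (leaf 1) (frac a) (frac b)"
      using separated_same_side[OF one(1,2), of a a] \<open>a = b\<close> by simp
    then show False using sep[OF one(1,2)] a b by simp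
  qed
  then consider "a < b" | "b < a" by linarith
  then show ?thesis
  proof cases
    case 1
    then have "ends a b" using a b ne sep by (intro *) auto
    then show ?thesis using a b by (intro that[of a b]) auto
  next
    case 2
    then have "ends b a" using a b ne sep leaf_separates_commute by (intro *) auto
    then show ?thesis using a b by (intro that[of b a]) auto
  qed
qed

text \<open>
  The lift of a point of the circle to one of the two end arcs. Both fit into one turn, so it is unique if
  it exists.
\<close>

definition lift :: "real \<Rightarrow> real" where
  "lift y = (SOME t. (W 1 - 1 < t \<and> t < U 1 \<or> U (d - 1) < t \<and> t < W (d - 1)) \<and> frac t = y)"

lemma lift_frac:
  assumes "W 1 - 1 < t \<and> t < U 1 \<or> U (d - 1) < t \<and> t < W (d - 1)"
  shows "lift (frac t) = t"
  unfolding lift_def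
proof (rule some_equality)
  have w: "W 1 - 1 < s \<and> s < W 1" if "W 1 - 1 < s \<and> s < U 1 \<or> U (d - 1) < s \<and> s < W (d - 1)" for s
    using that outer_leaves UW[of 1] d2 by auto
  fix s assume s: "(W 1 - 1 < s \<and> s < U 1 \<or> U (d - 1) < s \<and> s < W (d - 1)) \<and> frac s = frac t"
  have "s - t \<in> \<int>" using s by (simp add: frac_eq_frac_iff)
  moreover have "- 1 < s - t" "s - t < 1" using w[OF assms] w[of s] s by auto
  ultimately show "s = t"
    using not_in_Ints_between[of 0 "s - t"] not_in_Ints_between[of "-1" "s - t"] by (cases s t rule: linorder_cases) auto
qed (use assms in simp)

lemma lift_ends: "ends p q \<Longrightarrow> lift (frac p) = p" "ends p q \<Longrightarrow> lift (frac q) = q"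
  by (auto simp: ends_def intro!: lift_frac)

text \<open>
  The index is shifted by one, so that already level 0 guarantees outdegree \<open>d\<close>.
\<close>

definition full_ends :: "nat \<Rightarrow> real \<Rightarrow> real \<Rightarrow> bool" where
  "full_ends n p q \<longleftrightarrow> ends p q \<and> full_paths d major (Suc n) {frac p, frac q}"

lemma full_paths_imp_ends:
  assumes "x \<in> circle" "y \<in> circle" "full_paths d major (Suc n) {x, y}"
  obtains p q where "full_ends n p q" "{x, y} = {frac p, frac q}"
proof -
  have "leaf i \<in> major" if "1 \<le> i" "i < d" for i using that by (simp add: major_def)
  then obtain p q where "ends p q" "{x, y} = {frac p, frac q}"
    using separated_imp_ends[OF assms(1,2)] full_paths_separated(3)[OF major_primitive d2 assms] by blast
  then show ?thesis using that assms(3) by (simp only: full_ends_def)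
qed

text \<open>
  Each leaf spans \<open>1 / d\<close> less than the previous one, and this difference comprises two
  nonempty arcs.
\<close>

lemma chain_cuts_gap:
  assumes "ends p q" "i < d"
  shows "0 < real d * (chain_cuts d U p q (Suc i) - chain_cuts d U p q i)"
    and "real d * (chain_cuts d U p q (Suc i) - chain_cuts d U p q i) < 1"
proof -
  have d0: "real d > 0" using d2 by simp
  have "0 < chain_cuts d U p q (Suc i) - chain_cuts d U p q i \<and>
      chain_cuts d U p q (Suc i) - chain_cuts d U p q i < 1 / real d"
  proof -
    consider "i = 0" | "1 \<le> i" "Suc i < d" | "i = d - 1" "1 \<le> i" using assms(2) by linarith
    then show ?thesis
    proof cases
      case 1
      then show ?thesis using assms(1) WU[of 1] d2 by (simp add: chain_cuts_def ends_def)
    next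
      case 2
      have "W i - W (Suc i) = U i - U (Suc i) + 1 / real d"
        using WU[of i] WU[of "Suc i"] 2 d0 by (simp add: field_simps)
      then show ?thesis using 2 U_mono[of i "Suc i"] W_anti[of i "Suc i"] by (simp add: chain_cuts_def)
    next
      case 3
      have "W (d - 1) = U (d - 1) + 1 / real d"
        using WU[of "d - 1"] d2 d0 by (simp add: field_simps of_nat_diff)
      moreover have "Suc i = d" "i \<noteq> 0" using 3 d2 by auto
      then have "chain_cuts d U p q (Suc i) = q" "chain_cuts d U p q i = U (d - 1)"
        unfolding chain_cuts_def using 3(1) assms(2) by auto
      ultimately show ?thesis using assms(1) by (simp add: ends_def)
    qed
  qed
  then show "0 < real d * (chain_cuts d U p q (Suc i) - chain_cuts d U p q i)"
    "real d * (chain_cuts d U p q (Suc i) - chain_cuts d U p q i) < 1"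
    using d0 by (auto simp: field_simps)
qed

text \<open>
  A piece between consecutive cut points is shorter than \<open>1 / d\<close>, so the circle map sends it
  injectively onto the arc between the images of its ends.
\<close>

lemma full_ends_chain:
  assumes "full_ends (Suc n) p q"
  defines "s \<equiv> \<lambda>i. lift (chain_point p q i)"
  shows "i < d \<Longrightarrow> chain_link (full_ends n) (s i) (s (Suc i))
           (real d * (chain_cuts d U p q (Suc i) - chain_cuts d U p q i))"
    and "i \<le> d \<Longrightarrow> real d * chain_cuts d U p q i - s i \<in> \<int>"
proof -
  have e: "ends p q" and full: "full_paths d major (Suc (Suc n)) {frac p, frac q}"
    using assms(1) by (auto simp: full_ends_def simp del: full_paths.simps)
  have pair: "\<exists>a b. full_ends n a b \<and> {chain_point p q i, chain_point p q (Suc i)} = {frac a, frac b}"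
    if i: "i < d" for i
  proof -
    have "{chain_point p q i, chain_point p q (Suc i)} \<in># thurston_targets d major {frac p, frac q}"
      unfolding thurston_targets_ends[OF e] using i by auto
    then have "full_paths d major (Suc n) {chain_point p q i, chain_point p q (Suc i)}"
      using full unfolding full_paths.simps(2)[of d major "Suc n"] by blast
    then show ?thesis
      using full_paths_imp_ends[of "chain_point p q i" "chain_point p q (Suc i)" n] frac_circle
      unfolding chain_point_def by metis
  qed
  show "chain_link (full_ends n) (s i) (s (Suc i))
           (real d * (chain_cuts d U p q (Suc i) - chain_cuts d U p q i))" if i: "i < d"
  proof -
    define g where "g = real d * chain_cuts d U p q (Suc i) - real d * chain_cuts d U p q i"
    have g: "0 < g" "g < 1" using chain_cuts_gap[OF e i] by (auto simp: g_def right_diff_distrib)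
    obtain a b where ab: "full_ends n a b" "{chain_point p q i, chain_point p q (Suc i)} = {frac a, frac b}"
      using pair[OF i] by blast
    have eab: "ends a b" using ab(1) by (simp only: full_ends_def)
    consider "chain_point p q i = frac a" "chain_point p q (Suc i) = frac b"
      | "chain_point p q i = frac b" "chain_point p q (Suc i) = frac a"
      using ab(2) by (auto simp: doubleton_eq_iff)
    then have "chain_link (full_ends n) (s i) (s (Suc i)) g"
    proof cases
      case 1
      have "s i = a" "s (Suc i) = b" using 1 lift_ends[OF eab] by (simp_all add: s_def)
      moreover have "g = b - a" unfolding g_def
        using 1 g ends_diff[OF eab] unfolding chain_point_def g_def
        by (intro frac_diff_unique[where x' = a and y' = b]) auto
      ultimately show ?thesis using ab(1) by (simp add: chain_link_def)
    next
      case 2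
      have "s i = b" "s (Suc i) = a" using 2 lift_ends[OF eab] by (simp_all add: s_def)
      moreover have "g = 1 - (b - a)" unfolding g_def
        using 2 g ends_diff[OF eab] unfolding chain_point_def g_def
        by (intro frac_diff_unique[where x' = b and y' = a]) auto
      ultimately show ?thesis using ab(1) by (simp add: chain_link_def)
    qed
    then show ?thesis by (simp add: g_def right_diff_distrib)
  qed
  show "real d * chain_cuts d U p q i - s i \<in> \<int>" if i: "i \<le> d"
  proof -
    obtain k where k: "k < d" "i = k \<or> i = Suc k"
      using i d2 by (cases i) (auto simp: less_eq_Suc_le intro: that[of 0])
    obtain a b where ab: "full_ends n a b" "{chain_point p q k, chain_point p q (Suc k)} = {frac a, frac b}"
      using pair[OF k(1)] by blast
    have eab: "ends a b" using ab(1) by (simp only: full_ends_def)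
    have "chain_point p q i = frac a \<or> chain_point p q i = frac b" using ab(2) k(2) by (auto simp: doubleton_eq_iff)
    then have "frac (s i) = chain_point p q i" using lift_ends[OF eab] by (auto simp: s_def)
    then show ?thesis unfolding chain_point_def by (metis frac_eq_frac_iff)
  qed
qed

sublocale alternating_chains d "W 1 - 1" "U (d - 1)" U "\<lambda>i. lift (frac (real d * U i))" full_ends
proof
  show "2 \<le> d" by (rule d2)
  show "W 1 - 1 + 1 / real d \<le> U (d - 1)"
    using WU[of 1] outer_leaves d2 by simp
  have "W (d - 1) = U (d - 1) + 1 / real d"
    using WU[of "d - 1"] d2 by (simp add: field_simps of_nat_diff)
  then show "W 1 - 1 < p \<and> p < W 1 - 1 + 1 / real d \<and> U (d - 1) < q \<and> q < U (d - 1) + 1 / real d"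
    if "full_ends n p q" for n p q
    using that WU[of 1] d2 by (auto simp: full_ends_def ends_def simp del: full_paths.simps)
  show "full_ends n p q" if "full_ends (Suc n) p q" for n p q
    using that full_paths_Suc by (simp only: full_ends_def)
  show "\<exists>s. (\<forall>i<d. chain_link (full_ends n) (s i) (s (Suc i))
                  (d * (chain_cuts d U p q (Suc i) - chain_cuts d U p q i))) \<and>
          (\<forall>i\<in>{1..<d}. s i = lift (frac (real d * U i))) \<and> (\<forall>i\<le>d. d * chain_cuts d U p q i - s i \<in> \<int>)"
    if "full_ends (Suc n) p q" for n p q
    using full_ends_chain[OF that]
    by (intro exI[of _ "\<lambda>i. lift (chain_point p q i)"]) (auto simp: chain_point_def chain_cuts_def)
qed

text \<open>
  Some multiple of \<open>1 / (2 (d - 1))\<close> is within \<open>7 / d ^ n\<close> of \<open>p\<close>; it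
  serves as the axis, and the error \<open>6 / d ^ n\<close> of the cut points is added.
\<close>

lemma near_chebyshev:
  assumes "x \<in> circle" "y \<in> circle" "full_paths d major (Suc (Suc n)) {x, y}"
  obtains j :: int where "\<And>i. i \<in> {1..<d} \<Longrightarrow>
    \<bar>U i - (j / (2 * (real d - 1)) + i / (2 * d))\<bar> \<le> 13 / real d ^ n \<and>
    \<bar>W i - (j / (2 * (real d - 1)) + 1 - i / (2 * d))\<bar> \<le> 13 / real d ^ n"
proof -
  define \<epsilon> where "\<epsilon> = 1 / real d ^ n"
  have e0: "0 \<le> \<epsilon>" by (simp add: \<epsilon>_def)
  obtain p q where pq: "full_ends (Suc n) p q" using full_paths_imp_ends[OF assms] by blast
  obtain j :: int where j: "\<bar>2 * (real d - 1) * p - j\<bar> \<le> 14 * \<epsilon>"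
    using E_geometry(2)[OF pq] unfolding \<epsilon>_def by blast
  define a where "a = real_of_int j / (2 * (real d - 1))"
  have D: "1 \<le> real d - 1" using d2 by simp
  have "2 * (real d - 1) * (p - a) = 2 * (real d - 1) * p - j"
    using D by (simp add: a_def right_diff_distrib)
  then have "2 * (real d - 1) * \<bar>p - a\<bar> \<le> 14 * \<epsilon>" using j D by (metis abs_mult abs_of_nonneg zero_le_mult_iff zero_le_numeral order_trans zero_le_one)
  moreover have "2 * \<bar>p - a\<bar> \<le> 2 * (real d - 1) * \<bar>p - a\<bar>"
    using D by (intro mult_right_mono) auto
  ultimately have "2 * \<bar>p - a\<bar> \<le> 14 * \<epsilon>" by (rule order_trans[rotated])
  then have pa: "\<bar>p - a\<bar> \<le> 7 * \<epsilon>" by simp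
  show ?thesis
  proof (rule that[of j], unfold a_def[symmetric])
    fix i assume i: "i \<in> {1..<d}"
    have "\<bar>U i - (p + i / (2 * d))\<bar> \<le> 6 * \<epsilon>"
      using E_geometry(1)[OF pq i] by (simp add: \<epsilon>_def)
    then have u: "\<bar>U i - (a + i / (2 * d))\<bar> \<le> 13 * \<epsilon>" using pa by linarith
    have "real i / real d = i / (2 * d) + i / (2 * d)" by simp
    then have "W i - (a + 1 - i / (2 * d)) = U i - (a + i / (2 * d))" using WU[of i] i by simp
    then show "\<bar>U i - (a + i / (2 * d))\<bar> \<le> 13 / real d ^ n \<and> \<bar>W i - (a + 1 - i / (2 * d))\<bar> \<le> 13 / real d ^ n"
      using u by (simp add: \<epsilon>_def)
  qed
qed

end

text \<open>
  Each leaf has one endpoint between \<open>x\<close> and \<open>y\<close> and one between \<open>y\<close>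
  and \<open>x + 1\<close>. Chords with linked ends would cross, so the leaves are nested. As both ends have
  the same image, \<open>d\<close> times the span of a leaf is an integer in \<open>{1..<d}\<close>. These
  integers are distinct by nesting, and there are \<open>d - 1\<close> of them; they number the leaves.
\<close>

lemma separated_major_parallel:
  assumes M: "primitive_major d M" and d: "2 \<le> d" and xy: "x \<in> circle" "y \<in> circle" "x < y"
    and card: "card M = d - 1" and L2: "\<And>L. L \<in> M \<Longrightarrow> card L = 2"
    and sep: "\<And>L. L \<in> M \<Longrightarrow> leaf_separates L x y"
  obtains U W where "parallel_leaves d U W" "M = parallel_leaves.major d U W"
proof -
  note MD = primitive_majorD[OF M]
  have "\<exists>u w. L = {frac u, frac w} \<and> x < u \<and> u < y \<and> y < w \<and> w < x + 1" if L: "L \<in> M" for L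
  proof -
    obtain u w where uw: "u \<in> L" "x < u" "u < y" "frac w \<in> L" "y < w" "w < x + 1"
      using leaf_separates_endpoints[OF MD(2)[OF L] xy sep[OF L]] by blast
    have fu: "frac u = u" using uw xy by (intro frac_circle_eq) auto
    have "w - u \<notin> \<int>" using uw by (intro not_in_Ints_between[of 0]) auto
    then have "frac w \<noteq> frac u" by (simp add: frac_eq_frac_iff)
    then have "{frac u, frac w} = L"
      using uw L2[OF L] MD(3)[OF L] fu by (intro card_subset_eq) auto
    then show ?thesis using uw by blast
  qed
  then obtain u w where uw: "\<And>L. L \<in> M \<Longrightarrow> L = {frac (u L), frac (w L)} \<and> x < u L \<and> u L < y \<and> y < w L \<and> w L < x + 1"
    by metis
  have nested: "u L \<noteq> u K \<and> (u L < u K \<longrightarrow> w K < w L)" if LK: "L \<in> M" "K \<in> M" "L \<noteq> K" for L K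
  proof -
    have disj: "leaf_polygon L \<inter> leaf_polygon K = {}" using MD(5)[OF LK] by (simp add: disjnt_def)
    have pL: "leaf_polygon L = closed_segment (circle_point (u L)) (circle_point (w L))"
      using uw[OF LK(1)] leaf_polygon_pair by metis
    have pK: "leaf_polygon K = closed_segment (circle_point (u K)) (circle_point (w K))"
      using uw[OF LK(2)] leaf_polygon_pair by metis
    have ne: "u L \<noteq> u K" "w L \<noteq> w K"
      using disj ends_in_segment unfolding pL pK by (metis IntI emptyE)+
    moreover have "w K < w L" if "u L < u K"
    proof (rule ccontr)
      assume "\<not> w K < w L"
      then show False using linked_chords_cross[of "u L" "u K" "w L" "w K"] that uw[OF LK(1)] uw[OF LK(2)] ne disj
        unfolding pL pK by auto
    qed
    ultimately show ?thesis by blast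
  qed
  have "\<exists>k. 1 \<le> k \<and> k < d \<and> w L = u L + real k / real d" if L: "L \<in> M" for L
  proof -
    have "circle_map d (frac (u L)) = circle_map d (frac (w L))"
      using uw[OF L] by (intro MD(6)[OF L]) auto
    then have "real d * w L - real d * u L \<in> \<int>" by (metis circle_map_frac frac_eq_frac_iff)
    then obtain k where k: "real d * w L - real d * u L = of_int k" by (auto elim: Ints_cases)
    have "0 < w L - u L" "w L - u L < 1" using uw[OF L] by auto
    then have "real d * 0 < real d * (w L - u L)" "real d * (w L - u L) < real d * 1"
      using d by (intro mult_strict_left_mono; simp)+
    then have "0 < k" "k < int d" using k by (simp_all add: right_diff_distrib)
    moreover have "w L = u L + of_int k / real d" using k d by (simp add: field_simps)
    ultimately show ?thesis by (intro exI[of _ "nat k"]) auto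
  qed
  then obtain k where k: "\<And>L. L \<in> M \<Longrightarrow> 1 \<le> k L \<and> k L < d \<and> w L = u L + real (k L) / real d"
    by metis
  have k_less: "k K < k L" if "L \<in> M" "K \<in> M" "u L < u K" for L K
  proof -
    have "L \<noteq> K" using that by auto
    then have "real (k K) / real d < real (k L) / real d"
      using nested[of L K] that k[OF that(1)] k[OF that(2)] by simp
    then show ?thesis using d by (simp add: divide_less_cancel)
  qed
  have inj: "inj_on k M"
    by (rule inj_onI) (metis k_less less_irrefl linorder_neqE_linordered_idom nested)
  have img: "k ` M = {1..<d}"
    using k card card_image[OF inj] by (intro card_subset_eq) auto
  define lf where "lf i = the_inv_into M k (d - i)" for i
  have lf: "lf i \<in> M" "k (lf i) = d - i" if "1 \<le> i" "i < d" for i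
  proof -
    have "d - i \<in> k ` M" unfolding img using that by auto
    then show "lf i \<in> M" "k (lf i) = d - i"
      unfolding lf_def by (auto intro: the_inv_into_into[OF inj] f_the_inv_into_f[OF inj])
  qed
  have ord: "u (lf i) < u (lf j)" if "1 \<le> i" "i < j" "j < d" for i j
  proof (rule ccontr)
    assume "\<not> ?thesis"
    moreover have "lf i \<noteq> lf j" using lf(2)[of i] lf(2)[of j] that by auto
    ultimately have "u (lf j) < u (lf i)" using nested[of "lf i" "lf j"] lf(1)[of i] lf(1)[of j] that by auto
    then have "d - i < d - j" using k_less[of "lf j" "lf i"] lf[of i] lf[of j] that by auto
    then show False using that by auto
  qed
  interpret parallel_leaves d "\<lambda>i. u (lf i)" "\<lambda>i. w (lf i)"
  proof
    show "u (lf i) < u (lf j)" if "1 \<le> i" "i < j" "j < d" for i j by (rule ord[OF that])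
    show "w (lf j) < w (lf i)" if "1 \<le> i" "i < j" "j < d" for i j
      using ord[OF that] nested[of "lf i" "lf j"] lf(1)[of i] lf(1)[of j] that by fastforce
    show "w (lf i) = u (lf i) + 1 - real i / real d" if "1 \<le> i" "i < d" for i
      using k[OF lf(1)[OF that]] lf(2)[OF that] that d by (simp add: field_simps of_nat_diff)
  qed (rule d)
  have "major = lf ` {1..<d}"
    unfolding major_def leaf_def by (intro image_cong refl) (use uw lf(1) in auto)
  moreover have "lf ` {1..<d} = M"
  proof (rule card_subset_eq)
    show "finite M" by (rule MD(1))
    show "lf ` {1..<d} \<subseteq> M" using lf(1) by auto
    have "inj_on lf {1..<d}" by (rule inj_onI) (metis atLeastLessThan_iff lf(2) diff_diff_cancel less_imp_le)
    then show "card (lf ` {1..<d}) = card M" by (simp add: card_image card)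
  qed
  ultimately show ?thesis using that parallel_leaves_axioms by simp
qed

lemma full_paths_parallel:
  assumes M: "primitive_major d M" and d: "2 \<le> d" and xy: "x \<in> circle" "y \<in> circle"
    and full: "full_paths d M (Suc n) {x, y}"
  obtains U W where "parallel_leaves d U W" "M = parallel_leaves.major d U W"
proof -
  note sep = full_paths_separated[OF M d xy full]
  have "M \<noteq> {}" using sep(1) d by auto
  then obtain L where L: "L \<in> M" by blast
  have "x \<noteq> y" using sep(3)[OF L] not_leaf_separates_refl[OF primitive_majorD(2)[OF M L] xy(1)] by metis
  then consider "x < y" | "y < x" by linarith
  then show ?thesis
  proof cases
    case 1
    show ?thesis by (rule separated_major_parallel[OF M d xy 1 sep that])
  next
    case 2
    have "leaf_separates L y x" if "L \<in> M" for L using sep(3)[OF that] leaf_separates_commute by blast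
    then show ?thesis using separated_major_parallel[OF M d xy(2,1) 2 sep(1,2)] that by metis
  qed
qed

section \<open>Chebyshev majors\<close>

definition cheb_axis :: "nat \<Rightarrow> int \<Rightarrow> real" where
  "cheb_axis d j = real_of_int j / (2 * (real d - 1))"

definition cheb_U :: "nat \<Rightarrow> int \<Rightarrow> nat \<Rightarrow> real" where
  "cheb_U d j i = cheb_axis d j + real i / (2 * real d)"

text \<open>
  The mirror image of \<open>cheb_U\<close>, lifted by one turn to lie to its right.
\<close>

definition cheb_W :: "nat \<Rightarrow> int \<Rightarrow> nat \<Rightarrow> real" where
  "cheb_W d j i = cheb_axis d j + 1 - real i / (2 * real d)"

definition chebyshev_major :: "nat \<Rightarrow> int \<Rightarrow> real set set" where
  "chebyshev_major d j = (\<lambda>i. {frac (cheb_U d j i), frac (cheb_W d j i)}) ` {1..<d}"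

lemma cheb_axis_mult: "2 \<le> d \<Longrightarrow> real d * cheb_axis d j = cheb_axis d j + real_of_int j / 2"
  by (simp add: cheb_axis_def field_simps)

lemma cheb_parallel: "2 \<le> d \<Longrightarrow> parallel_leaves d (cheb_U d j) (cheb_W d j)"
  by unfold_locales (auto simp: cheb_U_def cheb_W_def divide_strict_right_mono field_simps)

lemma cheb_major_eq: "2 \<le> d \<Longrightarrow> parallel_leaves.major d (cheb_U d j) (cheb_W d j) = chebyshev_major d j"
  by (simp add: parallel_leaves.major_def[OF cheb_parallel] parallel_leaves.leaf_def[OF cheb_parallel] chebyshev_major_def cong: image_cong)

lemma cheb_primitive: "2 \<le> d \<Longrightarrow> primitive_major d (chebyshev_major d j)"
  using parallel_leaves.major_primitive[OF cheb_parallel, of d j] cheb_major_eq by simp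

lemma cheb_RPM: assumes "2 \<le> d" shows "chebyshev_major d j \<in> RPM d"
proof -
  have "cheb_U d j i \<in> \<rat>" "cheb_W d j i \<in> \<rat>" for i
    by (auto simp: cheb_U_def cheb_W_def cheb_axis_def)
  then have "frac (cheb_U d j i) \<in> \<rat>" "frac (cheb_W d j i) \<in> \<rat>" for i
    by (auto simp: frac_def)
  then have "\<forall>L\<in>chebyshev_major d j. L \<subseteq> \<rat>" unfolding chebyshev_major_def by blast
  then show ?thesis using cheb_primitive[OF assms] by (simp add: RPM_def PM_def)
qed

lemma cheb_PM: "2 \<le> d \<Longrightarrow> chebyshev_major d j \<in> PM d"
  using cheb_RPM by (simp add: RPM_def)

text \<open>
  All images of leaves are \<open>a\<close> or \<open>a + 1/2\<close>, alternately, and the axis \<open>{a,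
  a + 1/2}\<close> is invariant. So the \<open>d\<close> edges that leave the vertex \<open>{a, a +
  1/2}\<close> return to it. The other vertices are single points, from which no edge leads there.
\<close>

lemma chebyshev_entropy:
  assumes d: "2 \<le> d"
  shows "rational_core_entropy d (chebyshev_major d j) = ln d"
proof -
  define M where "M = chebyshev_major d j"
  define a where "a = cheb_axis d j"
  define B where "B = {frac a, frac (a + 1/2)}"
  have mR: "M \<in> RPM d" unfolding M_def by (rule cheb_RPM[OF d])
  then have M: "primitive_major d M" by (auto simp: RPM_def PM_def)
  interpret finite_thurston_graph d M by (rule rational_finite_thurston_graph[OF mR d])
  interpret P: parallel_leaves d "cheb_U d j" "cheb_W d j" by (rule cheb_parallel[OF d])
  have PM: "P.major = M" unfolding M_def by (rule cheb_major_eq[OF d])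
  have da: "real d * a = a + real_of_int j / 2" unfolding a_def by (rule cheb_axis_mult[OF d])
  have dU: "real d * (a + real i / (2 * real d)) = a + of_int (j + int i) / 2" for i
    using d by (simp add: distrib_left da add_divide_distrib)
  have step: "circle_map d (frac (a + of_int k / 2)) = frac (a + of_int (j + int d * k) / 2)" for k
  proof -
    have "real d * (a + of_int k / 2) = a + of_int (j + int d * k) / 2"
      by (simp add: distrib_left da add_divide_distrib)
    then show ?thesis by (simp only: circle_map_frac)
  qed
  have leaf_im: "leaf_image d (P.leaf i) = frac (a + of_int (j + int i) / 2)" if "1 \<le> i" "i < d" for i
    using P.leaf_image_leaf[OF that] dU[of i] by (simp add: cheb_U_def a_def)
  have inB: "frac (a + of_int k / 2) \<in> B" for k unfolding frac_half B_def by simp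
  have B_half: "\<exists>k. x = frac (a + of_int k / 2)" if "x \<in> B" for x
    using that unfolding B_def by (auto intro: exI[of _ 0] exI[of _ 1])
  have pB: "postcritical d M \<subseteq> B"
  proof
    fix x assume "x \<in> postcritical d M"
    then obtain n L where L: "L \<in> M" "x = (circle_map d ^^ n) (leaf_image d L)" by (auto simp: postcritical_def)
    obtain i where i: "1 \<le> i" "i < d" "L = P.leaf i" using L(1) unfolding PM[symmetric] P.major_def by auto
    have "(circle_map d ^^ n) (leaf_image d L) \<in> B"
    proof (induction n)
      case 0 then show ?case by (simp only: funpow_0 i(3) leaf_im[OF i(1,2)] inB)
    next
      case (Suc n)
      then obtain k where "(circle_map d ^^ n) (leaf_image d L) = frac (a + of_int k / 2)" using B_half by blast
      then show ?case by (simp only: funpow.simps o_apply step inB)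
    qed
    then show "x \<in> B" using L by simp
  qed
  have e: "P.ends a (a + 1/2)"
    using d by (auto simp: P.ends_def cheb_U_def cheb_W_def a_def[symmetric] of_nat_diff field_simps)
  have cp: "P.chain_point a (a + 1/2) i = frac (a + of_int (j + int i) / 2)" if "i \<le> d" for i
  proof -
    have "chain_cuts d (cheb_U d j) a (a + 1/2) i = a + real i / (2 * real d)"
      using that d by (auto simp: chain_cuts_def cheb_U_def a_def[symmetric])
    then show ?thesis unfolding P.chain_point_def by (simp only: dU)
  qed
  have lst: "map (\<lambda>i. {P.chain_point a (a + 1/2) i, P.chain_point a (a + 1/2) (Suc i)}) [0..<d] = map (\<lambda>i. B) [0..<d]"
  proof (rule map_cong[OF refl])
    fix i assume "i \<in> set [0..<d]"
    then show "{P.chain_point a (a + 1/2) i, P.chain_point a (a + 1/2) (Suc i)} = B"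
      using cp[of i] cp[of "Suc i"] half_turn_pair[of a "j + int i"] unfolding B_def
      by (simp add: add.assoc add.commute[of 1])
  qed
  have "thurston_targets d M {frac a, frac (a + 1/2)} = mset (map (\<lambda>i. B) [0..<d])"
    using P.thurston_targets_ends[OF e] unfolding PM lst .
  then have "thurston_targets d M B = mset (map (\<lambda>i. B) [0..<d])" by (simp only: B_def)
  then have cnt: "count (thurston_targets d M B) B = d" by (simp add: map_replicate_const)
  have "B \<in> thurston_vertices d M"
  proof -
    have one: "1 \<le> (1::nat)" "1 < d" using d by auto
    have p1: "frac (a + of_int (j + 1) / 2) \<in> postcritical d M"
      using postcritical_leaf_image[of "P.leaf 1" M d] leaf_im[OF one] d unfolding PM[symmetric] P.major_def by auto
    have "frac (a + of_int j / 2) \<in> postcritical d M"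
    \<comment> \<open>for \<open>d = 2\<close> the only leaf has one image; the other end of the axis is the next point of its orbit\<close>
    proof (cases "d = 2")
      case True
      have "circle_map d (frac (a + of_int (j + 1) / 2)) = frac (a + of_int (j + 2 * (j + 1)) / 2)"
        using step[of "j + 1"] True by simp
      also have "\<dots> = frac (a + of_int j / 2)" by (simp only: frac_half) auto
      finally show ?thesis using postcritical_circle_map[OF p1] by simp
    next
      case False
      then have "1 \<le> (2::nat)" "2 < d" using d by auto
      then have "frac (a + of_int (j + 2) / 2) \<in> postcritical d M"
        using postcritical_leaf_image[of "P.leaf 2" M d] leaf_im[of 2] unfolding PM[symmetric] P.major_def by auto
      moreover have "frac (a + of_int (j + 2) / 2) = frac (a + of_int j / 2)" by (simp only: frac_half) auto
      ultimately show ?thesis by simp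
    qed
    then show ?thesis using p1 half_turn_pair[of a j] unfolding thurston_vertices_def B_def by blast
  qed
  moreover have "B \<notin># thurston_targets d M q" if q: "q \<in> thurston_vertices d M" "q \<noteq> B" for q
  proof -
    obtain x y where xy: "q = {x, y}" "x \<in> postcritical d M" "y \<in> postcritical d M"
      using q(1) by (auto simp: thurston_vertices_def)
    then have "x = y" using pB q(2) unfolding B_def by auto
    have x: "x \<in> circle" using xy(2) postcritical_circle[OF M] by blast
    have "{L \<in> M. leaf_separates L x x} = {}"
      using not_leaf_separates_refl[OF primitive_majorD(2)[OF M] x] by blast
    then have "set (separation_vector M x x) = {}" using separation_vector_set(2)[OF M x x] by simp
    then have "thurston_targets d M q = {#{circle_map d x}#}"
      using \<open>x = y\<close> by (simp add: xy(1) thurston_targets_def pair_targets_def)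
    moreover have "B \<noteq> {circle_map d x}" using frac_half_neq[of a] unfolding B_def by auto
    ultimately show ?thesis by simp
  qed
  ultimately have ge: "real d \<le> spectral_radius (thurston_matrix d M)"
    using spectral_radius_ge_self_loops[of B] cnt by simp
  have "spectral_radius (thurston_matrix d M) \<le> real d"
    by (rule spectral_radius_le[OF thurston_targets_size_le[OF M d]])
  then show ?thesis using ge unfolding rational_core_entropy_def M_def by simp
qed

section \<open>Rotating Chebyshev majors\<close>

lemma cheb_axis_add: "2 \<le> d \<Longrightarrow> cheb_axis d (j + k) = cheb_axis d j + real_of_int k / (2 * (real d - 1))"
  by (simp add: cheb_axis_def add_divide_distrib)

lemma chebyshev_shift:
  assumes d: "2 \<le> d"
  shows "shift_major d (chebyshev_major d j) = chebyshev_major d (j + 2)"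
proof -
  have sh: "circle_shift d (frac x) = frac (x + 1 / (real d - 1))" for x
  proof -
    have "frac x + 1 / (real d - 1) = (x + 1 / (real d - 1)) + of_int (- \<lfloor>x\<rfloor>)" by (simp add: frac_def)
    then show ?thesis unfolding circle_shift_def by (simp only: frac_add_of_int_right)
  qed
  have a: "cheb_axis d (j + 2) = cheb_axis d j + 1 / (real d - 1)"
    using cheb_axis_add[OF d, of j 2] d by (simp add: field_simps)
  show ?thesis
    unfolding shift_major_def chebyshev_major_def image_image
    by (intro image_cong refl) (simp add: sh cheb_U_def cheb_W_def a algebra_simps)
qed

text \<open>
  Moving the axis by half a turn exchanges its two ends; this reverses the order of the leaves.
\<close>

lemma chebyshev_periodic:
  assumes d: "2 \<le> d"
  shows "chebyshev_major d (j + (int d - 1)) = chebyshev_major d j"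
proof -
  have a: "cheb_axis d (j + (int d - 1)) = cheb_axis d j + 1/2"
  proof -
    have "real_of_int (int d - 1) = real d - 1" by simp
    moreover have "(real d - 1) / (2 * (real d - 1)) = 1 / 2" using d by (intro nonzero_divide_mult_cancel_right) simp
    ultimately show ?thesis by (simp only: cheb_axis_add[OF d, of j "int d - 1"])
  qed
  have eq: "{frac (cheb_U d (j + (int d - 1)) i), frac (cheb_W d (j + (int d - 1)) i)} =
      {frac (cheb_U d j (d - i)), frac (cheb_W d j (d - i))}" if i: "i \<in> {1..<d}" for i
  proof -
    have h: "real (d - i) / (2 * real d) = 1/2 - real i / (2 * real d)"
      using i d by (simp add: of_nat_diff diff_divide_distrib)
    have "cheb_U d (j + (int d - 1)) i = cheb_W d j (d - i)"
      unfolding cheb_U_def cheb_W_def a h by simp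
    moreover have "cheb_W d (j + (int d - 1)) i = cheb_U d j (d - i) + of_int 1"
      unfolding cheb_U_def cheb_W_def a h by simp
    ultimately show ?thesis by (simp only: frac_add_of_int_right insert_commute)
  qed
  have "chebyshev_major d (j + (int d - 1)) = (\<lambda>i. {frac (cheb_U d j (d - i)), frac (cheb_W d j (d - i))}) ` {1..<d}"
    unfolding chebyshev_major_def by (intro image_cong refl eq)
  also have "\<dots> = (\<lambda>i. {frac (cheb_U d j i), frac (cheb_W d j i)}) ` (\<lambda>i. d - i) ` {1..<d}"
    by (simp add: image_image)
  also have "(\<lambda>i. d - i) ` {1..<d} = {1..<d}"
  proof
    show "{1..<d} \<subseteq> (\<lambda>i. d - i) ` {1..<d}"
    proof
      fix i assume "i \<in> {1..<d}"
      then show "i \<in> (\<lambda>i. d - i) ` {1..<d}" by (intro image_eqI[of _ _ "d - i"]) auto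
    qed
  qed auto
  finally show ?thesis by (simp add: chebyshev_major_def)
qed

lemma chebyshev_mod:
  assumes d: "2 \<le> d"
  shows "chebyshev_major d (j + k * (int d - 1)) = chebyshev_major d j"
proof -
  have n: "chebyshev_major d (j + int n * (int d - 1)) = chebyshev_major d j" for j n
  proof (induction n)
    case (Suc n)
    have "j + int (Suc n) * (int d - 1) = (j + int n * (int d - 1)) + (int d - 1)" by (simp add: algebra_simps)
    then show ?case using Suc chebyshev_periodic[OF d] by metis
  qed simp
  show ?thesis
  proof (cases "0 \<le> k")
    case True then show ?thesis using n[of j "nat k"] by simp
  next
    case False
    then have "(j + k * (int d - 1)) + int (nat (- k)) * (int d - 1) = j" by (simp add: algebra_simps)
    then show ?thesis using n[of "j + k * (int d - 1)" "nat (- k)"] by metis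
  qed
qed

text \<open>
  The two ends of every leaf are mirror images of each other, so their sum is \<open>2 a\<close> modulo 1.
\<close>

lemma chebyshev_inj:
  assumes d: "2 \<le> d" and eq: "chebyshev_major d i = chebyshev_major d j"
    and ij: "0 \<le> i" "i < int d - 1" "0 \<le> j" "j < int d - 1"
  shows "i = j"
proof -
  have sum: "frac (\<Sum>x\<in>L. x) = real_of_int j / (real d - 1)"
    if L: "L \<in> chebyshev_major d j" and j: "0 \<le> j" "j < int d - 1" for L j
  proof -
    obtain k where k: "1 \<le> k" "k < d" "L = {frac (cheb_U d j k), frac (cheb_W d j k)}"
      using L unfolding chebyshev_major_def by auto
    have ne: "frac (cheb_U d j k) \<noteq> frac (cheb_W d j k)"
      by (rule parallel_leaves.frac_UW_neq[OF cheb_parallel[OF d] k(1,2)])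
    have "(\<Sum>x\<in>L. x) = frac (cheb_U d j k) + frac (cheb_W d j k)" using ne by (simp add: k(3))
    also have "\<dots> = 2 * cheb_axis d j + of_int (1 - \<lfloor>cheb_U d j k\<rfloor> - \<lfloor>cheb_W d j k\<rfloor>)"
      by (simp add: frac_def cheb_U_def cheb_W_def)
    finally have "frac (\<Sum>x\<in>L. x) = frac (2 * cheb_axis d j)" by (simp only: frac_add_of_int_right)
    also have "2 * cheb_axis d j = real_of_int j / (real d - 1)" using d by (simp add: cheb_axis_def field_simps)
    also have "frac \<dots> = real_of_int j / (real d - 1)"
    proof -
      have "real_of_int j < real d - 1" using j by linarith
      then show ?thesis using j d by (intro frac_circle_eq) auto
    qed
    finally show ?thesis .
  qed
  have "{frac (cheb_U d i 1), frac (cheb_W d i 1)} \<in> chebyshev_major d i"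
    unfolding chebyshev_major_def using d by auto
  then have "real_of_int i / (real d - 1) = real_of_int j / (real d - 1)"
    using sum ij eq by metis
  then show ?thesis using d by simp
qed

lemma shift_power_chebyshev:
  assumes "2 \<le> d"
  shows "(shift_major d ^^ k) (chebyshev_major d j) = chebyshev_major d (j + 2 * int k)"
  by (induction k) (simp_all add: chebyshev_shift[OF assms] algebra_simps)

lemma shift_major_cancel:
  assumes "M \<subseteq> Pow circle" "M' \<subseteq> Pow circle" "shift_major d M = shift_major d M'"
  shows "M = M'"
proof -
  have "inj_on (circle_shift d) circle"
    unfolding circle_shift_def by (rule inj_onI) (erule (2) frac_add_inj)
  then have "inj_on ((`) (circle_shift d)) (Pow circle)" by (rule inj_on_image_Pow)
  then show ?thesis using assms unfolding shift_major_def by (meson inj_on_image_eq_iff)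
qed

lemma shift_major_Pow: "shift_major d M \<subseteq> Pow circle"
  unfolding shift_major_def circle_shift_def using frac_circle by blast

text \<open>
  The rotation is injective, so that negative powers of the shift can be cancelled.
\<close>

lemma shift_power_cancel:
  assumes "M \<subseteq> Pow circle" "M' \<subseteq> Pow circle" "(shift_major d ^^ k) M = (shift_major d ^^ k) M'"
  shows "M = M'"
  using assms
proof (induction k arbitrary: M M')
  case (Suc k)
  have "(shift_major d ^^ k) (shift_major d M) = (shift_major d ^^ k) (shift_major d M')"
    using Suc.prems(3) by (simp only: funpow_Suc_right o_apply)
  then have "shift_major d M = shift_major d M'"
    by (rule Suc.IH[OF shift_major_Pow shift_major_Pow])
  then show ?case by (rule shift_major_cancel[OF Suc.prems(1,2)])
qed simp

text \<open>
  Since the index matters modulo \<open>d - 1\<close>, a negative \<open>t\<close> can be replaced by a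
  nonnegative one of the same parity.
\<close>

lemma chebyshev_shift_even:
  assumes d: "2 \<le> d" and t: "even t"
  shows "\<exists>k. (shift_major d ^^ k) (chebyshev_major d i) = chebyshev_major d (i + t)"
proof
  \<comment> \<open>a multiple of \<open>2 (d - 1)\<close> is added to \<open>t\<close> to make the exponent nonnegative\<close>
  define k where "k = nat (t div 2 + \<bar>t\<bar> * (int d - 1))"
  have "\<bar>t\<bar> * 1 \<le> \<bar>t\<bar> * (int d - 1)" using d by (intro mult_left_mono) auto
  moreover have "- \<bar>t\<bar> \<le> t div 2" using t by (auto elim!: evenE simp: abs_if)
  ultimately have "0 \<le> t div 2 + \<bar>t\<bar> * (int d - 1)" by linarith
  then have "int k = t div 2 + \<bar>t\<bar> * (int d - 1)" unfolding k_def by simp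
  then have "i + 2 * int k = (i + t) + (2 * \<bar>t\<bar>) * (int d - 1)" using t by (auto simp: algebra_simps)
  then show "(shift_major d ^^ k) (chebyshev_major d i) = chebyshev_major d (i + t)"
    unfolding shift_power_chebyshev[OF d] using chebyshev_mod[OF d] by metis
qed

lemma chebyshev_shift_class:
  assumes d: "2 \<le> d"
  shows "shift_equiv d `` {chebyshev_major d i} = {chebyshev_major d (i + t) |t. even t}"
proof (intro equalityI subsetI)
  fix M assume "M \<in> shift_equiv d `` {chebyshev_major d i}"
  then obtain k where M: "M \<in> PM d" and
      "M = (shift_major d ^^ k) (chebyshev_major d i) \<or> chebyshev_major d i = (shift_major d ^^ k) M"
    by (auto simp: shift_equiv_def)
  then show "M \<in> {chebyshev_major d (i + t) |t. even t}"
  proof (elim disjE)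
    assume "M = (shift_major d ^^ k) (chebyshev_major d i)"
    then have "M = chebyshev_major d (i + 2 * int k)" by (simp only: shift_power_chebyshev[OF d])
    moreover have "even (2 * int k)" by simp
    ultimately show ?thesis by blast
  next
    assume *: "chebyshev_major d i = (shift_major d ^^ k) M"
    have "(shift_major d ^^ k) (chebyshev_major d (i + - (2 * int k))) = chebyshev_major d i"
      unfolding shift_power_chebyshev[OF d] by simp
    moreover have "N \<subseteq> Pow circle" if "N \<in> PM d" for N
      using that primitive_majorD(2) unfolding PM_def by blast
    ultimately have "M = chebyshev_major d (i + - (2 * int k))"
      using shift_power_cancel[of M "chebyshev_major d (i + - (2 * int k))"] M cheb_PM[OF d] * by metis
    moreover have "even (- (2 * int k))" by simp
    ultimately show ?thesis by blast
  qed
next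
  fix M assume "M \<in> {chebyshev_major d (i + t) |t. even t}"
  then obtain t where "even t" "M = chebyshev_major d (i + t)" by blast
  then show "M \<in> shift_equiv d `` {chebyshev_major d i}"
    using chebyshev_shift_even[OF d, of t i] cheb_PM[OF d] by (auto simp: shift_equiv_def)
qed

section \<open>Maximal entropy\<close>

lemma core_entropy_continuous_at:
  assumes h: "is_core_entropy d h" and M: "M \<in> PM d" and e: "0 < e"
  obtains r where "0 < r" "\<And>m. m \<in> PM d \<Longrightarrow> PM_dist M m < r \<Longrightarrow> \<bar>h m - h M\<bar> < e"
proof -
  interpret Metric_space "PM d" PM_dist by (rule Metric_space_PM)
  have "continuous_map mtopology euclideanreal h" using h by (simp add: is_core_entropy_def)
  then have "openin mtopology {m \<in> topspace mtopology. h m \<in> ball (h M) e}"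
    by (rule openin_continuous_map_preimage) simp
  moreover have "M \<in> {m \<in> topspace mtopology. h m \<in> ball (h M) e}" using M e by simp
  ultimately obtain r where r: "0 < r" "mball M r \<subseteq> {m \<in> topspace mtopology. h m \<in> ball (h M) e}"
    unfolding openin_mtopology by blast
  show ?thesis
  proof (rule that[OF r(1)])
    fix m assume "m \<in> PM d" "PM_dist M m < r"
    then have "h m \<in> ball (h M) e" using r(2) M by (auto simp: in_mball)
    then show "\<bar>h m - h M\<bar> < e" by (simp add: dist_real_def abs_minus_commute)
  qed
qed

text \<open>
  The entropy of \<open>M\<close> is approximated at rational majors whose leaves are displaced leaves of
  \<open>M\<close>, so that geometric information passes to \<open>M\<close>.
\<close>

lemma core_entropy_near_rational:
  assumes h: "is_core_entropy d h" and d: "2 \<le> d" and M: "M \<in> PM d" and e: "0 < e"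
  obtains m where "m \<in> RPM d" "\<bar>rational_core_entropy d m - h M\<bar> < e"
    "\<And>L. L \<in> M \<Longrightarrow> \<exists>K\<in>m. \<forall>x\<in>L. \<exists>y\<in>K. arc_dist x y \<le> e"
proof -
  obtain r where r: "0 < r" "\<And>m. m \<in> PM d \<Longrightarrow> PM_dist M m < r \<Longrightarrow> \<bar>h m - h M\<bar> < e"
    using core_entropy_continuous_at[OF h M e] by blast
  obtain m where m: "m \<in> RPM d" "PM_dist M m \<le> min (r / 2) e"
      "\<And>L. L \<in> M \<Longrightarrow> \<exists>K\<in>m. \<forall>x\<in>L. \<exists>y\<in>K. arc_dist x y \<le> min (r / 2) e"
    using rational_majors_dense[OF d M, of "min (r / 2) e"] r(1) e by auto
  have "h m = rational_core_entropy d m" using h m(1) by (simp add: is_core_entropy_def)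
  moreover have "m \<in> PM d" using m(1) by (simp add: RPM_def)
  ultimately have "\<bar>rational_core_entropy d m - h M\<bar> < e" using r(2)[of m] m(2) r(1) by simp
  moreover have "\<exists>K\<in>m. \<forall>x\<in>L. \<exists>y\<in>K. arc_dist x y \<le> e" if "L \<in> M" for L
    using m(3)[OF that] by fastforce
  ultimately show ?thesis using that m(1) by blast
qed

lemma core_entropy_le:
  assumes h: "is_core_entropy d h" and d: "2 \<le> d" and M: "M \<in> PM d"
  shows "h M \<le> ln d"
proof (rule ccontr)
  assume "\<not> ?thesis"
  then have "0 < h M - ln d" by simp
  then obtain m where "m \<in> RPM d" "\<bar>rational_core_entropy d m - h M\<bar> < h M - ln d"
    using core_entropy_near_rational[OF h d M] by metis
  then show False using rational_entropy_le[of m d] d by auto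
qed

text \<open>
  One inclusion up to \<open>\<eta>\<close> suffices, because a leaf contained in a two-point leaf is equal
  to it.
\<close>

definition chebyshev_near :: "nat \<Rightarrow> real set set \<Rightarrow> real \<Rightarrow> int \<Rightarrow> bool" where
  "chebyshev_near d M \<eta> j \<longleftrightarrow>
     (\<forall>L\<in>M. \<exists>K\<in>chebyshev_major d j. \<forall>x\<in>L. \<exists>y\<in>K. arc_dist x y \<le> \<eta>)"

text \<open>
  Let \<open>13 / d ^ n \<le> \<eta> / 2\<close> and \<open>N = n + 2\<close>. A rational major of entropy
  above \<open>ln (d ^ N - 1) / N\<close> has a vertex from which paths meet only vertices of outdegree
  \<open>d\<close> in their first \<open>N\<close> positions; hence it is \<open>\<eta> / 2\<close>-close to
  a Chebyshev major. Such rational majors exist within \<open>\<eta> / 2\<close> of \<open>M\<close>.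
\<close>

lemma maximal_entropy_near_chebyshev:
  assumes h: "is_core_entropy d h" and d: "2 \<le> d" and M: "M \<in> PM d" and max: "h M = ln d" and \<eta>: "0 < \<eta>"
  shows "\<exists>j\<in>{0..<int d - 1}. chebyshev_near d M \<eta> j"
proof -
  obtain n where n: "(1 / real d) ^ n < \<eta> / 26"
    using real_arch_pow_inv[of "\<eta> / 26" "1 / real d"] \<eta> d by auto
  then have n13: "13 / real d ^ n \<le> \<eta> / 2" by (simp add: power_one_over field_simps)
  define N where "N = Suc (Suc n)"
  \<comment> \<open>rational majors of entropy above \<open>b\<close> have a vertex with \<open>full_paths\<close> up to \<open>N\<close>\<close>
  define b where "b = ln (real d ^ N - 1) / N"
  have dN: "1 < real d ^ N" using d unfolding N_def by (intro one_less_power) auto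
  have "ln (real d ^ N - 1) < ln (real d ^ N)"
    using dN by (subst ln_less_cancel_iff; linarith)
  also have "\<dots> = N * ln d" using d by (simp add: ln_realpow)
  finally have b: "b < ln d" by (simp add: b_def N_def field_simps)
  define e where "e = min (ln d - b) (\<eta> / 2)"
  have e: "0 < e" using b \<eta> by (simp add: e_def)
  obtain m where m: "m \<in> RPM d" "\<bar>rational_core_entropy d m - h M\<bar> < e"
      "\<And>L. L \<in> M \<Longrightarrow> \<exists>K\<in>m. \<forall>x\<in>L. \<exists>y\<in>K. arc_dist x y \<le> e"
    using core_entropy_near_rational[OF h d M e] by blast
  have pm: "primitive_major d m" using m(1) by (simp add: RPM_def PM_def)
  have "b < rational_core_entropy d m" using m(2) max unfolding e_def by linarith
  then obtain x y where xy: "x \<in> circle" "y \<in> circle" "full_paths d m N {x, y}"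
    using rational_entropy_full_paths[OF m(1) d, of N] unfolding b_def N_def by blast
  obtain U W where par: "parallel_leaves d U W" "m = parallel_leaves.major d U W"
    using full_paths_parallel[OF pm d xy(1,2)] xy(3) unfolding N_def by blast
  interpret parallel_leaves d U W by (rule par(1))
  have full: "full_paths d major (Suc (Suc n)) {x, y}" by (metis N_def par(2) xy(3))
  obtain j :: int where j: "\<And>i. i \<in> {1..<d} \<Longrightarrow>
      \<bar>U i - (j / (2 * (real d - 1)) + i / (2 * d))\<bar> \<le> 13 / real d ^ n \<and>
      \<bar>W i - (j / (2 * (real d - 1)) + 1 - i / (2 * d))\<bar> \<le> 13 / real d ^ n"
    by (rule near_chebyshev[OF xy(1,2) full]) (rule that)
  define j' where "j' = j mod (int d - 1)"
  have "chebyshev_major d j = chebyshev_major d j'"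
    using chebyshev_mod[OF d, of j' "j div (int d - 1)"] unfolding j'_def mod_div_mult_eq .
  moreover have "chebyshev_near d M \<eta> j"
    unfolding chebyshev_near_def
  proof
    fix L assume L: "L \<in> M"
    obtain K where K: "K \<in> m" "\<And>x. x \<in> L \<Longrightarrow> \<exists>y\<in>K. arc_dist x y \<le> e" using m(3)[OF L] by blast
    obtain i where i: "i \<in> {1..<d}" "K = {frac (U i), frac (W i)}"
    proof -
      have "K \<in> major" by (metis K(1) par(2))
      then show ?thesis using that unfolding major_def leaf_def by blast
    qed
    define K' where "K' = {frac (cheb_U d j i), frac (cheb_W d j i)}"
    have "\<exists>y\<in>K'. arc_dist x y \<le> \<eta>" if x: "x \<in> L" for x
    proof -
      obtain y where y: "y \<in> K" "arc_dist x y \<le> e" using K(2)[OF x] by blast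
      have "\<exists>z\<in>K'. arc_dist y z \<le> 13 / real d ^ n"
      proof -
        have "arc_dist (frac (U i)) (frac (cheb_U d j i)) \<le> 13 / real d ^ n"
          using arc_dist_frac_le[of "U i" "cheb_U d j i"] j[OF i(1)] by (simp add: cheb_U_def cheb_axis_def)
        moreover have "arc_dist (frac (W i)) (frac (cheb_W d j i)) \<le> 13 / real d ^ n"
          using arc_dist_frac_le[of "W i" "cheb_W d j i"] j[OF i(1)] by (simp add: cheb_W_def cheb_axis_def)
        ultimately show ?thesis using y(1) unfolding i(2) K'_def by blast
      qed
      then obtain z where z: "z \<in> K'" "arc_dist y z \<le> 13 / real d ^ n" by blast
      have "L \<subseteq> circle" using M L primitive_majorD(2) by (simp add: PM_def)
      then have c: "x \<in> circle" "y \<in> circle" "z \<in> circle"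
        using x y(1) z(1) frac_circle unfolding i(2) K'_def by blast+
      have "arc_dist x z \<le> \<eta>"
        using arc_dist_triangle[OF c] y(2) z(2) n13 unfolding e_def by linarith
      then show ?thesis using z(1) by blast
    qed
    moreover have "K' \<in> chebyshev_major d j" using i(1) unfolding K'_def chebyshev_major_def by blast
    ultimately show "\<exists>K\<in>chebyshev_major d j. \<forall>x\<in>L. \<exists>y\<in>K. arc_dist x y \<le> \<eta>" by blast
  qed
  ultimately have "chebyshev_near d M \<eta> j'" by (simp add: chebyshev_near_def)
  moreover have "j' \<in> {0..<int d - 1}" using d by (simp add: j'_def)
  ultimately show ?thesis by blast
qed

text \<open>
  There are finitely many Chebyshev majors, with finitely many leaves and endpoints, so one of them is
  approximated for all \<open>\<eta>\<close> at once. Its leaves contain those of \<open>M\<close>, and the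
  sum condition leaves room for no further ones.
\<close>

lemma maximal_entropy_chebyshev:
  assumes h: "is_core_entropy d h" and d: "2 \<le> d" and M: "M \<in> PM d" and max: "h M = ln d"
  shows "\<exists>j\<in>{0..<int d - 1}. M = chebyshev_major d j"
proof -
  have pm: "primitive_major d M" using M by (simp add: PM_def)
  have "\<exists>j\<in>{0..<int d - 1}. \<forall>\<eta>>0. chebyshev_near d M \<eta> j"
  proof (rule finite_limit)
    show "chebyshev_near d M \<mu> j" if "chebyshev_near d M \<nu> j" "\<nu> \<le> \<mu>" for j \<mu> \<nu>
      using that unfolding chebyshev_near_def by (meson order_trans)
  qed (use maximal_entropy_near_chebyshev[OF h d M max] in auto)
  then obtain j where j: "j \<in> {0..<int d - 1}" "\<And>\<eta>. 0 < \<eta> \<Longrightarrow> chebyshev_near d M \<eta> j" by blast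
  let ?C = "chebyshev_major d j"
  have pc: "primitive_major d ?C" by (rule cheb_primitive[OF d])
  have card_C: "card K \<le> 2" "finite K" if "K \<in> ?C" for K
    using that unfolding chebyshev_major_def by (auto simp: card_insert_if)
  have "L \<in> ?C \<and> card L = 2" if L: "L \<in> M" for L
  proof -
    have "\<exists>K\<in>?C. \<forall>\<eta>>0. \<forall>x\<in>L. \<exists>y\<in>K. arc_dist x y \<le> \<eta>"
    proof (rule finite_limit)
      show "finite ?C" by (rule primitive_majorD(1)[OF pc])
      show "\<exists>K\<in>?C. \<forall>x\<in>L. \<exists>y\<in>K. arc_dist x y \<le> \<eta>" if "0 < \<eta>" for \<eta>
        using j(2)[OF that] L unfolding chebyshev_near_def by blast
    qed (meson order_trans)
    then obtain K where K: "K \<in> ?C" "\<And>\<eta> x. 0 < \<eta> \<Longrightarrow> x \<in> L \<Longrightarrow> \<exists>y\<in>K. arc_dist x y \<le> \<eta>" by blast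
    have "L \<subseteq> K"
    proof
      fix x assume x: "x \<in> L"
      have "\<exists>y\<in>K. \<forall>\<eta>>0. arc_dist x y \<le> \<eta>"
        by (rule finite_limit) (use K card_C x in auto)
      then obtain y where y: "y \<in> K" "\<And>\<eta>. 0 < \<eta> \<Longrightarrow> arc_dist x y \<le> \<eta>" by blast
      have c: "x \<in> circle" "y \<in> circle"
        using x y(1) primitive_majorD(2)[OF pm L] primitive_majorD(2)[OF pc K(1)] by blast+
      have "x = y"
      proof (rule ccontr)
        assume "x \<noteq> y"
        then have "0 < arc_dist x y" using arc_dist_pos c by blast
        then show False using y(2)[of "arc_dist x y / 2"] by simp
      qed
      then show "x \<in> K" using y(1) by simp
    qed
    moreover have "card K \<le> card L" using card_C(1)[OF K(1)] primitive_majorD(4)[OF pm L] by simp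
    ultimately have "L = K" using card_C(2)[OF K(1)] by (simp add: card_seteq)
    then show ?thesis using K(1) card_C(1)[OF K(1)] primitive_majorD(4)[OF pm L] by simp
  qed
  then have sub: "M \<subseteq> ?C" and two: "\<And>L. L \<in> M \<Longrightarrow> card L = 2" by blast+
  have "card M = (\<Sum>L\<in>M. card L - 1)" using two by simp
  then have "card ?C \<le> card M" using primitive_majorD(7)[OF pm] card_leaves_le[OF pc] by simp
  then have "M = ?C" using card_seteq[OF primitive_majorD(1)[OF pc] sub] by simp
  then show ?thesis using j(1) by blast
qed

theorem theoremA:
  fixes d :: nat and h :: "real set set \<Rightarrow> real"
  assumes "d \<ge> 2"
    and "is_core_entropy d h"
  shows "finite (entropy_maximizers d h) \<and> card (entropy_maximizers d h) = d - 1 \<and>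
    (even d \<longrightarrow>
       (\<forall>M\<in>entropy_maximizers d h. \<forall>M'\<in>entropy_maximizers d h. (M, M') \<in> shift_equiv d)) \<and>
    (odd d \<longrightarrow>
       (\<exists>C1\<in>PM d // shift_equiv d. \<exists>C2\<in>PM d // shift_equiv d.
          C1 \<noteq> C2 \<and> entropy_maximizers d h = C1 \<union> C2))"
proof -
  note d = assms(1) and h = assms(2)
  have h_cheb: "h (chebyshev_major d j) = ln d" for j
    using h cheb_RPM[OF d] chebyshev_entropy[OF d] by (simp add: is_core_entropy_def)
  have cheb_max: "chebyshev_major d j \<in> entropy_maximizers d h" for j
    using cheb_PM[OF d] core_entropy_le[OF h d] h_cheb by (simp add: entropy_maximizers_def)
  have max_cheb: "\<exists>j\<in>{0..<int d - 1}. M = chebyshev_major d j" if M: "M \<in> entropy_maximizers d h" for M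
  proof -
    have PM: "M \<in> PM d" and ge: "h (chebyshev_major d 0) \<le> h M"
      using M cheb_PM[OF d] by (auto simp: entropy_maximizers_def)
    have "h M = ln d" using core_entropy_le[OF h d PM] ge h_cheb[of 0] by simp
    then show ?thesis by (rule maximal_entropy_chebyshev[OF h d PM])
  qed
  have eq: "entropy_maximizers d h = chebyshev_major d ` {0..<int d - 1}"
    using cheb_max max_cheb by blast
  have inj: "inj_on (chebyshev_major d) {0..<int d - 1}"
    by (rule inj_onI) (rule chebyshev_inj[OF d], auto)
  have fin: "finite (entropy_maximizers d h)" unfolding eq by simp
  have card: "card (entropy_maximizers d h) = d - 1"
    unfolding eq card_image[OF inj] using d by simp
  have in_class: "chebyshev_major d j \<in> shift_equiv d `` {chebyshev_major d i}" if "even (j - i)" for i j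
    unfolding chebyshev_shift_class[OF d]
    by (intro CollectI exI[of _ "j - i"] conjI that) simp
  then have equiv: "(chebyshev_major d i, chebyshev_major d j) \<in> shift_equiv d" if "even (j - i)" for i j
    using that by (simp only: Image_singleton_iff)
  have even_case: "(M, M') \<in> shift_equiv d"
    if e: "even d" and M: "M \<in> entropy_maximizers d h" "M' \<in> entropy_maximizers d h" for M M'
  proof -
    obtain i j where ij: "M = chebyshev_major d i" "M' = chebyshev_major d j"
      using max_cheb[OF M(1)] max_cheb[OF M(2)] by blast
    show ?thesis
    proof (cases "even (j - i)")
      case True
      then show ?thesis unfolding ij by (rule equiv)
    next
      case False
      then have "even (j + (int d - 1) - i)" using e by simp
      then have "(chebyshev_major d i, chebyshev_major d (j + (int d - 1))) \<in> shift_equiv d" by (rule equiv)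
      then show ?thesis unfolding ij chebyshev_periodic[OF d] .
    qed
  qed
  have odd_case: "\<exists>C1\<in>PM d // shift_equiv d. \<exists>C2\<in>PM d // shift_equiv d.
      C1 \<noteq> C2 \<and> entropy_maximizers d h = C1 \<union> C2" if o: "odd d"
  proof -
    let ?C = "\<lambda>i. shift_equiv d `` {chebyshev_major d i}"
    have quot: "?C 0 \<in> PM d // shift_equiv d" "?C 1 \<in> PM d // shift_equiv d"
      by (intro quotientI cheb_PM[OF d])+
    have "chebyshev_major d 0 \<in> ?C 0" by (rule in_class) simp
    moreover have "chebyshev_major d 0 \<notin> ?C 1"
    proof
      assume "chebyshev_major d 0 \<in> ?C 1"
      then obtain t where t: "even t" "chebyshev_major d 0 = chebyshev_major d (1 + t)"
        unfolding chebyshev_shift_class[OF d] by blast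
      define j where "j = (1 + t) mod (int d - 1)"
      have "chebyshev_major d (1 + t) = chebyshev_major d j"
        using chebyshev_mod[OF d, of j "(1 + t) div (int d - 1)"] unfolding j_def mod_div_mult_eq .
      then have "0 = j" using t(2) d by (intro chebyshev_inj[OF d]) (auto simp: j_def)
      then have "int d - 1 dvd 1 + t" by (simp add: j_def mod_eq_0_iff_dvd)
      moreover have "2 dvd int d - 1" using o by simp
      ultimately have "even (1 + t)" using dvd_trans by blast
      then show False using t(1) by simp
    qed
    ultimately have distinct: "?C 0 \<noteq> ?C 1" by metis
    have union: "entropy_maximizers d h = ?C 0 \<union> ?C 1"
    proof (intro equalityI subsetI)
      fix M assume "M \<in> entropy_maximizers d h"
      then obtain j where j: "M = chebyshev_major d j" using max_cheb by blast
      show "M \<in> ?C 0 \<union> ?C 1"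
      proof (cases "even j")
        case True
        then have "M \<in> ?C 0" unfolding j by (intro in_class) simp
        then show ?thesis by blast
      next
        case False
        then have "M \<in> ?C 1" unfolding j by (intro in_class) simp
        then show ?thesis by blast
      qed
    next
      fix M assume "M \<in> ?C 0 \<union> ?C 1"
      then show "M \<in> entropy_maximizers d h"
        unfolding chebyshev_shift_class[OF d] using cheb_max by blast
    qed
    show ?thesis
    proof (rule bexI[of _ "?C 0"], rule bexI[of _ "?C 1"], rule conjI)
    qed (fact distinct union quot)+
  qed
  show ?thesis using fin card even_case odd_case by blast
qed

end
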